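(* Let $X=\{X(n)\}_{n\ge0}$ be the vertex occupation process and $\pi$ the transition map described in the context. Let $p\in\mathcal D^\circ$ with $\pi(p)=p$, and let $\sigma(D\pi(p))$ be the spectrum of the $d\times d$ Jacobian matrix $D\pi(p)$. If $\operatorname{Re}\lambda\neq1$ for all $\lambda\in\sigma(D\pi(p))$ and $\operatorname{Re}\lambda>1$ for at least one $\lambda\in\sigma(D\pi(p))$, then $\mathbb P\big(\lim_{n\to\infty}X(n)=p\big)=0$.
   Context: Model. Let $m\ge1$, $[m]=\{1,\dots,m\}$, let $V^1,\dots,V^m$ be nonempty finite sets, $V=\bigcup_i V^i$, $d^i=|V^i|$, $d=\sum_i d^i$, and $I_v=\{i\in[m]: v\in V^i\}$ for $v\in V$. Parameters: $\alpha>0$, $\eta_v^i>0$ ($v\in V$, $i\in I_v$), $\rho_v^{ij}\in\mathbb R$ ($v\in V$, $i,j\in I_v$) with $\rho_v^{ij}=\rho_v^{ji}$ and $\eta_v^i>\sum_{j\in I_v:\rho_v^{ij}<0}|\rho_v^{ij}|$. Let $\triangle^i$ be the simplex of probability vectors $(x_v^i)_{v\in V^i}$ and $\mathcal D=\triangle^1\times\cdots\times\triangle^m\subset\mathbb R^d$, with points $x=(x_v^i)_{i\in[m],v\in V^i}$. Let $\mathcal D^\circ=\{x\in\mathcal D: x_v^i>0\ \forall i\in[m],v\in V^i\}$. Define $\pi=(\pi_v^i)_{i\in[m],v\in V^i}:\mathcal D\to\mathcal D$ by $$\pi_v^i(x)=\frac{x_v^iH_v^i(x)}{\sum_{w\in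 V^i}x_w^iH_w^i(x)},\qquad H_v^i(x)=\Big(\eta_v^i+\sum_{j\in I_v}\rho_v^{ij}x_v^j\Big)^\alpha .$$ The same formula defines $\pi$ smoothly in a neighbourhood of $p$ in $\mathbb R^d$; $D\pi(p)=\big(\partial\pi_v^i/\partial x_w^j(p)\big)$ is computed from this formula with all $d$ coordinates treated as independent variables. The walks $W^i(n)\in V^i$, $n\ge1$, $i\in[m]$, are random variables on a probability space such that, with $X_v^i(0)=1/d^i$, $X_v^i(n)=\frac{1}{d^i+n}\big(1+\sum_{k=1}^n\mathbf 1\{W^i(k)=v\}\big)$, $X(n)=(X_v^i(n))_{i,v}\in\mathcal D$, and $\mathcal F_n$ the $\sigma$-field generated by $W^i(k)$, $i\in[m]$, $1\le k\le n$ ($\mathcal F_0$ trivial), one has $\mathbb P(W^i(n+1)=v\mid\mathcal F_n)=\pi_v^i(X(n))$ for all $n\ge0$, and $W^1(n+1),\dots,W^m(n+1)$ are conditionally independent given $\mathcal F_n$. *)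

theory Defs
  imports
    "HOL-Probability.Probability"
    "Jordan_Normal_Form.Spectral_Radius"
begin

text \<open>
  The walks are indexed by \<open>{1..m}\<close> and \<open>V i\<close> is the vertex set of walk \<open>i\<close>. A point of
  \<open>\<real>\<^sup>d\<close> is a function \<open>nat \<times> 'v \<Rightarrow> real\<close> in \<^const>\<open>extensional\<close> \<open>(coords m V)\<close>:
  it has its \<open>d = card (coords m V)\<close> coordinates on \<open>coords m V\<close> and the fixed value
  \<^const>\<open>undefined\<close> elsewhere. On such functions equality is equality of the \<open>d\<close> coordinates,
  and the product topology of the function type is the topology of \<open>\<real>\<^sup>d\<close>.
\<close>

definition coords :: "nat \<Rightarrow> (nat \<Rightarrow> 'v set) \<Rightarrow> (nat \<times> 'v) set" where
  "coords m V = Sigma {1..m} V"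

definition walks_at :: "nat \<Rightarrow> (nat \<Rightarrow> 'v set) \<Rightarrow> 'v \<Rightarrow> nat set" where
  "walks_at m V v = {i \<in> {1..m}. v \<in> V i}"

definition simplex_prod :: "nat \<Rightarrow> (nat \<Rightarrow> 'v set) \<Rightarrow> (nat \<times> 'v \<Rightarrow> real) set" where
  "simplex_prod m V =
     {x \<in> extensional (coords m V).
        (\<forall>c \<in> coords m V. 0 \<le> x c) \<and> (\<forall>i \<in> {1..m}. (\<Sum>v\<in>V i. x (i, v)) = 1)}"

definition simplex_prod_pos :: "nat \<Rightarrow> (nat \<Rightarrow> 'v set) \<Rightarrow> (nat \<times> 'v \<Rightarrow> real) set" where
  "simplex_prod_pos m V = {x \<in> simplex_prod m V. \<forall>c \<in> coords m V. 0 < x c}"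

definition weight ::
    "nat \<Rightarrow> (nat \<Rightarrow> 'v set) \<Rightarrow> real \<Rightarrow> (nat \<Rightarrow> 'v \<Rightarrow> real) \<Rightarrow> ('v \<Rightarrow> nat \<Rightarrow> nat \<Rightarrow> real) \<Rightarrow>
     (nat \<times> 'v \<Rightarrow> real) \<Rightarrow> nat \<Rightarrow> 'v \<Rightarrow> real" where
  "weight m V \<alpha> \<eta> \<rho> x i v =
     (\<eta> i v + (\<Sum>j\<in>walks_at m V v. \<rho> v i j * x (j, v))) powr \<alpha>"

definition trans_map ::
    "nat \<Rightarrow> (nat \<Rightarrow> 'v set) \<Rightarrow> real \<Rightarrow> (nat \<Rightarrow> 'v \<Rightarrow> real) \<Rightarrow> ('v \<Rightarrow> nat \<Rightarrow> nat \<Rightarrow> real) \<Rightarrow>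
     (nat \<times> 'v \<Rightarrow> real) \<Rightarrow> (nat \<times> 'v \<Rightarrow> real)" where
  "trans_map m V \<alpha> \<eta> \<rho> x =
     (\<lambda>(i, v) \<in> coords m V. x (i, v) * weight m V \<alpha> \<eta> \<rho> x i v /
        (\<Sum>w\<in>V i. x (i, w) * weight m V \<alpha> \<eta> \<rho> x i w))"

definition partial_deriv :: "(('c \<Rightarrow> real) \<Rightarrow> real) \<Rightarrow> 'c \<Rightarrow> ('c \<Rightarrow> real) \<Rightarrow> real" where
  "partial_deriv f c x = deriv (\<lambda>t. f (x(c := t))) (x c)"

text \<open>
  Matrices are indexed by natural numbers, so the finite set of coordinates is enumerated by
  \<^const>\<open>from_nat_into\<close>, a bijection from \<open>{..<card C}\<close> onto \<open>C\<close>. Another enumeration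
  gives a matrix similar by a permutation, with the same spectrum. The entries are taken in the
  complex numbers because the spectrum is complex.
\<close>

definition jacobian_mat ::
    "'c set \<Rightarrow> (('c \<Rightarrow> real) \<Rightarrow> ('c \<Rightarrow> real)) \<Rightarrow> ('c \<Rightarrow> real) \<Rightarrow> complex mat" where
  "jacobian_mat C f x =
     mat (card C) (card C)
       (\<lambda>(k, l). complex_of_real
          (partial_deriv (\<lambda>y. f y (from_nat_into C k)) (from_nat_into C l) x))"

definition occupation ::
    "nat \<Rightarrow> (nat \<Rightarrow> 'v set) \<Rightarrow> (nat \<Rightarrow> nat \<Rightarrow> 'a \<Rightarrow> 'v) \<Rightarrow> nat \<Rightarrow> 'a \<Rightarrow> (nat \<times> 'v \<Rightarrow> real)" where
  "occupation m V W n \<omega> =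
     (\<lambda>(i, v) \<in> coords m V.
        1 / (real (card (V i)) + real n) * (1 + (\<Sum>k=1..n. of_bool (W i k \<omega> = v))))"

definition history ::
    "'a measure \<Rightarrow> nat \<Rightarrow> (nat \<Rightarrow> 'v set) \<Rightarrow> (nat \<Rightarrow> nat \<Rightarrow> 'a \<Rightarrow> 'v) \<Rightarrow> nat \<Rightarrow> 'a measure" where
  "history M m V W n =
     sigma (space M) {W i k -` A \<inter> space M |i k A. i \<in> {1..m} \<and> k \<in> {1..n} \<and> A \<subseteq> V i}"

definition cond_prob_given :: "'a measure \<Rightarrow> 'a measure \<Rightarrow> 'a set \<Rightarrow> 'a \<Rightarrow> real" where
  "cond_prob_given M F A = real_cond_exp M F (indicator A)"

text \<open>The conditional counterpart of \<^const>\<open>prob_space.indep_vars\<close>.\<close>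

definition cond_indep_vars ::
    "'a measure \<Rightarrow> 'a measure \<Rightarrow> ('i \<Rightarrow> 'b measure) \<Rightarrow> ('i \<Rightarrow> 'a \<Rightarrow> 'b) \<Rightarrow> 'i set \<Rightarrow> bool" where
  "cond_indep_vars M F N X I \<longleftrightarrow>
     (\<forall>i\<in>I. X i \<in> measurable M (N i)) \<and>
     (\<forall>J\<subseteq>I. J \<noteq> {} \<longrightarrow> finite J \<longrightarrow> (\<forall>A. (\<forall>j\<in>J. A j \<in> sets (N j)) \<longrightarrow>
        (AE \<omega> in M. cond_prob_given M F (\<Inter>j\<in>J. X j -` A j \<inter> space M) \<omega> =
           (\<Prod>j\<in>J. cond_prob_given M F (X j -` A j \<inter> space M) \<omega>))))"

end

(*
Put z = y' - y for the visit counts of two copies of the process that are started at the same time n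
from different counts y, y' near n p, and let them evolve under a coupling that makes their steps
differ only with probability O(|z| / n). The expected increment of z is close to D pi(p) z / n.

On the tangent space T of the simplices, D pi(p) = 1 + B, and because rho is symmetric B is
self-adjoint for a weighted inner product; B is invertible on T and, by the instability of p, its
quadratic form bil is positive somewhere. With a small tau > 0 the gauge
u z = sqrt (ip z z + tau bil z z) - sqrt (ip z z) is Lipschitz, homogeneous and positive exactly on
the cone bil z z > 0, where it grows at least by the factor 1 + (1 + b) / n in expectation per step.
An exponential moment of u therefore shows that, once u z is large enough, z is likely to outgrow
order n, which is impossible while both copies stay near p.

From any state two states with u z large can be reached in a fixed number K of steps, each with
probability bounded below, and at least one of these leaves the neighbourhood of p with probability
bounded below. Hence from every state at every late time the process leaves the neighbourhood with a
probability bounded below, so it almost surely does not stay there for ever.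
*)
theory Submission
  imports Defs
begin

text \<open>A single copy near \<open>p\<close> has noise of order one per step, and driving it off
  the stable directions would call for a stable manifold and a quantitative kick across it. The
  difference \<open>z\<close> of two copies needs neither: its drift is governed by D pi(p) up to a
  small multiple of |z| / n wherever the copies are in the neighbourhood, which is why strict
  differentiability is used, and its noise fades with |z|. A bounded exponent lam therefore
  suffices, since the second order term lam * O(|z| / n) is beaten by a drift of order |z| / n.

  The part 1 + 1 / n of the growth factor merely keeps pace with time, because the counts in a box
  of fixed size may differ by order n; the surplus 1 + b / n, whose product over n diverges, gives
  the contradiction. Excluding the eigenvalue 1 makes the surplus available up to the border of the
  cone: where \<open>bil z z = 0\<close> the gauge still grows, since |B z| is comparable to |z| on
  \<open>T\<close>.\<close>

section \<open>Coupling of two finite distributions, and Cauchy-Schwarz\<close>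

text \<open>The maximal coupling: the common mass \<open>min (\<mu> x) (\<nu> x)\<close> sits on the
  diagonal and the excesses are paired as a normalised product. Only the total excess
  \<open>D\<close> can land off the diagonal, and it is at most the sum of |\<mu> x - \<nu>
  x|.\<close>

lemma coupling_exists:
  fixes \<mu> \<nu> :: "'x \<Rightarrow> real"
  assumes fin: "finite \<Omega>"
    and nonneg: "\<And>x. x \<in> \<Omega> \<Longrightarrow> 0 \<le> \<mu> x" "\<And>x. x \<in> \<Omega> \<Longrightarrow> 0 \<le> \<nu> x"
    and one: "sum \<mu> \<Omega> = 1" "sum \<nu> \<Omega> = 1"
  obtains \<kappa> where "\<And>x y. x \<in> \<Omega> \<Longrightarrow> y \<in> \<Omega> \<Longrightarrow> 0 \<le> \<kappa> x y"
    and "\<And>x. x \<in> \<Omega> \<Longrightarrow> (\<Sum>y\<in>\<Omega>. \<kappa> x y) = \<mu> x"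
    and "\<And>y. y \<in> \<Omega> \<Longrightarrow> (\<Sum>x\<in>\<Omega>. \<kappa> x y) = \<nu> y"
    and "(\<Sum>x\<in>\<Omega>. \<Sum>y\<in>\<Omega>. of_bool (x \<noteq> y) * \<kappa> x y) \<le> (\<Sum>x\<in>\<Omega>. \<bar>\<mu> x - \<nu> x\<bar>)"
proof -
  define e where "e x = min (\<mu> x) (\<nu> x)" for x
  define a where "a x = \<mu> x - e x" for x
  define b where "b x = \<nu> x - e x" for x
  define D where "D = sum a \<Omega>"
  define \<kappa> where "\<kappa> x y = (if x = y then e x else 0) + a x * b y / D" for x y
  have a0: "0 \<le> a x" and b0: "0 \<le> b x" for x by (auto simp: a_def b_def e_def)
  have e0: "0 \<le> e x" if "x \<in> \<Omega>" for x using nonneg that by (auto simp: e_def)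
  have Db: "D = sum b \<Omega>" using one by (simp add: D_def a_def b_def sum_subtractf)
  have D0: "0 \<le> D" unfolding D_def by (intro sum_nonneg a0)
  \<comment> \<open>\<open>D = 0\<close> means equal distributions; then every excess is 0, in
    agreement with the value 0 that division by 0 returns.\<close>
  have aD: "a x * D / D = a x" if "x \<in> \<Omega>" for x
  proof (cases "D = 0")
    case True
    then have "a x = 0" using that sum_nonneg_eq_0_iff[OF fin, of a] a0 by (auto simp: D_def)
    then show ?thesis by simp
  qed simp
  have bD: "D * b x / D = b x" if "x \<in> \<Omega>" for x
  proof (cases "D = 0")
    case True
    then have "b x = 0" using that sum_nonneg_eq_0_iff[OF fin, of b] b0 by (auto simp: Db)
    then show ?thesis by simp
  qed simp
  have ab: "(\<Sum>y\<in>\<Omega>. a x * b y / D) = a x * D / D" for x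
    by (simp add: Db sum_distrib_left sum_divide_distrib)
  have ba: "(\<Sum>x\<in>\<Omega>. a x * b y / D) = D * b y / D" for y
    by (simp add: D_def sum_distrib_right sum_divide_distrib)
  show thesis
  proof (rule that[of \<kappa>])
    fix x y assume "x \<in> \<Omega>" "y \<in> \<Omega>"
    then show "0 \<le> \<kappa> x y" using e0 a0 b0 D0 by (simp add: \<kappa>_def)
  next
    fix x assume "x \<in> \<Omega>"
    then show "(\<Sum>y\<in>\<Omega>. \<kappa> x y) = \<mu> x"
      using fin by (simp add: \<kappa>_def sum.distrib ab aD) (simp add: a_def)
  next
    fix y assume "y \<in> \<Omega>"
    then show "(\<Sum>x\<in>\<Omega>. \<kappa> x y) = \<nu> y"
      using fin by (simp add: \<kappa>_def sum.distrib ba bD) (simp add: b_def)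
  next
    have "(\<Sum>x\<in>\<Omega>. \<Sum>y\<in>\<Omega>. of_bool (x \<noteq> y) * \<kappa> x y) \<le> (\<Sum>x\<in>\<Omega>. \<Sum>y\<in>\<Omega>. a x * b y / D)"
      using a0 b0 D0 by (intro sum_mono) (auto simp: \<kappa>_def)
    also have "\<dots> = sum a \<Omega>"
      using aD by (simp add: ab)
    also have "\<dots> \<le> (\<Sum>x\<in>\<Omega>. \<bar>\<mu> x - \<nu> x\<bar>)"
      by (intro sum_mono) (auto simp: a_def e_def)
    finally show "(\<Sum>x\<in>\<Omega>. \<Sum>y\<in>\<Omega>. of_bool (x \<noteq> y) * \<kappa> x y) \<le> (\<Sum>x\<in>\<Omega>. \<bar>\<mu> x - \<nu> x\<bar>)" .
  qed
qed

text \<open>The discriminant argument, for the three numbers of a quadratic form alone, so that it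
  serves both \<open>ip\<close> and its perturbation \<open>F\<close> in
  \<open>gauge_exists\<close>.\<close>

lemma Cauchy_Schwarz_if_nonneg_form:
  fixes a b d :: real
  assumes "\<And>s t. 0 \<le> t\<^sup>2 * a + 2 * t * s * b + s\<^sup>2 * d"
  shows "\<bar>b\<bar> \<le> sqrt a * sqrt d"
proof -
  have a: "0 \<le> a" using assms[of 1 0] by simp
  have d: "0 \<le> d" using assms[of 0 1] by simp
  have "b\<^sup>2 \<le> a * d"
  proof (cases "a = 0 \<and> d = 0")
    case True
    then show ?thesis using assms[of 1 "- b"] by (simp add: power2_eq_square)
  next
    case False
    then consider "a > 0" | "d > 0" using a d by force
    then show ?thesis
    proof cases
      case 1
      have "0 \<le> a * (a * d - b\<^sup>2)" using assms[of "- b" a]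
        by (simp add: power2_eq_square algebra_simps)
      then show ?thesis using 1 by (simp add: zero_le_mult_iff)
    next
      case 2
      have "0 \<le> d * (a * d - b\<^sup>2)" using assms[of d "- b"]
        by (simp add: power2_eq_square algebra_simps)
      then show ?thesis using 2 by (simp add: zero_le_mult_iff)
    qed
  qed
  then have "sqrt (b\<^sup>2) \<le> sqrt (a * d)" by (rule real_sqrt_le_mono)
  then show ?thesis by (simp add: real_sqrt_mult)
qed

section \<open>Strict differentiability\<close>

definition near :: "'c set \<Rightarrow> ('c \<Rightarrow> real) \<Rightarrow> real \<Rightarrow> ('c \<Rightarrow> real) set" where
  "near C p r = {x. \<forall>c\<in>C. \<bar>x c - p c\<bar> \<le> r}"

definition l1 :: "'c set \<Rightarrow> ('c \<Rightarrow> real) \<Rightarrow> real" where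
  "l1 C z = (\<Sum>c\<in>C. \<bar>z c\<bar>)"

text \<open>Strict differentiability at \<open>p\<close>: both arguments of the difference quotient move. \<open>L\<close> is
  bounded but not required to be linear.\<close>

definition strict_deriv ::
    "'c set \<Rightarrow> ('c \<Rightarrow> real) \<Rightarrow> (('c \<Rightarrow> real) \<Rightarrow> real) \<Rightarrow> (('c \<Rightarrow> real) \<Rightarrow> real) \<Rightarrow> bool" where
  "strict_deriv C p f L \<longleftrightarrow> (\<exists>K. \<forall>z. \<bar>L z\<bar> \<le> K * l1 C z) \<and>
     (\<forall>e>0. \<forall>\<^sub>F r in at_right 0. \<forall>x\<in>near C p r. \<forall>y\<in>near C p r.
        \<bar>f y - f x - L (\<lambda>c. y c - x c)\<bar> \<le> e * l1 C (\<lambda>c. y c - x c))"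

lemma strict_derivD:
  assumes "strict_deriv C p f L" "e > 0"
  shows "\<forall>\<^sub>F r in at_right 0. \<forall>x\<in>near C p r. \<forall>y\<in>near C p r.
        \<bar>f y - f x - L (\<lambda>c. y c - x c)\<bar> \<le> e * l1 C (\<lambda>c. y c - x c)"
  using assms by (simp add: strict_deriv_def)

lemma l1_nonneg [simp]: "0 \<le> l1 C z"
  by (simp add: l1_def sum_nonneg)

lemma abs_le_l1: "finite C \<Longrightarrow> c \<in> C \<Longrightarrow> \<bar>z c\<bar> \<le> l1 C z"
  unfolding l1_def by (rule member_le_sum) auto

lemma l1_triangle: "l1 C (\<lambda>c. x c + y c) \<le> l1 C x + l1 C y"
  unfolding l1_def sum.distrib[symmetric] by (intro sum_mono) simp

lemma l1_scale: "l1 C (\<lambda>c. s * x c) = \<bar>s\<bar> * l1 C x"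
  by (simp add: l1_def abs_mult sum_distrib_left)

lemma l1_cong: "(\<And>c. c \<in> C \<Longrightarrow> x c = y c) \<Longrightarrow> l1 C x = l1 C y"
  unfolding l1_def by (intro sum.cong) auto

lemma center_in_near: "0 \<le> r \<Longrightarrow> p \<in> near C p r"
  by (simp add: near_def)

lemma l1_diff_near_le:
  assumes "x \<in> near C p r" "y \<in> near C p r"
  shows "l1 C (\<lambda>c. y c - x c) \<le> real (card C) * (2 * r)"
  unfolding l1_def using assms by (intro sum_bounded_above) (fastforce simp: near_def)

lemma strict_deriv_bounded:
  assumes "strict_deriv C p f L"
  obtains K where "K > 0" "\<And>z. \<bar>L z\<bar> \<le> K * l1 C z"
proof -
  obtain K where K: "\<bar>L z\<bar> \<le> K * l1 C z" for z using assms by (auto simp: strict_deriv_def)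
  have "\<bar>L z\<bar> \<le> max 1 K * l1 C z" for z
    using K[of z] mult_right_mono[of K "max 1 K" "l1 C z"] by simp
  then show thesis using that[of "max 1 K"] by simp
qed

lemma strict_deriv_lipschitz:
  assumes "strict_deriv C p f L"
  obtains K where "K > 0" "\<And>z. \<bar>L z\<bar> \<le> K * l1 C z"
    "\<forall>\<^sub>F r in at_right 0. \<forall>x\<in>near C p r. \<forall>y\<in>near C p r. \<bar>f y - f x\<bar> \<le> K * l1 C (\<lambda>c. y c - x c)"
proof -
  obtain K where K: "K > 0" "\<And>z. \<bar>L z\<bar> \<le> K * l1 C z" by (rule strict_deriv_bounded[OF assms]) (rule that; assumption)
  have "\<forall>\<^sub>F r in at_right 0. \<forall>x\<in>near C p r. \<forall>y\<in>near C p r.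
        \<bar>f y - f x - L (\<lambda>c. y c - x c)\<bar> \<le> 1 * l1 C (\<lambda>c. y c - x c)"
    by (rule strict_derivD[OF assms]) simp
  then have "\<forall>\<^sub>F r in at_right 0. \<forall>x\<in>near C p r. \<forall>y\<in>near C p r.
        \<bar>f y - f x\<bar> \<le> (K + 1) * l1 C (\<lambda>c. y c - x c)"
  proof (rule eventually_mono, intro ballI)
    fix r x y
    assume r: "\<forall>x\<in>near C p r. \<forall>y\<in>near C p r.
        \<bar>f y - f x - L (\<lambda>c. y c - x c)\<bar> \<le> 1 * l1 C (\<lambda>c. y c - x c)"
      and xy: "x \<in> near C p r" "y \<in> near C p r"
    show "\<bar>f y - f x\<bar> \<le> (K + 1) * l1 C (\<lambda>c. y c - x c)"
      using r[rule_format, OF xy] K(2)[of "\<lambda>c. y c - x c"] by (simp add: algebra_simps)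
  qed
  moreover have "\<bar>L z\<bar> \<le> (K + 1) * l1 C z" for z
    using K(2)[of z] l1_nonneg[of C z] unfolding distrib_right by linarith
  ultimately show thesis using that[of "K + 1"] K(1) by auto
qed

lemma strict_deriv_continuous:
  assumes "strict_deriv C p f L" "e > 0"
  shows "\<forall>\<^sub>F r in at_right 0. \<forall>x\<in>near C p r. \<bar>f x - f p\<bar> \<le> e"
proof -
  obtain K where K: "K > 0" "\<And>z. \<bar>L z\<bar> \<le> K * l1 C z"
    "\<forall>\<^sub>F r in at_right 0. \<forall>x\<in>near C p r. \<forall>y\<in>near C p r. \<bar>f y - f x\<bar> \<le> K * l1 C (\<lambda>c. y c - x c)"
    by (rule strict_deriv_lipschitz[OF assms(1)]) (rule that; assumption)
  have "((\<lambda>r. K * (real (card C) * (2 * r))) \<longlongrightarrow> K * (real (card C) * (2 * 0))) (at_right 0)"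
    by (intro tendsto_intros)
  then have "\<forall>\<^sub>F r in at_right 0. K * (real (card C) * (2 * r)) < e"
    using assms(2) by (intro order_tendstoD(2)[where y = "K * (real (card C) * (2 * 0))"]) auto
  with K(3) eventually_at_right_less[of 0] show ?thesis
  proof eventually_elim
    case (elim r)
    show ?case
    proof
      fix x assume x: "x \<in> near C p r"
      have p: "p \<in> near C p r" using elim by (intro center_in_near) auto
      have "\<bar>f x - f p\<bar> \<le> K * l1 C (\<lambda>c. x c - p c)" using elim(1) p x by blast
      also have "\<dots> \<le> K * (real (card C) * (2 * r))"
        using l1_diff_near_le[OF p x] K(1) by (intro mult_left_mono) auto
      finally show "\<bar>f x - f p\<bar> \<le> e" using elim by linarith
    qed
  qed
qed

lemma strict_deriv_coord:
  assumes "finite C" "c \<in> C"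
  shows "strict_deriv C p (\<lambda>x. x c) (\<lambda>z. z c)"
  unfolding strict_deriv_def
  using assms by (intro conjI exI[of _ 1] allI impI always_eventually) (simp_all add: abs_le_l1)

lemma strict_deriv_const: "strict_deriv C p (\<lambda>x. a) (\<lambda>z. 0)"
  unfolding strict_deriv_def by (intro conjI exI[of _ 0] allI impI always_eventually) simp_all

lemma strict_deriv_add:
  assumes "strict_deriv C p f L" "strict_deriv C p g G"
  shows "strict_deriv C p (\<lambda>x. f x + g x) (\<lambda>z. L z + G z)"
  unfolding strict_deriv_def
proof (intro conjI allI impI)
  obtain K where K: "K > 0" "\<And>z. \<bar>L z\<bar> \<le> K * l1 C z" by (rule strict_deriv_bounded[OF assms(1)]) (rule that; assumption)
  obtain K' where K': "K' > 0" "\<And>z. \<bar>G z\<bar> \<le> K' * l1 C z" by (rule strict_deriv_bounded[OF assms(2)]) (rule that; assumption)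
  have "\<bar>L z + G z\<bar> \<le> (K + K') * l1 C z" for z
    using K(2)[of z] K'(2)[of z] by (simp add: algebra_simps)
  then show "\<exists>K. \<forall>z. \<bar>L z + G z\<bar> \<le> K * l1 C z" by blast
  fix e :: real assume "e > 0"
  then have "e / 2 > 0" by simp
  then have
    "\<forall>\<^sub>F r in at_right 0. \<forall>x\<in>near C p r. \<forall>y\<in>near C p r.
        \<bar>f y - f x - L (\<lambda>c. y c - x c)\<bar> \<le> e / 2 * l1 C (\<lambda>c. y c - x c)"
    "\<forall>\<^sub>F r in at_right 0. \<forall>x\<in>near C p r. \<forall>y\<in>near C p r.
        \<bar>g y - g x - G (\<lambda>c. y c - x c)\<bar> \<le> e / 2 * l1 C (\<lambda>c. y c - x c)"
    by (rule strict_derivD[OF assms(1)] strict_derivD[OF assms(2)]; assumption)+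
  then show "\<forall>\<^sub>F r in at_right 0. \<forall>x\<in>near C p r. \<forall>y\<in>near C p r.
        \<bar>f y + g y - (f x + g x) - (L (\<lambda>c. y c - x c) + G (\<lambda>c. y c - x c))\<bar>
        \<le> e * l1 C (\<lambda>c. y c - x c)"
  proof eventually_elim
    case (elim r)
    show ?case
    proof (intro ballI)
      fix x y assume "x \<in> near C p r" "y \<in> near C p r"
      with elim have "\<bar>f y - f x - L (\<lambda>c. y c - x c)\<bar> \<le> e / 2 * l1 C (\<lambda>c. y c - x c)"
        "\<bar>g y - g x - G (\<lambda>c. y c - x c)\<bar> \<le> e / 2 * l1 C (\<lambda>c. y c - x c)" by blast+
      then show "\<bar>f y + g y - (f x + g x) - (L (\<lambda>c. y c - x c) + G (\<lambda>c. y c - x c))\<bar>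
        \<le> e * l1 C (\<lambda>c. y c - x c)" by linarith
    qed
  qed
qed

text \<open>On a small ball around \<open>f p\<close> the function \<phi> t - D t has derivative at
  most \<open>e1\<close> in size, by continuity of \<phi>', so it is \<open>e1\<close>-Lipschitz
  there. Such a bound, unlike differentiability at the single point \<open>f p\<close>, lets both
  arguments move.\<close>

lemma strict_deriv_compose:
  assumes f: "strict_deriv C p f L"
    and \<phi>: "\<And>t. t \<in> S \<Longrightarrow> (\<phi> has_real_derivative \<phi>' t) (at t)" "open S" "f p \<in> S"
      "isCont \<phi>' (f p)"
  shows "strict_deriv C p (\<lambda>x. \<phi> (f x)) (\<lambda>z. \<phi>' (f p) * L z)"
  unfolding strict_deriv_def
proof (intro conjI allI impI)
  obtain K where K: "K > 0" "\<And>z. \<bar>L z\<bar> \<le> K * l1 C z"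
    "\<forall>\<^sub>F r in at_right 0. \<forall>x\<in>near C p r. \<forall>y\<in>near C p r. \<bar>f y - f x\<bar> \<le> K * l1 C (\<lambda>c. y c - x c)"
    by (rule strict_deriv_lipschitz[OF f]) (rule that; assumption)
  define D where "D = \<phi>' (f p)"
  have "\<bar>D * L z\<bar> \<le> (\<bar>D\<bar> * K) * l1 C z" for z
    using K(2)[of z] by (simp add: abs_mult mult.assoc mult_left_mono)
  then show "\<exists>K. \<forall>z. \<bar>\<phi>' (f p) * L z\<bar> \<le> K * l1 C z" unfolding D_def by blast
  fix e :: real assume e: "e > 0"
  \<comment> \<open>The error splits into e1 * K from the nonlinearity of \<phi> and (|D| + 1) * e2
    from that of \<open>f\<close>, half of e each; the 1 keeps the denominator positive.\<close>
  define e1 where "e1 = e / (2 * K)"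
  define e2 where "e2 = e / (2 * (\<bar>D\<bar> + 1))"
  have e1: "e1 > 0" and e2: "e2 > 0" using e K(1) by (auto simp: e1_def e2_def)
  obtain \<delta> where \<delta>: "\<delta> > 0" "cball (f p) \<delta> \<subseteq> S" "\<And>t. \<bar>t - f p\<bar> \<le> \<delta> \<Longrightarrow> \<bar>\<phi>' t - D\<bar> \<le> e1"
  proof -
    obtain \<delta>1 where 1: "\<delta>1 > 0" "cball (f p) \<delta>1 \<subseteq> S" using \<phi>(2,3) open_contains_cball by blast
    obtain \<delta>2 where 2: "\<delta>2 > 0" "\<And>t. dist t (f p) < \<delta>2 \<Longrightarrow> dist (\<phi>' t) D < e1"
      using \<phi>(4) e1 unfolding continuous_at_eps_delta D_def by metis
    show thesis
    proof (rule that[of "min \<delta>1 (\<delta>2 / 2)"])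
      show "cball (f p) (min \<delta>1 (\<delta>2 / 2)) \<subseteq> S" using 1 by auto
      show "\<bar>\<phi>' t - D\<bar> \<le> e1" if "\<bar>t - f p\<bar> \<le> min \<delta>1 (\<delta>2 / 2)" for t
        using 2(2)[of t] that 2(1) by (auto simp: dist_real_def)
    qed (use 1 2 in auto)
  qed
  have mvt: "\<bar>\<phi> t - \<phi> s - D * (t - s)\<bar> \<le> e1 * \<bar>t - s\<bar>" if "\<bar>s - f p\<bar> \<le> \<delta>" "\<bar>t - f p\<bar> \<le> \<delta>" for s t
  proof -
    have "norm ((\<phi> t - D * t) - (\<phi> s - D * s)) \<le> e1 * norm (t - s)"
    proof (rule field_differentiable_bound[where S = "cball (f p) \<delta>" and f' = "\<lambda>t. \<phi>' t - D"])
      show "((\<lambda>z. \<phi> z - D * z) has_field_derivative \<phi>' z - D) (at z within cball (f p) \<delta>)"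
        if "z \<in> cball (f p) \<delta>" for z
      proof -
        have "(\<phi> has_field_derivative \<phi>' z) (at z within cball (f p) \<delta>)"
          using \<delta>(2) that by (intro has_field_derivative_at_within[OF \<phi>(1)]) blast
        then show ?thesis by (auto intro!: derivative_eq_intros)
      qed
      show "norm (\<phi>' z - D) \<le> e1" if "z \<in> cball (f p) \<delta>" for z
        using \<delta>(3)[of z] that by (auto simp: dist_real_def abs_minus_commute)
    qed (use that in \<open>auto simp: dist_real_def abs_minus_commute\<close>)
    then show ?thesis by (simp add: algebra_simps)
  qed
  have "\<forall>\<^sub>F r in at_right 0. \<forall>x\<in>near C p r. \<forall>y\<in>near C p r.
        \<bar>f y - f x - L (\<lambda>c. y c - x c)\<bar> \<le> e2 * l1 C (\<lambda>c. y c - x c)"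
    by (rule strict_derivD[OF f e2])
  with K(3) strict_deriv_continuous[OF f \<delta>(1)]
  show "\<forall>\<^sub>F r in at_right 0. \<forall>x\<in>near C p r. \<forall>y\<in>near C p r.
        \<bar>\<phi> (f y) - \<phi> (f x) - \<phi>' (f p) * L (\<lambda>c. y c - x c)\<bar> \<le> e * l1 C (\<lambda>c. y c - x c)"
  proof eventually_elim
    case (elim r)
    show ?case
    proof (intro ballI)
      fix x y assume x: "x \<in> near C p r" and y: "y \<in> near C p r"
      define n where "n = l1 C (\<lambda>c. y c - x c)"
      define l where "l = L (\<lambda>c. y c - x c)"
      have "\<bar>\<phi> (f y) - \<phi> (f x) - D * (f y - f x)\<bar> \<le> e1 * \<bar>f y - f x\<bar>"
        using elim(2) x y by (intro mvt) auto
      also have "\<dots> \<le> e1 * (K * n)"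
        using elim(1) x y e1 unfolding n_def by (intro mult_left_mono) auto
      also have "\<dots> = e / 2 * n" using K(1) by (simp add: e1_def)
      finally have 1: "\<bar>\<phi> (f y) - \<phi> (f x) - D * (f y - f x)\<bar> \<le> e / 2 * n" .
      have "\<bar>D * (f y - f x) - D * l\<bar> = \<bar>D\<bar> * \<bar>f y - f x - l\<bar>"
        by (simp add: abs_mult flip: right_diff_distrib)
      also have "\<dots> \<le> (\<bar>D\<bar> + 1) * (e2 * n)"
        using elim(3) x y unfolding n_def l_def by (intro mult_mono) auto
      also have "\<dots> = e / 2 * n" by (simp add: e2_def field_simps)
      finally have 2: "\<bar>D * (f y - f x) - D * l\<bar> \<le> e / 2 * n" .
      show "\<bar>\<phi> (f y) - \<phi> (f x) - \<phi>' (f p) * L (\<lambda>c. y c - x c)\<bar> \<le> e * l1 C (\<lambda>c. y c - x c)"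
        using 1 2 unfolding D_def[symmetric] n_def[symmetric] l_def[symmetric]
        by linarith
    qed
  qed
qed

lemma strict_deriv_scale:
  assumes "strict_deriv C p f L"
  shows "strict_deriv C p (\<lambda>x. a * f x) (\<lambda>z. a * L z)"
  using strict_deriv_compose[OF assms, of UNIV "\<lambda>t. a * t" "\<lambda>_. a"]
  by (auto intro!: derivative_eq_intros)

lemma strict_deriv_sum:
  assumes "finite I" "\<And>i. i \<in> I \<Longrightarrow> strict_deriv C p (f i) (L i)"
  shows "strict_deriv C p (\<lambda>x. \<Sum>i\<in>I. f i x) (\<lambda>z. \<Sum>i\<in>I. L i z)"
  using assms
proof (induction I rule: finite_induct)
  case empty
  show ?case by (simp add: strict_deriv_const)
next
  case (insert i I)
  then show ?case using strict_deriv_add[of C p "f i" "L i"] by simp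
qed

lemma strict_deriv_cong:
  assumes "strict_deriv C p f L" and "\<forall>\<^sub>F r in at_right 0. \<forall>x\<in>near C p r. f x = g x"
  shows "strict_deriv C p g L"
  unfolding strict_deriv_def
proof (intro conjI allI impI)
  show "\<exists>K. \<forall>z. \<bar>L z\<bar> \<le> K * l1 C z" using assms(1) by (simp add: strict_deriv_def)
  fix e :: real assume "e > 0"
  then have "\<forall>\<^sub>F r in at_right 0. \<forall>x\<in>near C p r. \<forall>y\<in>near C p r.
        \<bar>f y - f x - L (\<lambda>c. y c - x c)\<bar> \<le> e * l1 C (\<lambda>c. y c - x c)"
    by (rule strict_derivD[OF assms(1)])
  with assms(2) show "\<forall>\<^sub>F r in at_right 0. \<forall>x\<in>near C p r. \<forall>y\<in>near C p r.
        \<bar>g y - g x - L (\<lambda>c. y c - x c)\<bar> \<le> e * l1 C (\<lambda>c. y c - x c)"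
    by eventually_elim auto
qed

text \<open>Fixing one argument at \<open>p\<close> and moving the other along one coordinate leaves
  an ordinary derivative. Linearity along this line is requested because \<open>strict_deriv\<close>
  does not provide it.\<close>

lemma strict_deriv_imp_partial_deriv:
  assumes f: "strict_deriv C p f L" and C: "finite C" "c \<in> C"
    and lin: "\<And>s. L (\<lambda>b. s * of_bool (b = c)) = s * l"
  shows "partial_deriv f c p = l"
proof -
  have "((\<lambda>t. f (p(c := t))) has_real_derivative l) (at (p c))"
    unfolding has_field_derivative_def has_derivative_at_alt
  proof (intro conjI allI impI)
    show "bounded_linear ((*) l)" by (rule bounded_linear_mult_right)
    fix e :: real assume e: "e > 0"
    have "\<forall>\<^sub>F r in at_right 0. 0 < r \<and> (\<forall>x\<in>near C p r. \<forall>y\<in>near C p r.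
        \<bar>f y - f x - L (\<lambda>c. y c - x c)\<bar> \<le> e * l1 C (\<lambda>c. y c - x c))"
      by (intro eventually_conj eventually_at_right_less strict_derivD[OF f e])
    then obtain r where r: "r > 0" "\<And>x y. x \<in> near C p r \<Longrightarrow> y \<in> near C p r \<Longrightarrow>
        \<bar>f y - f x - L (\<lambda>c. y c - x c)\<bar> \<le> e * l1 C (\<lambda>c. y c - x c)"
      using eventually_happens'[OF trivial_limit_at_right_real] by blast
    show "\<exists>d>0. \<forall>y. norm (y - p c) < d \<longrightarrow>
         norm (f (p(c := y)) - f (p(c := p c)) - l * (y - p c)) \<le> e * norm (y - p c)"
    proof (intro exI[of _ r] conjI allI impI r(1))
      fix y assume "norm (y - p c) < r"
      then have y: "p(c := y) \<in> near C p r" using r(1) by (auto simp: near_def)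
      have eq: "(\<lambda>b. (p(c := y)) b - p b) = (\<lambda>b. (y - p c) * of_bool (b = c))" by auto
      have "l1 C (\<lambda>b. (y - p c) * of_bool (b = c)) = (\<Sum>b\<in>C. if b = c then \<bar>y - p c\<bar> else 0)"
        unfolding l1_def by (intro sum.cong) auto
      then have "l1 C (\<lambda>b. (y - p c) * of_bool (b = c)) = \<bar>y - p c\<bar>" using C by simp
      then show "norm (f (p(c := y)) - f (p(c := p c)) - l * (y - p c)) \<le> e * norm (y - p c)"
        using r(2)[OF center_in_near y] r(1) unfolding eq lin by (simp add: mult.commute)
    qed
  qed
  then show ?thesis unfolding partial_deriv_def by (rule DERIV_imp_deriv)
qed

section \<open>Linearization at the fixed point\<close>

locale walk_model =
  fixes m :: nat and V :: "nat \<Rightarrow> 'v set" and \<alpha> :: real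
    and \<eta> :: "nat \<Rightarrow> 'v \<Rightarrow> real" and \<rho> :: "'v \<Rightarrow> nat \<Rightarrow> nat \<Rightarrow> real"
    and p :: "nat \<times> 'v \<Rightarrow> real"
  assumes m_pos: "m \<ge> 1"
    and V: "\<And>i. i \<in> {1..m} \<Longrightarrow> finite (V i) \<and> V i \<noteq> {}"
    and \<alpha>_pos: "\<alpha> > 0"
    and \<rho>_sym: "\<And>v i j. i \<in> walks_at m V v \<Longrightarrow> j \<in> walks_at m V v \<Longrightarrow> \<rho> v i j = \<rho> v j i"
    and \<eta>_\<rho>: "\<And>i v. i \<in> {1..m} \<Longrightarrow> v \<in> V i \<Longrightarrow>
           \<eta> i v > (\<Sum>j \<in> {j \<in> walks_at m V v. \<rho> v i j < 0}. \<bar>\<rho> v i j\<bar>)"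
    and p: "p \<in> simplex_prod_pos m V"
    and p_fix: "trans_map m V \<alpha> \<eta> \<rho> p = p"
begin

abbreviation C :: "(nat \<times> 'v) set" where "C \<equiv> coords m V"
abbreviation \<pi> :: "(nat \<times> 'v \<Rightarrow> real) \<Rightarrow> nat \<times> 'v \<Rightarrow> real" where "\<pi> \<equiv> trans_map m V \<alpha> \<eta> \<rho>"

definition R :: "(nat \<times> 'v \<Rightarrow> real) \<Rightarrow> nat \<times> 'v \<Rightarrow> real" where
  "R z c = (\<Sum>j\<in>walks_at m V (snd c). \<rho> (snd c) (fst c) j * z (j, snd c))"

text \<open>Unlike the H of the informal model, this is the base at \<open>p\<close> before it is
  raised to the power \<alpha>.\<close>

definition H :: "nat \<times> 'v \<Rightarrow> real" where
  "H c = \<eta> (fst c) (snd c) + R p c"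

text \<open>The part of the derivative that comes from the weights: \<alpha> R / H is the
  logarithmic derivative of a weight, and it is centred under the probability vector of the walk, as
  for every softmax.\<close>

definition B :: "(nat \<times> 'v \<Rightarrow> real) \<Rightarrow> nat \<times> 'v \<Rightarrow> real" where
  "B z c = \<alpha> * p c * (R z c / H c - (\<Sum>w\<in>V (fst c). p (fst c, w) * R z (fst c, w) / H (fst c, w)))"

text \<open>The Jacobian with all coordinates independent. The last term is the part of the
  derivative of the normaliser that vanishes on \<open>T\<close>.\<close>

definition J :: "(nat \<times> 'v \<Rightarrow> real) \<Rightarrow> nat \<times> 'v \<Rightarrow> real" where
  "J z c = z c + B z c - p c * (\<Sum>w\<in>V (fst c). z (fst c, w))"

definition T :: "(nat \<times> 'v \<Rightarrow> real) set" where
  "T = {z. \<forall>i\<in>{1..m}. (\<Sum>v\<in>V i. z (i, v)) = 0}"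

lemma finite_V: "i \<in> {1..m} \<Longrightarrow> finite (V i)"
  using V by blast

lemma finite_C: "finite C"
  unfolding coords_def using V by (intro finite_SigmaI) auto

lemma in_C: "(i, v) \<in> C \<longleftrightarrow> i \<in> {1..m} \<and> v \<in> V i"
  by (simp add: coords_def)

lemma fst_C: "c \<in> C \<Longrightarrow> fst c \<in> {1..m}"
  by (auto simp: coords_def)

lemma sum_C: "(\<Sum>c\<in>C. f c) = (\<Sum>i\<in>{1..m}. \<Sum>v\<in>V i. f (i, v))"
  unfolding coords_def using V by (subst sum.Sigma) auto

lemma walks_at_C: "j \<in> walks_at m V v \<longleftrightarrow> (j, v) \<in> C"
  by (simp add: walks_at_def coords_def)

lemma finite_walks_at: "finite (walks_at m V v)"
  by (simp add: walks_at_def)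

lemma p_pos: "c \<in> C \<Longrightarrow> 0 < p c"
  using p by (simp add: simplex_prod_pos_def)

lemma p_sum: "i \<in> {1..m} \<Longrightarrow> (\<Sum>v\<in>V i. p (i, v)) = 1"
  using p by (simp add: simplex_prod_pos_def simplex_prod_def)

lemma p_le_1: "c \<in> C \<Longrightarrow> p c \<le> 1"
proof -
  assume c: "c \<in> C"
  have "p (fst c, snd c) \<le> (\<Sum>v\<in>V (fst c). p (fst c, v))"
    using c p_pos finite_V by (intro member_le_sum) (auto simp: coords_def intro: less_imp_le)
  then show ?thesis using p_sum fst_C c by simp
qed

text \<open>As 0 \<le> p \<le> 1, only negative coefficients can lower the sum, each by at most its
  absolute value, and \<eta> exceeds their total.\<close>

lemma H_pos: "c \<in> C \<Longrightarrow> 0 < H c"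
proof -
  assume c: "c \<in> C"
  define v where "v = snd c"
  define i where "i = fst c"
  have iv: "i \<in> {1..m}" "v \<in> V i" using c by (auto simp: coords_def i_def v_def)
  have "R p c = (\<Sum>j\<in>walks_at m V v. \<rho> v i j * p (j, v))" by (simp add: R_def i_def v_def)
  also have "\<dots> \<ge> (\<Sum>j\<in>walks_at m V v. if \<rho> v i j < 0 then - \<bar>\<rho> v i j\<bar> else 0)"
  proof (rule sum_mono)
    fix j assume "j \<in> walks_at m V v"
    then have "0 \<le> p (j, v)" "p (j, v) \<le> 1" using p_pos p_le_1 by (auto simp: walks_at_C less_imp_le)
    then show "(if \<rho> v i j < 0 then - \<bar>\<rho> v i j\<bar> else 0) \<le> \<rho> v i j * p (j, v)"
      using mult_left_mono_neg[of "p (j, v)" 1 "\<rho> v i j"] by auto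
  qed
  also have "(\<Sum>j\<in>walks_at m V v. if \<rho> v i j < 0 then - \<bar>\<rho> v i j\<bar> else 0) =
      - (\<Sum>j \<in> {j \<in> walks_at m V v. \<rho> v i j < 0}. \<bar>\<rho> v i j\<bar>)"
    by (simp add: sum.inter_filter[OF finite_walks_at] sum_negf[symmetric] if_distrib cong: if_cong)
  finally show ?thesis using \<eta>_\<rho>[OF iv] by (simp add: H_def i_def v_def)
qed

lemma weight_eq: "weight m V \<alpha> \<eta> \<rho> x i v = (\<eta> i v + R x (i, v)) powr \<alpha>"
  by (simp add: weight_def R_def)

lemma trans_map_eq:
  assumes "c \<in> C"
  shows "\<pi> x c = x c * (\<eta> (fst c) (snd c) + R x c) powr \<alpha> /
     (\<Sum>w\<in>V (fst c). x (fst c, w) * (\<eta> (fst c) w + R x (fst c, w)) powr \<alpha>)"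
  using assms by (simp add: trans_map_def weight_eq case_prod_beta)

lemma H_powr_eq_sum:
  assumes "c \<in> C"
  shows "H c powr \<alpha> = (\<Sum>w\<in>V (fst c). p (fst c, w) * H (fst c, w) powr \<alpha>)" (is "_ = ?S")
proof -
  have "0 \<le> ?S" using assms p_pos by (intro sum_nonneg) (auto simp: coords_def less_imp_le)
  moreover have eq: "p c * H c powr \<alpha> / ?S = p c"
    using trans_map_eq[OF assms, of p] p_fix by (simp add: H_def)
  then have "?S \<noteq> 0" using p_pos[OF assms] by auto
  ultimately show ?thesis using eq p_pos[OF assms] by (simp add: field_simps)
qed

text \<open>At an interior fixed point the coordinate of \<open>p\<close> cancels, so every weight
  of a walk equals the normaliser of that walk; t powr \<alpha> is injective on positive t. The
  self-adjointness in \<open>ip_B\<close> rests on this.\<close>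

lemma H_const:
  assumes "i \<in> {1..m}" "v \<in> V i" "w \<in> V i"
  shows "H (i, v) = H (i, w)"
proof -
  have "H (i, v) powr \<alpha> = H (i, w) powr \<alpha>"
    using H_powr_eq_sum[of "(i, v)"] H_powr_eq_sum[of "(i, w)"] assms by (simp add: in_C)
  then have "(H (i, v) powr \<alpha>) powr (1 / \<alpha>) = (H (i, w) powr \<alpha>) powr (1 / \<alpha>)" by simp
  then show ?thesis using H_pos[of "(i, v)"] H_pos[of "(i, w)"] assms \<alpha>_pos
    by (simp add: powr_powr in_C)
qed

lemma R_lin: "R (\<lambda>c. s * x c + t * y c) c = s * R x c + t * R y c"
  by (simp add: R_def algebra_simps sum.distrib sum_distrib_left)

lemma B_lin: "B (\<lambda>c. s * x c + t * y c) c = s * B x c + t * B y c"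
  by (simp add: B_def R_lin algebra_simps sum.distrib sum_distrib_left sum_divide_distrib
      add_divide_distrib)

lemma J_lin: "J (\<lambda>c. s * x c + t * y c) c = s * J x c + t * J y c"
  by (simp add: J_def B_lin algebra_simps sum.distrib sum_distrib_left)

lemma J_on_T: "z \<in> T \<Longrightarrow> c \<in> C \<Longrightarrow> J z c = z c + B z c"
  by (auto simp: J_def T_def coords_def)

lemma sum_B: "i \<in> {1..m} \<Longrightarrow> (\<Sum>v\<in>V i. B z (i, v)) = 0"
proof -
  assume i: "i \<in> {1..m}"
  define M where "M = (\<Sum>w\<in>V i. p (i, w) * R z (i, w) / H (i, w))"
  have "(\<Sum>v\<in>V i. B z (i, v)) = (\<Sum>v\<in>V i. \<alpha> * (p (i, v) * R z (i, v) / H (i, v)) - \<alpha> * M * p (i, v))"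
    by (intro sum.cong) (auto simp: B_def M_def algebra_simps)
  also have "\<dots> = \<alpha> * M - \<alpha> * M * 1"
    unfolding sum_subtractf sum_distrib_left[symmetric] by (simp add: p_sum[OF i] M_def)
  finally show ?thesis by simp
qed

text \<open>Infinitesimally, the transition probabilities of a walk sum to the constant 1. Hence
  eigenvectors of \<open>J\<close> for nonzero eigenvalues are tangent to the simplices.\<close>

lemma sum_J: "i \<in> {1..m} \<Longrightarrow> (\<Sum>v\<in>V i. J z (i, v)) = 0"
  by (simp add: J_def sum.distrib sum_subtractf sum_B p_sum flip: sum_distrib_right)

lemma strict_deriv_R:
  shows "strict_deriv C p (\<lambda>x. R x c) (\<lambda>z. R z c)"
  unfolding R_def
  by (intro strict_deriv_sum finite_walks_at strict_deriv_scale strict_deriv_coord finite_C)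
    (simp add: walks_at_C)

lemma strict_deriv_log:
  assumes "c \<in> C"
  shows "strict_deriv C p (\<lambda>x. ln (x c) + \<alpha> * ln (\<eta> (fst c) (snd c) + R x c))
     (\<lambda>z. inverse (p c) * z c + \<alpha> * (inverse (H c) * R z c))"
proof (intro strict_deriv_add strict_deriv_scale)
  have ln: "(ln has_real_derivative inverse t) (at t)" if "t \<in> {0<..}" for t :: real
    using that by (auto intro!: derivative_eq_intros simp: divide_inverse)
  show "strict_deriv C p (\<lambda>x. ln (x c)) (\<lambda>z. inverse (p c) * z c)"
    by (rule strict_deriv_compose[where S = "{0<..}" and \<phi> = ln and \<phi>' = inverse])
      (use ln p_pos[OF assms] assms in \<open>auto intro!: strict_deriv_coord finite_C continuous_intros\<close>)
  have "strict_deriv C p (\<lambda>x. \<eta> (fst c) (snd c) + R x c) (\<lambda>z. 0 + R z c)"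
    by (intro strict_deriv_add strict_deriv_const strict_deriv_R)
  then have "strict_deriv C p (\<lambda>x. ln (\<eta> (fst c) (snd c) + R x c))
      (\<lambda>z. inverse (\<eta> (fst c) (snd c) + R p c) * (0 + R z c))"
    by (rule strict_deriv_compose[where S = "{0<..}" and \<phi> = ln and \<phi>' = inverse])
      (use ln H_pos[OF assms] in \<open>auto simp: H_def intro!: continuous_intros\<close>)
  then show "strict_deriv C p (\<lambda>x. ln (\<eta> (fst c) (snd c) + R x c)) (\<lambda>z. inverse (H c) * R z c)"
    by (simp add: H_def)
qed

lemma eventually_pos_near:
  "\<forall>\<^sub>F r in at_right 0. \<forall>x\<in>near C p r. \<forall>c\<in>C. p c / 2 \<le> x c \<and> 0 < x c \<and> 0 < \<eta> (fst c) (snd c) + R x c"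
proof -
  have "\<forall>\<^sub>F r in at_right 0. \<forall>c\<in>C. \<forall>x\<in>near C p r. p c / 2 \<le> x c \<and> 0 < x c \<and> 0 < \<eta> (fst c) (snd c) + R x c"
  proof (intro eventually_ball_finite finite_C ballI)
    fix c assume c: "c \<in> C"
    have "p c / 2 > 0" "H c / 2 > 0" using p_pos[OF c] H_pos[OF c] by auto
    from strict_deriv_continuous[OF strict_deriv_coord[OF finite_C c, of p] this(1)]
      strict_deriv_continuous[OF strict_deriv_R[of c] this(2)]
    show "\<forall>\<^sub>F r in at_right 0. \<forall>x\<in>near C p r. p c / 2 \<le> x c \<and> 0 < x c \<and> 0 < \<eta> (fst c) (snd c) + R x c"
    proof eventually_elim
      case (elim r)
      show ?case
      proof
        fix x assume "x \<in> near C p r"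
        then have "\<bar>x c - p c\<bar> \<le> p c / 2" "\<bar>R x c - R p c\<bar> \<le> H c / 2" using elim by blast+
        then show "p c / 2 \<le> x c \<and> 0 < x c \<and> 0 < \<eta> (fst c) (snd c) + R x c"
          using p_pos[OF c] H_pos[OF c] unfolding abs_le_iff H_def by (auto simp: field_simps)
      qed
    qed
  qed
  then show ?thesis by eventually_elim auto
qed

text \<open>Near \<open>p\<close> the transition map is a softmax of \<open>ln x + \<alpha> ln (\<eta> + R x)\<close>, so only sums and
  functions of one variable have to be differentiated.\<close>

lemma strict_deriv_trans_map:
  assumes c: "c \<in> C"
  shows "strict_deriv C p (\<lambda>x. \<pi> x c) (\<lambda>z. J z c)"
proof -
  define F where "F c x = ln (x c) + \<alpha> * ln (\<eta> (fst c) (snd c) + R x c)" for c x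
  define dF where "dF c z = inverse (p c) * z c + \<alpha> * (inverse (H c) * R z c)" for c and z :: "nat \<times> 'v \<Rightarrow> real"
  define S where "S x = (\<Sum>w\<in>V (fst c). exp (F (fst c, w) x))" for x
  define i where "i = fst c"
  have i: "i \<in> {1..m}" using fst_C[OF c] by (simp add: i_def)
  have F: "strict_deriv C p (F c) (dF c)" if "c \<in> C" for c
    unfolding F_def dF_def by (rule strict_deriv_log[OF that])
  have iw: "(fst c, w) \<in> C" if "w \<in> V (fst c)" for w using c that by (auto simp: coords_def)
  have S_pos: "S x > 0" for x
    unfolding S_def using V[OF fst_C[OF c]] by (intro sum_pos) auto
  have expF: "exp (F b x) = x b * (\<eta> (fst b) (snd b) + R x b) powr \<alpha>"
    if "0 < x b" "0 < \<eta> (fst b) (snd b) + R x b" for b x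
    using that by (simp add: F_def exp_add powr_def)
  have expF_p: "exp (F b p) = p b * H b powr \<alpha>" if "b \<in> C" for b
    using expF[of p b] that p_pos H_pos by (simp add: H_def)
  have exp: "strict_deriv C p (\<lambda>x. exp (F b x)) (\<lambda>z. exp (F b p) * dF b z)" if "b \<in> C" for b
    by (rule strict_deriv_compose[where S = UNIV and \<phi> = exp and \<phi>' = exp])
      (use that F in \<open>auto intro!: DERIV_exp\<close>)
  have S: "strict_deriv C p S (\<lambda>z. \<Sum>w\<in>V (fst c). exp (F (fst c, w) p) * dF (fst c, w) z)"
    unfolding S_def using finite_V[OF fst_C[OF c]] by (intro strict_deriv_sum exp iw)
  have "strict_deriv C p (\<lambda>x. ln (S x))
      (\<lambda>z. inverse (S p) * (\<Sum>w\<in>V (fst c). exp (F (fst c, w) p) * dF (fst c, w) z))"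
    by (rule strict_deriv_compose[where S = "{0<..}" and \<phi> = ln and \<phi>' = inverse])
      (use S S_pos[of p] in \<open>auto intro!: derivative_eq_intros continuous_intros simp: divide_inverse\<close>)
  then have "strict_deriv C p (\<lambda>x. F c x + - 1 * ln (S x))
      (\<lambda>z. dF c z + - 1 * (inverse (S p) * (\<Sum>w\<in>V (fst c). exp (F (fst c, w) p) * dF (fst c, w) z)))"
    by (intro strict_deriv_add F[OF c] strict_deriv_scale)
  then have "strict_deriv C p (\<lambda>x. exp (F c x + - 1 * ln (S x)))
      (\<lambda>z. exp (F c p + - 1 * ln (S p)) *
        (dF c z + - 1 * (inverse (S p) * (\<Sum>w\<in>V (fst c). exp (F (fst c, w) p) * dF (fst c, w) z))))"
    by (rule strict_deriv_compose[where S = UNIV and \<phi> = exp and \<phi>' = exp]) (auto intro!: DERIV_exp)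
  moreover have "(\<lambda>z. exp (F c p + - 1 * ln (S p)) *
        (dF c z + - 1 * (inverse (S p) * (\<Sum>w\<in>V (fst c). exp (F (fst c, w) p) * dF (fst c, w) z)))) =
      (\<lambda>z. J z c)"
  proof
    fix z
    have Sp: "S p = H c powr \<alpha>"
      unfolding S_def H_powr_eq_sum[OF c] by (intro sum.cong refl) (simp add: expF_p iw)
    \<comment> \<open>At the fixed point all weights of the walk equal \<open>S p\<close>, which
      factors out of the sum and cancels.\<close>
    have *: "exp (F (fst c, w) p) * dF (fst c, w) z =
      S p * (z (fst c, w) + \<alpha> * (p (fst c, w) * R z (fst c, w) / H (fst c, w)))" if "w \<in> V (fst c)" for w
    proof -
      have "H (fst c, w) powr \<alpha> = S p"
        using H_powr_eq_sum[OF iw[OF that]] H_powr_eq_sum[OF c] by (simp add: Sp)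
      then show ?thesis using p_pos[OF iw[OF that]] H_pos[OF iw[OF that]] iw[OF that]
        by (simp add: expF_p dF_def field_simps)
    qed
    have "inverse (S p) * (\<Sum>w\<in>V (fst c). exp (F (fst c, w) p) * dF (fst c, w) z) =
      inverse (S p) * (\<Sum>w\<in>V (fst c). S p * (z (fst c, w) + \<alpha> * (p (fst c, w) * R z (fst c, w) / H (fst c, w))))"
      by (intro arg_cong2[where f = "(*)"] sum.cong refl *)
    also have "\<dots> = (\<Sum>w\<in>V (fst c). z (fst c, w)) + \<alpha> * (\<Sum>w\<in>V (fst c). p (fst c, w) * R z (fst c, w) / H (fst c, w))"
      using S_pos[of p] unfolding sum_distrib_left[symmetric] sum.distrib
      by (simp add: inverse_eq_divide)
    finally have 1: "inverse (S p) * (\<Sum>w\<in>V (fst c). exp (F (fst c, w) p) * dF (fst c, w) z) = \<dots>" .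
    have 2: "exp (F c p + - 1 * ln (S p)) = p c"
      using S_pos[of p] H_pos[OF c] by (simp add: exp_diff expF_p[OF c]) (simp add: Sp)
    show "exp (F c p + - 1 * ln (S p)) *
        (dF c z + - 1 * (inverse (S p) * (\<Sum>w\<in>V (fst c). exp (F (fst c, w) p) * dF (fst c, w) z))) = J z c"
      unfolding 1 2 unfolding J_def B_def dF_def using p_pos[OF c] by (simp add: field_simps)
  qed
  ultimately have "strict_deriv C p (\<lambda>x. exp (F c x + - 1 * ln (S x))) (\<lambda>z. J z c)" by simp
  then show ?thesis
  proof (rule strict_deriv_cong)
    \<comment> \<open>The logarithms represent the transition map only where coordinates and bases
      are positive, which a small box ensures.\<close>
    show "\<forall>\<^sub>F r in at_right 0. \<forall>x\<in>near C p r. exp (F c x + - 1 * ln (S x)) = \<pi> x c"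
      using eventually_pos_near
    proof eventually_elim
      case (elim r)
      show ?case
      proof
        fix x assume "x \<in> near C p r"
        then have pos: "0 < x b \<and> 0 < \<eta> (fst b) (snd b) + R x b" if "b \<in> C" for b using elim that by blast
        have "S x = (\<Sum>w\<in>V (fst c). x (fst c, w) * (\<eta> (fst c) w + R x (fst c, w)) powr \<alpha>)"
          unfolding S_def using pos iw by (intro sum.cong refl) (auto simp: expF)
        moreover have "exp (F c x + - 1 * ln (S x)) = exp (F c x) / S x"
          using S_pos[of x] by (simp add: exp_diff)
        ultimately show "exp (F c x + - 1 * ln (S x)) = \<pi> x c"
          using pos[OF c] by (simp add: trans_map_eq[OF c] expF)
      qed
    qed
  qed
qed

lemma partial_deriv_trans_map:
  assumes "b \<in> C" "c \<in> C"
  shows "partial_deriv (\<lambda>x. \<pi> x b) c p = J (\<lambda>a. of_bool (a = c)) b"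
  using J_lin[of _ "\<lambda>a. of_bool (a = c)" 0 "\<lambda>_. 0"]
  by (intro strict_deriv_imp_partial_deriv[OF strict_deriv_trans_map] assms finite_C) simp

end

section \<open>Self-adjointness and the spectrum of the Jacobian\<close>

context walk_model
begin

text \<open>The weight cancels the factor \<alpha> p / H in \<open>B\<close>. As \<open>H\<close> is
  constant on each walk, it gives on each simplex a multiple of the Shahshahani metric, whose weight
  is 1 / p.\<close>

definition g :: "nat \<times> 'v \<Rightarrow> real" where
  "g c = H c / (\<alpha> * p c)"

definition ip :: "(nat \<times> 'v \<Rightarrow> real) \<Rightarrow> (nat \<times> 'v \<Rightarrow> real) \<Rightarrow> real" where
  "ip z w = (\<Sum>c\<in>C. g c * z c * w c)"

definition bil :: "(nat \<times> 'v \<Rightarrow> real) \<Rightarrow> (nat \<times> 'v \<Rightarrow> real) \<Rightarrow> real" where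
  "bil z w = (\<Sum>c\<in>C. R z c * w c)"

lemma g_pos: "c \<in> C \<Longrightarrow> 0 < g c"
  using H_pos p_pos \<alpha>_pos by (simp add: g_def)

lemma ip_lin: "ip (\<lambda>c. s * x c + t * y c) z = s * ip x z + t * ip y z"
  by (simp add: ip_def algebra_simps sum.distrib sum_distrib_left)

lemma ip_commute: "ip x y = ip y x"
  by (simp add: ip_def mult_ac)

lemma bil_lin: "bil (\<lambda>c. s * x c + t * y c) z = s * bil x z + t * bil y z"
  by (simp add: bil_def R_lin algebra_simps sum.distrib sum_distrib_left)

text \<open>Grouped by vertices, both walk indices range over the same set, so that swapping them
  meets the symmetry of \<rho>.\<close>

lemma bil_eq: "bil x y = (\<Sum>v\<in>(\<Union>i\<in>{1..m}. V i). \<Sum>i\<in>walks_at m V v. \<Sum>j\<in>walks_at m V v. \<rho> v i j * x (j, v) * y (i, v))"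
proof -
  have fin: "finite (\<Union>i\<in>{1..m}. V i)" using finite_V by auto
  have "(\<Sum>v\<in>(\<Union>i\<in>{1..m}. V i). \<Sum>i\<in>walks_at m V v. R x (i, v) * y (i, v)) =
    (\<Sum>(v, i)\<in>(SIGMA v:(\<Union>i\<in>{1..m}. V i). walks_at m V v). R x (i, v) * y (i, v))"
    using fin finite_walks_at by (subst sum.Sigma) auto
  also have "\<dots> = (\<Sum>c\<in>C. R x c * y c)"
    by (rule sum.reindex_bij_witness[of _ "\<lambda>(i, v). (v, i)" "\<lambda>(v, i). (i, v)"])
      (auto simp: walks_at_def coords_def)
  finally show ?thesis by (simp add: bil_def R_def sum_distrib_right)
qed

lemma bil_commute: "bil x y = bil y x"
  unfolding bil_eq
proof (rule sum.cong, rule refl)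
  fix v
  have "(\<Sum>i\<in>walks_at m V v. \<Sum>j\<in>walks_at m V v. \<rho> v i j * x (j, v) * y (i, v)) =
    (\<Sum>j\<in>walks_at m V v. \<Sum>i\<in>walks_at m V v. \<rho> v i j * x (j, v) * y (i, v))"
    by (rule sum.swap)
  also have "\<dots> = (\<Sum>i\<in>walks_at m V v. \<Sum>j\<in>walks_at m V v. \<rho> v i j * y (j, v) * x (i, v))"
    by (intro sum.cong refl) (simp add: \<rho>_sym)
  finally show "(\<Sum>i\<in>walks_at m V v. \<Sum>j\<in>walks_at m V v. \<rho> v i j * x (j, v) * y (i, v)) =
    (\<Sum>i\<in>walks_at m V v. \<Sum>j\<in>walks_at m V v. \<rho> v i j * y (j, v) * x (i, v))" .
qed

lemma ip_nonneg: "0 \<le> ip z z"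
  unfolding ip_def using g_pos by (intro sum_nonneg) (auto simp: mult.assoc less_imp_le)

lemma ip_pos: "c \<in> C \<Longrightarrow> z c \<noteq> 0 \<Longrightarrow> 0 < ip z z"
proof -
  assume c: "c \<in> C" "z c \<noteq> 0"
  have "g c * z c * z c \<le> ip z z"
    unfolding ip_def using c g_pos by (intro member_le_sum finite_C) (auto simp: mult.assoc less_imp_le)
  moreover have "0 < z c * z c" using c(2) by (metis not_square_less_zero mult_eq_0_iff linorder_neqE)
  then have "0 < g c * z c * z c" using g_pos[OF c(1)] by (simp add: mult.assoc)
  ultimately show ?thesis by linarith
qed

text \<open>The interaction \<open>\<rho>\<close> is symmetric, so \<open>B\<close>, which is \<open>J - 1\<close> on the tangent space, is
  self-adjoint for the inner product \<open>ip\<close>.\<close>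

lemma ip_B: assumes "w \<in> T" shows "ip (B z) w = bil z w"
proof -
  define M where "M i = (\<Sum>w\<in>V i. p (i, w) * R z (i, w) / H (i, w))" for i
  have "ip (B z) w = (\<Sum>c\<in>C. R z c * w c - H c * M (fst c) * w c)"
    unfolding ip_def
  proof (intro sum.cong refl)
    fix c assume "c \<in> C"
    then show "g c * B z c * w c = R z c * w c - H c * M (fst c) * w c"
      using H_pos[of c] p_pos[of c] \<alpha>_pos by (simp add: B_def g_def M_def field_simps)
  qed
  also have "\<dots> = bil z w - (\<Sum>i\<in>{1..m}. \<Sum>v\<in>V i. H (i, v) * M i * w (i, v))"
    by (simp add: sum_subtractf bil_def sum_C)
  \<comment> \<open>The centring term of \<open>B\<close> drops out: \<open>H\<close> and
    \<open>M\<close> are constant on the vertices of a walk, where \<open>w\<close> sums to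
    0.\<close>
  also have "(\<Sum>i\<in>{1..m}. \<Sum>v\<in>V i. H (i, v) * M i * w (i, v)) = 0"
  proof (rule sum.neutral, rule ballI)
    fix i assume i: "i \<in> {1..m}"
    then obtain v0 where v0: "v0 \<in> V i" using V by blast
    have "(\<Sum>v\<in>V i. H (i, v) * M i * w (i, v)) = (\<Sum>v\<in>V i. H (i, v0) * M i * w (i, v))"
      using H_const[OF i v0] by (intro sum.cong refl) simp
    also have "\<dots> = 0" using assms i by (simp add: T_def flip: sum_distrib_left)
    finally show "(\<Sum>v\<in>V i. H (i, v) * M i * w (i, v)) = 0" .
  qed
  finally show ?thesis by simp
qed

lemma R_cong: "(\<And>c. c \<in> C \<Longrightarrow> x c = y c) \<Longrightarrow> R x b = R y b"
  unfolding R_def by (intro sum.cong refl) (simp add: walks_at_C)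

lemma J_cong:
  assumes "b \<in> C" "\<And>c. c \<in> C \<Longrightarrow> x c = y c"
  shows "J x b = J y b"
proof -
  have "R x c = R y c" for c by (rule R_cong) (rule assms(2))
  moreover have "(\<Sum>w\<in>V (fst b). x (fst b, w)) = (\<Sum>w\<in>V (fst b). y (fst b, w))"
    using assms by (intro sum.cong refl) (auto simp: coords_def)
  ultimately show ?thesis using assms by (simp add: J_def B_def)
qed

lemma J_eq_sum:
  assumes "b \<in> C"
  shows "J z b = (\<Sum>c\<in>C. J (\<lambda>a. of_bool (a = c)) b * z c)"
proof -
  have "J (\<lambda>a. \<Sum>c\<in>S. of_bool (a = c) * z c) b = (\<Sum>c\<in>S. J (\<lambda>a. of_bool (a = c)) b * z c)" if "finite S" for S
    using that
  proof (induction S rule: finite_induct)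
    case empty
    show ?case using J_lin[of 0 "\<lambda>_. 0" 0 "\<lambda>_. 0"] by simp
  next
    case (insert c S)
    have "J (\<lambda>a. \<Sum>c\<in>insert c S. of_bool (a = c) * z c) b =
       J (\<lambda>a. z c * of_bool (a = c) + 1 * (\<Sum>c\<in>S. of_bool (a = c) * z c)) b"
      unfolding sum.insert[OF insert(1,2)] by (simp only: mult.commute mult_1_left)
    also have "\<dots> = z c * J (\<lambda>a. of_bool (a = c)) b + 1 * J (\<lambda>a. \<Sum>c\<in>S. of_bool (a = c) * z c) b"
      by (rule J_lin)
    finally show ?case using insert by (simp add: mult.commute)
  qed
  from this[OF finite_C] have "J (\<lambda>a. \<Sum>c\<in>C. of_bool (a = c) * z c) b = (\<Sum>c\<in>C. J (\<lambda>a. of_bool (a = c)) b * z c)" .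
  moreover have "J z b = J (\<lambda>a. \<Sum>c\<in>C. of_bool (a = c) * z c) b"
  proof (rule J_cong[OF assms])
    fix a assume a: "a \<in> C"
    have "(\<Sum>c\<in>C. of_bool (a = c) * z c) = (\<Sum>c\<in>C. if a = c then z c else 0)" by (intro sum.cong) auto
    then show "z a = (\<Sum>c\<in>C. of_bool (a = c) * z c)" using a finite_C by simp
  qed
  ultimately show ?thesis by simp
qed

abbreviation Jac :: "complex mat" where "Jac \<equiv> jacobian_mat C \<pi> p"

abbreviation enum :: "nat \<Rightarrow> nat \<times> 'v" where "enum \<equiv> from_nat_into C"

lemma enum_bij: "bij_betw enum {..<card C} C"
  by (rule bij_betw_from_nat_into_finite[OF finite_C])

lemma enum_in_C: "k < card C \<Longrightarrow> enum k \<in> C"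
  using bij_betwE[OF enum_bij] by simp

lemma Jac_carrier: "Jac \<in> carrier_mat (card C) (card C)"
  by (simp add: jacobian_mat_def)

lemma Jac_mult_vec:
  assumes v: "v \<in> carrier_vec (card C)" and k: "k < card C"
  shows "vec_index (mult_mat_vec Jac v) k =
    (\<Sum>l<card C. complex_of_real (J (\<lambda>a. of_bool (a = enum l)) (enum k)) * vec_index v l)"
  using v k by (auto simp: mult_mat_vec_def jacobian_mat_def scalar_prod_def atLeast0LessThan
      partial_deriv_trans_map enum_in_C intro!: sum.cong)

lemma sum_enum: "(\<Sum>l<card C. f (enum l)) = (\<Sum>c\<in>C. f c)"
  by (rule sum.reindex_bij_betw[OF enum_bij])

text \<open>The real and imaginary parts \<open>a\<close>, \<open>b\<close> of an eigenvector are
  tangent. In \<open>bil a a + bil b b\<close> the rotation terms with \<nu> cancel by symmetry of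
  \<open>ip\<close>, leaving \<mu> - 1 times a positive number, so one of the two summands is
  positive.\<close>

lemma unstable_direction:
  assumes "\<xi> \<in> spectrum Jac" "Re \<xi> > 1"
  shows "\<exists>z\<in>T. bil z z > 0"
proof -
  have "eigenvalue Jac \<xi>" using assms(1) by (simp add: spectrum_def)
  then obtain v where v: "v \<in> carrier_vec (card C)" "v \<noteq> 0\<^sub>v (card C)" "mult_mat_vec Jac v = smult_vec \<xi> v"
    unfolding eigenvalue_def eigenvector_def using Jac_carrier by auto
  define idx where "idx = the_inv_into {..<card C} enum"
  have idx: "idx (enum k) = k" if "k < card C" for k
    unfolding idx_def using enum_bij that by (intro the_inv_into_f_f) (auto simp: bij_betw_def)
  define a where "a c = Re (vec_index v (idx c))" for c
  define b where "b c = Im (vec_index v (idx c))" for c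
  define \<mu> where "\<mu> = Re \<xi>"
  define \<nu> where "\<nu> = Im \<xi>"
  have eq: "(\<Sum>l<card C. complex_of_real (J (\<lambda>a. of_bool (a = enum l)) (enum k)) * vec_index v l) = \<xi> * vec_index v k"
    if "k < card C" for k
    using Jac_mult_vec[OF v(1) that] v(1) that by (simp add: v(3))
  have "J a c = \<mu> * a c - \<nu> * b c \<and> J b c = \<mu> * b c + \<nu> * a c" if c: "c \<in> C" for c
  proof -
    obtain k where k: "k < card C" "c = enum k" using c enum_bij by (auto simp: bij_betw_def)
    have "J a c = (\<Sum>l<card C. J (\<lambda>a. of_bool (a = enum l)) (enum k) * a (enum l))"
      using J_eq_sum[OF c, of a] unfolding k(2)
      by (simp only: sum_enum[where f = "\<lambda>c. J (\<lambda>a. of_bool (a = c)) (enum k) * a c"])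
    also have "\<dots> = Re (\<Sum>l<card C. complex_of_real (J (\<lambda>a. of_bool (a = enum l)) (enum k)) * vec_index v l)"
      by (simp add: a_def idx)
    finally have 1: "J a c = Re (\<xi> * vec_index v k)" using eq[OF k(1)] by simp
    have "J b c = (\<Sum>l<card C. J (\<lambda>a. of_bool (a = enum l)) (enum k) * b (enum l))"
      using J_eq_sum[OF c, of b] unfolding k(2)
      by (simp only: sum_enum[where f = "\<lambda>c. J (\<lambda>a. of_bool (a = c)) (enum k) * b c"])
    also have "\<dots> = Im (\<Sum>l<card C. complex_of_real (J (\<lambda>a. of_bool (a = enum l)) (enum k)) * vec_index v l)"
      by (simp add: b_def idx)
    finally have 2: "J b c = Im (\<xi> * vec_index v k)" using eq[OF k(1)] by simp
    show ?thesis using 1 2 by (simp add: \<mu>_def \<nu>_def a_def b_def k idx)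
  qed
  then have Ja: "\<And>c. c \<in> C \<Longrightarrow> J a c = \<mu> * a c - \<nu> * b c"
    and Jb: "\<And>c. c \<in> C \<Longrightarrow> J b c = \<mu> * b c + \<nu> * a c" by blast+
  have \<mu>: "\<mu> > 1" using assms(2) by (simp add: \<mu>_def)
  have "(\<Sum>v\<in>V i. a (i, v)) = 0 \<and> (\<Sum>v\<in>V i. b (i, v)) = 0" if i: "i \<in> {1..m}" for i
  proof -
    define s where "s = (\<Sum>v\<in>V i. a (i, v))"
    define t where "t = (\<Sum>v\<in>V i. b (i, v))"
    \<comment> \<open>\<open>J\<close> maps into \<open>T\<close>, so (s, t), read as a complex
      number, is annihilated by multiplication with \<xi>, which is not 0.\<close>
    have "0 = (\<Sum>v\<in>V i. \<mu> * a (i, v) - \<nu> * b (i, v))" "0 = (\<Sum>v\<in>V i. \<mu> * b (i, v) + \<nu> * a (i, v))"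
      using sum_J[OF i, of a] sum_J[OF i, of b] Ja Jb i by (simp_all add: in_C)
    then have 0: "0 = \<mu> * s - \<nu> * t" "0 = \<mu> * t + \<nu> * s"
      by (simp_all add: s_def t_def sum_subtractf sum.distrib sum_distrib_left)
    have "\<mu> * (s\<^sup>2 + t\<^sup>2) = s * (\<mu> * s - \<nu> * t) + t * (\<mu> * t + \<nu> * s)"
      by (simp add: power2_eq_square algebra_simps)
    also have "\<dots> = 0" unfolding 0[symmetric] by simp
    finally have "s\<^sup>2 + t\<^sup>2 = 0" using \<mu> by simp
    then show ?thesis by (simp add: s_def t_def)
  qed
  then have T: "a \<in> T" "b \<in> T" by (auto simp: T_def)
  have Ba: "B a c = (\<mu> - 1) * a c + (- \<nu>) * b c" and Bb: "B b c = (\<mu> - 1) * b c + \<nu> * a c" if "c \<in> C" for c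
    using J_on_T[OF T(1) that] J_on_T[OF T(2) that] Ja[OF that] Jb[OF that] by (auto simp: algebra_simps)
  have cong: "ip x z = ip y z" if "\<And>c. c \<in> C \<Longrightarrow> x c = y c" for x y z
    using that by (simp add: ip_def)
  have "bil a a = (\<mu> - 1) * ip a a + (- \<nu>) * ip b a"
    unfolding ip_B[OF T(1), symmetric] ip_lin[symmetric] by (rule cong) (rule Ba)
  moreover have "bil b b = (\<mu> - 1) * ip b b + \<nu> * ip a b"
    unfolding ip_B[OF T(2), symmetric] ip_lin[symmetric] by (rule cong) (rule Bb)
  ultimately have sum: "bil a a + bil b b = (\<mu> - 1) * (ip a a + ip b b)"
    by (simp add: ip_commute[of b a] algebra_simps)
  obtain k where k: "k < card C" "vec_index v k \<noteq> 0"
    using v(1,2) by (metis carrier_vecD eq_vecI index_zero_vec(1) index_zero_vec(2))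
  then have "a (enum k) \<noteq> 0 \<or> b (enum k) \<noteq> 0" by (simp add: a_def b_def idx complex_eq_iff)
  then have "ip a a + ip b b > 0"
    using ip_pos[OF enum_in_C[OF k(1)]] ip_nonneg[of a] ip_nonneg[of b] by (metis add_nonneg_pos add_pos_nonneg)
  then have "bil a a + bil b b > 0" using sum \<mu> by simp
  then show ?thesis using T by (metis add_nonpos_nonpos not_less)
qed

text \<open>On \<open>T\<close>, \<open>B\<close> acts as \<open>J\<close> minus the identity, whose
  matrix is invertible when 1 is not an eigenvalue; the entries of the inverse give
  \<open>k\<close>. The bound later quantifies the growth of the gauge.\<close>

lemma B_bounded_below:
  assumes "1 \<notin> spectrum Jac"
  shows "\<exists>k>0. \<forall>z\<in>T. l1 C z \<le> k * l1 C (B z)"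
proof -
  define n where "n = card C"
  define A where "A = char_matrix Jac 1"
  have A: "A \<in> carrier_mat n n" using Jac_carrier unfolding A_def n_def by simp
  have "Determinant.det A \<noteq> 0"
    using assms eigenvalue_det[OF Jac_carrier, of 1] by (simp add: spectrum_def A_def)
  from det_non_zero_imp_unit[OF A this, of "()"]
  obtain G where G: "G \<in> carrier_mat n n" "G * A = 1\<^sub>m n"
    by (auto simp: Units_def ring_mat_def)
  define k where "k = real n * (\<Sum>i<n. \<Sum>j<n. cmod (index_mat G (i, j))) + 1"
  have S0: "0 \<le> (\<Sum>i<n. \<Sum>j<n. cmod (index_mat G (i, j)))" by (intro sum_nonneg) auto
  show ?thesis
  proof (intro exI[of _ k] conjI ballI)
    show "k > 0" using S0 by (simp add: k_def add_nonneg_pos)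
    fix z assume z: "z \<in> T"
    define x where "x = vec n (\<lambda>k. complex_of_real (z (enum k)))"
    define y where "y = vec n (\<lambda>k. complex_of_real (B z (enum k)))"
    have x: "x \<in> carrier_vec n" and y: "y \<in> carrier_vec n" by (simp_all add: x_def y_def)
    have "mult_mat_vec A x = y"
    proof (rule eq_vecI)
      show "dim_vec (mult_mat_vec A x) = dim_vec y" using A by (simp add: y_def)
      fix i assume "i < dim_vec y"
      then have i: "i < card C" by (simp add: y_def n_def)
      have "vec_index (mult_mat_vec Jac x) i = (\<Sum>l<card C. complex_of_real (J (\<lambda>a. of_bool (a = enum l)) (enum i) * z (enum l)))"
        using Jac_mult_vec[of x i] x i by (simp add: n_def x_def)
      also have "\<dots> = complex_of_real (\<Sum>l<card C. J (\<lambda>a. of_bool (a = enum l)) (enum i) * z (enum l))"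
        by simp
      also have "(\<Sum>l<card C. J (\<lambda>a. of_bool (a = enum l)) (enum i) * z (enum l)) = J z (enum i)"
        using J_eq_sum[OF enum_in_C[OF i], of z] by (simp only: sum_enum[where f = "\<lambda>c. J (\<lambda>a. of_bool (a = c)) (enum i) * z c"])
      finally have "vec_index (mult_mat_vec Jac x) i = complex_of_real (J z (enum i))" .
      moreover have "mult_mat_vec A x = mult_mat_vec Jac x + smult_vec (-1) x"
        unfolding A_def char_matrix_def using Jac_carrier x
        by (subst add_mult_distrib_mat_vec[of _ n n]) (auto simp: n_def)
      ultimately show "vec_index (mult_mat_vec A x) i = vec_index y i"
        using i x Jac_carrier J_on_T[OF z enum_in_C[OF i]] by (simp add: y_def x_def n_def)
    qed
    then have "mult_mat_vec G y = mult_mat_vec (G * A) x"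
      using assoc_mult_mat_vec[OF G(1) A x] by simp
    then have Gy: "mult_mat_vec G y = x" using x by (simp add: G(2))
    have "l1 C z \<le> real (card C) * ((\<Sum>i<n. \<Sum>j<n. cmod (index_mat G (i, j))) * l1 C (B z))"
      unfolding l1_def[of C z]
    proof (rule sum_bounded_above)
      fix c assume c: "c \<in> C"
      obtain i where i: "i < n" "c = enum i" using c enum_bij by (auto simp: bij_betw_def n_def)
      have "complex_of_real (z c) = vec_index (mult_mat_vec G y) i"
        unfolding Gy using i by (simp add: x_def)
      also have "\<dots> = (\<Sum>j<n. index_mat G (i, j) * complex_of_real (B z (enum j)))"
        using G(1) i by (auto simp: mult_mat_vec_def scalar_prod_def y_def atLeast0LessThan intro!: sum.cong)
      finally have "\<bar>z c\<bar> = cmod \<dots>" by (metis norm_of_real real_norm_def)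
      also have "\<dots> \<le> (\<Sum>j<n. cmod (index_mat G (i, j)) * \<bar>B z (enum j)\<bar>)"
        by (rule order_trans[OF norm_sum]) (simp add: norm_mult)
      also have "\<dots> \<le> (\<Sum>j<n. cmod (index_mat G (i, j)) * l1 C (B z))"
        by (intro sum_mono mult_left_mono abs_le_l1 finite_C enum_in_C) (auto simp: n_def)
      also have "\<dots> = (\<Sum>j<n. cmod (index_mat G (i, j))) * l1 C (B z)" by (simp add: sum_distrib_right)
      also have "\<dots> \<le> (\<Sum>i<n. \<Sum>j<n. cmod (index_mat G (i, j))) * l1 C (B z)"
        using i by (intro mult_right_mono member_le_sum[of i "{..<n}" "\<lambda>i. \<Sum>j<n. cmod (index_mat G (i, j))"])
          (auto intro: sum_nonneg)
      finally show "\<bar>z c\<bar> \<le> \<dots>" .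
    qed
    also have "\<dots> \<le> k * l1 C (B z)"
      unfolding k_def n_def[symmetric] distrib_right by (simp add: mult.assoc)
    finally show "l1 C z \<le> k * l1 C (B z)" .
  qed
qed

end

section \<open>Construction of the gauge\<close>

context walk_model
begin

lemma B_in_T: "B z \<in> T"
  by (simp add: T_def sum_B)

lemma R_bounded: "\<exists>K>0. \<forall>z. \<forall>c\<in>C. \<bar>R z c\<bar> \<le> K * l1 C z"
proof -
  define k where "k c = (\<Sum>j\<in>walks_at m V (snd c). \<bar>\<rho> (snd c) (fst c) j\<bar>)" for c :: "nat \<times> 'v"
  have k0: "0 \<le> k c" for c unfolding k_def by (intro sum_nonneg) auto
  have "\<bar>R z c\<bar> \<le> (sum k C + 1) * l1 C z" if "c \<in> C" for z c
  proof -
    have "\<bar>R z c\<bar> \<le> (\<Sum>j\<in>walks_at m V (snd c). \<bar>\<rho> (snd c) (fst c) j\<bar> * l1 C z)"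
      unfolding R_def
      by (rule order_trans[OF sum_abs])
        (auto simp: abs_mult walks_at_C intro!: sum_mono mult_left_mono abs_le_l1 finite_C)
    also have "\<dots> = k c * l1 C z" by (simp add: k_def sum_distrib_right)
    also have "\<dots> \<le> (sum k C + 1) * l1 C z"
      using member_le_sum[OF that, of k] k0 finite_C by (intro mult_right_mono) auto
    finally show ?thesis .
  qed
  moreover have "0 < sum k C + 1" using k0 by (simp add: sum_nonneg add_nonneg_pos)
  ultimately show ?thesis by blast
qed

lemma ip_CS: "\<bar>ip z w\<bar> \<le> sqrt (ip z z) * sqrt (ip w w)"
proof (rule Cauchy_Schwarz_if_nonneg_form)
  fix s t :: real
  have "0 \<le> ip (\<lambda>c. t * z c + s * w c) (\<lambda>c. t * z c + s * w c)" by (rule ip_nonneg)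
  also have "\<dots> = t * ip z (\<lambda>c. t * z c + s * w c) + s * ip w (\<lambda>c. t * z c + s * w c)" by (rule ip_lin)
  also have "\<dots> = t * (t * ip z z + s * ip w z) + s * (t * ip z w + s * ip w w)"
    by (simp only: ip_commute[of _ "\<lambda>c. t * z c + s * w c"] ip_lin)
  finally show "0 \<le> t\<^sup>2 * ip z z + 2 * t * s * ip z w + s\<^sup>2 * ip w w"
    by (simp add: ip_commute[of w z] power2_eq_square algebra_simps)
qed

text \<open>The difference of two norms serves as a gauge of the unstable cone: \<open>u\<close> is Lipschitz, it is
  positive exactly where \<open>bil z z > 0\<close>, and there the vector field \<open>B\<close> increases it.
  The row \<open>l z\<close> is its derivative at \<open>z\<close>.\<close>

lemma gauge_exists:
  assumes nondeg: "1 \<notin> spectrum Jac" and unst: "\<exists>z\<in>T. bil z z > 0"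
  obtains u l \<Lambda> c1 where "\<Lambda> > 0" "c1 > 0"
    and "\<And>z. u z \<le> \<Lambda> * l1 C z"
    and "\<And>z c. c \<in> C \<Longrightarrow> \<bar>l z c\<bar> \<le> \<Lambda>"
    and "\<And>z. (\<Sum>c\<in>C. l z c * z c) = u z"
    and "\<And>z y. l1 C z > 0 \<Longrightarrow>
       u (\<lambda>c. z c + y c) \<ge> u z + (\<Sum>c\<in>C. l z c * y c) - \<Lambda> * (l1 C y)\<^sup>2 / l1 C z"
    and "\<And>z. z \<in> T \<Longrightarrow> 0 \<le> u z \<Longrightarrow> (\<Sum>c\<in>C. l z c * B z c) \<ge> c1 * l1 C z"
    and "\<exists>z\<in>T. 0 < u z"
    and "\<And>s z. s \<ge> 0 \<Longrightarrow> u (\<lambda>c. s * z c) = s * u z"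
proof -
  obtain r1 where r1: "r1 > 0" "\<And>z c. c \<in> C \<Longrightarrow> \<bar>R z c\<bar> \<le> r1 * l1 C z" using R_bounded by blast
  define G where "G = (\<Sum>c\<in>C. 1 / sqrt (g c)) + 1"
  define g1 where "g1 = sum g C + 1"
  have G: "G > 0" unfolding G_def using g_pos by (intro add_nonneg_pos sum_nonneg) (auto intro: less_imp_le)
  have g1: "g1 > 0" unfolding g1_def using g_pos by (intro add_nonneg_pos sum_nonneg) (auto intro: less_imp_le)
  have g_le: "g c \<le> g1" if "c \<in> C" for c
    using member_le_sum[OF that, of g] g_pos finite_C unfolding g1_def by (smt (verit) DiffE)
  define N where "N z = sqrt (ip z z)" for z
  have N0: "0 \<le> N z" for z by (simp add: N_def ip_nonneg)
  have N2: "(N z)\<^sup>2 = ip z z" for z by (simp add: N_def ip_nonneg)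
  have l1_le: "l1 C z \<le> G * N z" for z
  proof -
    have "\<bar>z c\<bar> \<le> 1 / sqrt (g c) * N z" if c: "c \<in> C" for c
    proof -
      have "g c * z c * z c \<le> ip z z"
        unfolding ip_def using c g_pos
        by (intro member_le_sum finite_C) (auto simp: mult.assoc less_imp_le)
      then have "sqrt (g c * (z c)\<^sup>2) \<le> N z" unfolding N_def
        by (intro real_sqrt_le_mono) (simp add: power2_eq_square mult.assoc)
      then show ?thesis using g_pos[OF c] by (simp add: real_sqrt_mult field_simps)
    qed
    then have "l1 C z \<le> (\<Sum>c\<in>C. 1 / sqrt (g c) * N z)" unfolding l1_def by (intro sum_mono)
    also have "\<dots> \<le> G * N z" unfolding G_def using N0[of z] by (simp add: sum_distrib_right distrib_right)
    finally show ?thesis .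
  qed
  have ip_le: "ip z z \<le> g1 * (l1 C z)\<^sup>2" for z
  proof -
    have "ip z z \<le> (\<Sum>c\<in>C. g1 * l1 C z * \<bar>z c\<bar>)"
      unfolding ip_def
    proof (rule sum_mono)
      fix c assume c: "c \<in> C"
      have "g c * z c * z c = g c * \<bar>z c\<bar> * \<bar>z c\<bar>" by (simp add: mult.assoc)
      also have "\<dots> \<le> g1 * l1 C z * \<bar>z c\<bar>"
        using c g1 by (intro mult_right_mono mult_mono g_le abs_le_l1 finite_C) auto
      finally show "g c * z c * z c \<le> g1 * l1 C z * \<bar>z c\<bar>" .
    qed
    also have "\<dots> = g1 * (l1 C z)\<^sup>2"
      by (simp add: l1_def power2_eq_square mult.assoc flip: sum_distrib_left)
    finally show ?thesis .
  qed
  have N_le: "N z \<le> sqrt g1 * l1 C z" for z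
    using real_sqrt_le_mono[OF ip_le[of z]] by (simp add: N_def real_sqrt_mult)
  have bil_le: "\<bar>bil z z\<bar> \<le> r1 * (l1 C z)\<^sup>2" for z
  proof -
    have "\<bar>bil z z\<bar> \<le> (\<Sum>c\<in>C. r1 * l1 C z * \<bar>z c\<bar>)"
      unfolding bil_def
      by (rule order_trans[OF sum_abs]) (auto simp: abs_mult intro!: sum_mono mult_right_mono r1(2))
    also have "\<dots> = r1 * (l1 C z)\<^sup>2"
      by (simp add: l1_def power2_eq_square mult.assoc flip: sum_distrib_left)
    finally show ?thesis .
  qed
  \<comment> \<open>Small enough that \<tau> |bil z z| is at most half of \<open>ip z z\<close>, so
    that \<open>F\<close> is a nonnegative form equivalent to \<open>ip\<close>.\<close>
  define \<tau> where "\<tau> = 1 / (2 * r1 * G\<^sup>2)"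
  have \<tau>: "\<tau> > 0" using r1 G by (simp add: \<tau>_def)
  define F where "F z w = ip z w + \<tau> * bil z w" for z w
  have F_lin: "F (\<lambda>c. s * x c + t * y c) z = s * F x z + t * F y z" for s t x y z
    by (simp add: F_def ip_lin bil_lin algebra_simps)
  have F_comm: "F x y = F y x" for x y
    by (simp add: F_def ip_commute[of x] bil_commute[of x])
  have \<tau>_bil: "\<bar>\<tau> * bil z z\<bar> \<le> ip z z / 2" for z
  proof -
    have "\<bar>\<tau> * bil z z\<bar> = \<tau> * \<bar>bil z z\<bar>" using \<tau> by (simp add: abs_mult)
    also have "\<dots> \<le> \<tau> * (r1 * (l1 C z)\<^sup>2)" using \<tau> by (intro mult_left_mono bil_le) auto
    also have "\<dots> \<le> \<tau> * (r1 * (G * N z)\<^sup>2)"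
      using \<tau> r1(1) l1_le[of z] by (intro mult_left_mono power_mono) auto
    also have "\<dots> = ip z z / 2" using r1(1) G by (simp add: \<tau>_def power_mult_distrib N2)
    finally show ?thesis .
  qed
  have F_ge: "ip z z / 2 \<le> F z z" and F_le: "F z z \<le> 2 * ip z z" for z
    using \<tau>_bil[of z] ip_nonneg[of z] by (simp_all add: F_def abs_le_iff)
  have F0: "0 \<le> F z z" for z using F_ge[of z] ip_nonneg[of z] by linarith
  define Nt where "Nt z = sqrt (F z z)" for z
  have Nt0: "0 \<le> Nt z" for z by (simp add: Nt_def F0)
  have Nt2: "(Nt z)\<^sup>2 = F z z" for z by (simp add: Nt_def F0)
  have N_le_Nt: "N z \<le> 2 * Nt z" for z
  proof (rule power2_le_imp_le)
    show "(N z)\<^sup>2 \<le> (2 * Nt z)\<^sup>2" using F_ge[of z] F0[of z] by (simp add: N2 Nt2 power_mult_distrib)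
  qed (simp add: Nt0)
  have Nt_le_N: "Nt z \<le> 2 * N z" for z
  proof (rule power2_le_imp_le)
    show "(Nt z)\<^sup>2 \<le> (2 * N z)\<^sup>2" using F_le[of z] ip_nonneg[of z] by (simp add: N2 Nt2 power_mult_distrib)
  qed (simp add: N0)
  have F_CS: "\<bar>F z w\<bar> \<le> Nt z * Nt w" for z w
    unfolding Nt_def
  proof (rule Cauchy_Schwarz_if_nonneg_form)
    fix s t :: real
    have "0 \<le> F (\<lambda>c. t * z c + s * w c) (\<lambda>c. t * z c + s * w c)" by (rule F0)
    also have "\<dots> = t * F z (\<lambda>c. t * z c + s * w c) + s * F w (\<lambda>c. t * z c + s * w c)" by (rule F_lin)
    also have "\<dots> = t * (t * F z z + s * F w z) + s * (t * F z w + s * F w w)"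
      by (simp only: F_comm[of _ "\<lambda>c. t * z c + s * w c"] F_lin)
    finally show "0 \<le> t\<^sup>2 * F z z + 2 * t * s * F z w + s\<^sup>2 * F w w"
      by (simp add: F_comm[of w z] power2_eq_square algebra_simps)
  qed
  define u where "u z = Nt z - N z" for z
  \<comment> \<open>The difference of the gradients of the two norms. Where a norm vanishes,
    division by 0 gives 0, so \<open>l\<close> is defined and bounded there as well.\<close>
  define l where "l z c = (g c * z c + \<tau> * R z c) / Nt z - g c * z c / N z" for z c
  have l_sum: "(\<Sum>c\<in>C. l z c * y c) = F z y / Nt z - ip z y / N z" for z y
  proof -
    have "F z y = (\<Sum>c\<in>C. (g c * z c + \<tau> * R z c) * y c)"
      by (simp add: F_def ip_def bil_def sum_distrib_left sum.distrib algebra_simps)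
    moreover have "l z c * y c = (g c * z c + \<tau> * R z c) * y c / Nt z - g c * z c * y c / N z" for c
      by (simp add: l_def left_diff_distrib)
    ultimately show ?thesis
      by (simp only: ip_def sum_subtractf flip: sum_divide_distrib)
  qed
  define \<Lambda> where "\<Lambda> = (g1 + \<tau> * r1) * (2 * G) + g1 * G"
  have \<Lambda>: "\<Lambda> > 0" using g1 \<tau> r1(1) G unfolding \<Lambda>_def by (intro add_pos_pos mult_pos_pos) auto
  have l_le: "\<bar>l z c\<bar> \<le> \<Lambda>" if c: "c \<in> C" for z c
  proof -
    have gz: "\<bar>g c * z c\<bar> \<le> g1 * l1 C z"
      using c g_pos[OF c] by (simp add: abs_mult mult_mono g_le abs_le_l1 finite_C less_imp_le g1)
    have "\<bar>\<tau> * R z c\<bar> \<le> \<tau> * (r1 * l1 C z)"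
      using \<tau> r1(2)[OF c, of z] by (simp add: abs_mult)
    then have gR: "\<bar>g c * z c + \<tau> * R z c\<bar> \<le> (g1 + \<tau> * r1) * l1 C z"
      using gz by (simp add: algebra_simps abs_le_iff)
    have d: "l1 C z / N z \<le> G"
      using l1_le[of z] N0[of z] G by (cases "N z = 0") (auto simp: divide_le_eq)
    have "l1 C z \<le> 2 * G * Nt z"
      using order_trans[OF l1_le mult_left_mono[OF N_le_Nt]] G by (simp add: mult_ac)
    then have dt: "l1 C z / Nt z \<le> 2 * G"
      using Nt0[of z] G by (cases "Nt z = 0") (auto simp: divide_le_eq)
    have "\<bar>l z c\<bar> \<le> \<bar>g c * z c + \<tau> * R z c\<bar> / Nt z + \<bar>g c * z c\<bar> / N z"
      unfolding l_def using N0[of z] Nt0[of z]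
      by (intro order_trans[OF abs_triangle_ineq4]) (simp add: abs_divide)
    also have "\<dots> \<le> (g1 + \<tau> * r1) * l1 C z / Nt z + g1 * l1 C z / N z"
      by (intro add_mono divide_right_mono gz gR N0 Nt0)
    also have "\<dots> \<le> \<Lambda>"
      unfolding \<Lambda>_def using mult_left_mono[OF d, of g1] mult_left_mono[OF dt, of "g1 + \<tau> * r1"] g1 \<tau> r1(1)
      by simp
    finally show ?thesis .
  qed
  have lu: "(\<Sum>c\<in>C. l z c * z c) = u z" for z
    unfolding l_sum u_def by (simp add: N_def Nt_def real_div_sqrt F0 ip_nonneg)
  have u_le: "u z \<le> \<Lambda> * l1 C z" for z
  proof -
    have "u z \<le> (\<Sum>c\<in>C. \<Lambda> * \<bar>z c\<bar>)"
      unfolding lu[symmetric]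
    proof (rule sum_mono)
      fix c assume "c \<in> C"
      have "l z c * z c \<le> \<bar>l z c\<bar> * \<bar>z c\<bar>" by (simp flip: abs_mult)
      also have "\<dots> \<le> \<Lambda> * \<bar>z c\<bar>" by (intro mult_right_mono l_le) (use \<open>c \<in> C\<close> in auto)
      finally show "l z c * z c \<le> \<Lambda> * \<bar>z c\<bar>" .
    qed
    then show ?thesis by (simp add: l1_def flip: sum_distrib_left)
  qed
  have N_pos: "N z > 0" and Nt_pos: "Nt z > 0" if "l1 C z > 0" for z
  proof -
    show "N z > 0" using l1_le[of z] that G N0[of z] by (cases "N z = 0") auto
    then show "Nt z > 0" using N_le_Nt[of z] by linarith
  qed
  \<comment> \<open>Only a lower bound is required. By Cauchy-Schwarz the norm \<open>Nt\<close>
    lies above its tangent at no cost; the subtracted norm \<open>N\<close> exceeds its tangent by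
    at most \<open>ip y y / (2 * N z)\<close>, since twice the product of two numbers is at most the
    sum of their squares.\<close>
  have second_order: "u (\<lambda>c. z c + y c) \<ge> u z + (\<Sum>c\<in>C. l z c * y c) - \<Lambda> * (l1 C y)\<^sup>2 / l1 C z"
    if z: "l1 C z > 0" for z y
  proof -
    let ?w = "\<lambda>c. z c + y c"
    have Fw: "F z ?w = F z z + F z y" using F_lin[of 1 z 1 y z] by (simp add: F_comm[of z ?w] F_comm[of y z])
    have ipw: "ip ?w ?w = ip z z + 2 * ip z y + ip y y"
      using ip_lin[of 1 z 1 y ?w] ip_lin[of 1 z 1 y z] ip_lin[of 1 z 1 y y]
      by (simp add: ip_commute[of z ?w] ip_commute[of y ?w] ip_commute[of y z])
    have "F z z + F z y \<le> Nt z * Nt ?w" using F_CS[of z ?w] unfolding Fw by linarith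
    then have 1: "Nt z + F z y / Nt z \<le> Nt ?w"
      using Nt_pos[OF z] by (simp add: Nt2[symmetric] field_simps power2_eq_square)
    have "0 \<le> (N ?w - N z)\<^sup>2" by simp
    then have "2 * N z * N ?w \<le> ip ?w ?w + ip z z" by (simp add: power2_diff N2 mult_ac)
    also have "\<dots> = 2 * (N z)\<^sup>2 + 2 * ip z y + ip y y" by (simp add: ipw N2)
    finally have 2: "N ?w \<le> N z + ip z y / N z + ip y y / (2 * N z)"
      using N_pos[OF z] by (simp add: field_simps power2_eq_square)
    have "ip y y / (2 * N z) \<le> g1 * (l1 C y)\<^sup>2 / (2 * N z)"
      using N_pos[OF z] by (intro divide_right_mono ip_le) auto
    also have "\<dots> = (g1 * (l1 C y)\<^sup>2) * (1 / (2 * N z))" by simp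
    also have "1 / (2 * N z) \<le> G / l1 C z"
      using l1_le[of z] N_pos[OF z] z G by (simp add: field_simps)
    finally have "ip y y / (2 * N z) \<le> (g1 * (l1 C y)\<^sup>2) * (G / l1 C z)"
      using g1 by (simp add: mult_left_mono)
    also have "\<dots> = (g1 * G) * ((l1 C y)\<^sup>2 / l1 C z)" by simp
    also have "\<dots> \<le> \<Lambda> * ((l1 C y)\<^sup>2 / l1 C z)"
      using g1 \<tau> r1(1) G by (intro mult_right_mono) (auto simp: \<Lambda>_def)
    finally have 3: "ip y y / (2 * N z) \<le> \<Lambda> * (l1 C y)\<^sup>2 / l1 C z" by simp
    show ?thesis using 1 2 3 unfolding l_sum u_def by linarith
  qed
  obtain k where k: "k > 0" "\<And>z. z \<in> T \<Longrightarrow> l1 C z \<le> k * l1 C (B z)"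
    using B_bounded_below[OF nondeg] by blast
  \<comment> \<open>Combines the drift bound \<tau> b^2 / (2 t) obtained below with b \<ge> |z| / (k
    G) and t \<le> 2 sqrt g1 |z|.\<close>
  define c1 where "c1 = \<tau> / (4 * (k * G)\<^sup>2 * sqrt g1)"
  have c1: "c1 > 0" using \<tau> k(1) G g1 by (simp add: c1_def)
  have drift: "(\<Sum>c\<in>C. l z c * B z c) \<ge> c1 * l1 C z" if zT: "z \<in> T" and uz: "0 \<le> u z" for z
  proof (cases "l1 C z = 0")
    case True
    then have "N z = 0" "Nt z = 0" using N_le[of z] N0[of z] Nt_le_N[of z] Nt0[of z] by auto
    then show ?thesis using True by (simp add: l_def)
  next
    case False
    then have z: "l1 C z > 0" using l1_nonneg[of C z] by linarith
    define n where "n = N z"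
    define t where "t = Nt z"
    define q where "q = bil z z"
    define b where "b = N (B z)"
    have n: "n > 0" and t: "t > 0" using N_pos[OF z] Nt_pos[OF z] by (auto simp: n_def t_def)
    have b: "b \<ge> 0" by (simp add: b_def N0)
    have "n \<le> t" using uz by (simp add: u_def n_def t_def)
    then have "n\<^sup>2 \<le> t\<^sup>2" using n by (intro power_mono) auto
    moreover have t2: "t\<^sup>2 = n\<^sup>2 + \<tau> * q" by (simp add: t_def n_def q_def N2 Nt2 F_def)
    ultimately have q: "q \<ge> 0" using \<tau> by (simp add: zero_le_mult_iff)
    have ipq: "ip z (B z) = q" using ip_B[OF zT, of z] by (simp add: ip_commute q_def)
    \<comment> \<open>Self-adjointness turns \<open>bil z (B z)\<close> into
      \<open>ip (B z) (B z)\<close>: the perturbation contributes the square \<tau> b^2, which is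
      the source of growth.\<close>
    have Fq: "F z (B z) = q + \<tau> * b\<^sup>2"
      using ip_B[OF B_in_T[of z], of z] by (simp add: F_def ipq b_def N2)
    have "\<bar>q\<bar> \<le> n * b" using ip_CS[of z "B z"] by (simp add: ipq n_def b_def N_def)
    then have q2: "q\<^sup>2 \<le> n\<^sup>2 * b\<^sup>2" using q power_mono[of q "n * b" 2] by (simp add: power_mult_distrib)
    have "2 * n * t \<le> n\<^sup>2 + t\<^sup>2" using zero_le_power2[of "n - t"] by (simp add: power2_diff)
    then have "2 * n * t \<le> 2 * n\<^sup>2 + \<tau> * q" using t2 by simp
    \<comment> \<open>The drift is \<tau> b^2 / t - q (t - n) / (t n). With t - n \<le> \<tau> q /
      (2 n) and q \<le> n b the loss is at most half of the gain.\<close>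
    then have tn: "2 * n * (t - n) \<le> \<tau> * q" by (simp add: algebra_simps power2_eq_square)
    have "2 * n * n * (q * (t - n)) = n * (q * (2 * n * (t - n)))" by simp
    also have "\<dots> \<le> n * (q * (\<tau> * q))" using n q tn by (intro mult_left_mono) auto
    also have "\<dots> = n * (\<tau> * q\<^sup>2)" by (simp add: power2_eq_square)
    also have "\<dots> \<le> n * (\<tau> * (n\<^sup>2 * b\<^sup>2))" using n \<tau> q2 by (intro mult_left_mono) auto
    also have "\<dots> = n * n * (\<tau> * b\<^sup>2 * n)" by (simp add: power2_eq_square)
    finally have "2 * (q * (t - n)) \<le> \<tau> * b\<^sup>2 * n"
      using n by (simp add: mult.assoc mult.left_commute[of 2])
    then have "\<tau> * b\<^sup>2 * n \<le> 2 * ((q + \<tau> * b\<^sup>2) * n - q * t)" by (simp add: algebra_simps)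
    then have "\<tau> * b\<^sup>2 * n / (2 * t * n) \<le> ((q + \<tau> * b\<^sup>2) * n - q * t) / (t * n)"
      using n t by (simp add: field_simps)
    also have "\<dots> = (q + \<tau> * b\<^sup>2) / t - q / n" using n t by (simp add: field_simps)
    also have "\<dots> = (\<Sum>c\<in>C. l z c * B z c)" unfolding l_sum Fq ipq by (simp add: n_def t_def)
    finally have main: "\<tau> * b\<^sup>2 / (2 * t) \<le> (\<Sum>c\<in>C. l z c * B z c)" using n by simp
    have "l1 C z \<le> k * (G * b)"
      using order_trans[OF k(2)[OF zT] mult_left_mono[OF l1_le[of "B z"]]] k(1) by (simp add: b_def)
    then have bz: "l1 C z / (k * G) \<le> b" using k(1) G by (simp add: field_simps)
    have tz: "t \<le> 2 * (sqrt g1 * l1 C z)"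
      using Nt_le_N[of z] N_le[of z] by (simp add: t_def)
    have "c1 * l1 C z = \<tau> * (l1 C z / (k * G))\<^sup>2 / (2 * (2 * (sqrt g1 * l1 C z)))"
      using z k(1) G g1 by (simp add: c1_def power2_eq_square field_simps)
    also have "\<dots> \<le> \<tau> * b\<^sup>2 / (2 * t)"
      using \<tau> t tz bz z k(1) G by (intro frac_le mult_left_mono power_mono) auto
    finally show ?thesis using main by linarith
  qed
  have hom: "u (\<lambda>c. s * z c) = s * u z" if "s \<ge> 0" for s z
  proof -
    have "ip (\<lambda>c. s * z c) (\<lambda>c. s * z c) = s\<^sup>2 * ip z z"
      by (simp add: ip_def sum_distrib_left power2_eq_square mult_ac)
    moreover have "F (\<lambda>c. s * z c) (\<lambda>c. s * z c) = s\<^sup>2 * F z z"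
      using F_lin[of s z 0 z "\<lambda>c. s * z c"] F_lin[of s z 0 z z]
      by (simp add: F_comm[of z "\<lambda>c. s * z c"] power2_eq_square)
    ultimately show ?thesis using that by (simp add: u_def N_def Nt_def real_sqrt_mult algebra_simps)
  qed
  have ex: "\<exists>z\<in>T. 0 < u z"
  proof -
    from unst obtain z where z: "z \<in> T" "bil z z > 0" by blast
    have "ip z z < F z z" using z \<tau> by (simp add: F_def)
    then show ?thesis using z by (auto simp: u_def N_def Nt_def)
  qed
  show thesis
    by (rule that[of \<Lambda> c1 u l]) (use \<Lambda> c1 u_le l_le lu second_order drift ex hom in blast)+
qed

end

section \<open>The step of two coupled copies\<close>

text \<open>For x = - t < 0 this amounts to 1 \<le> (1 - t + t^2) exp t. Replacing exp t by its
  second Taylor polynomial, a lower bound, leaves 1 plus nonnegative powers of t.\<close>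

lemma exp_le_quadratic:
  fixes x :: real
  assumes "\<bar>x\<bar> \<le> 1"
  shows "exp x \<le> 1 + x + x\<^sup>2"
proof (cases "x \<ge> 0")
  case True
  then show ?thesis using assms by (intro exp_bound) auto
next
  case False
  define t where "t = - x"
  have t: "t > 0" using False by (simp add: t_def)
  have "1 \<le> 1 + t\<^sup>2 / 2 + t ^ 3 / 2 + t ^ 4 / 2" using t by simp
  also have "\<dots> = (1 - t + t\<^sup>2) * (1 + t + t\<^sup>2 / 2)"
    by (simp add: power2_eq_square power3_eq_cube power4_eq_xxxx field_simps)
  also have "\<dots> \<le> (1 - t + t\<^sup>2) * exp t"
  proof (intro mult_left_mono)
    show "1 + t + t\<^sup>2 / 2 \<le> exp t" using t by (intro exp_lower_Taylor_quadratic) auto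
    show "0 \<le> 1 - t + t\<^sup>2" using assms by (simp add: t_def)
  qed
  finally show ?thesis using t by (simp add: t_def exp_minus field_simps)
qed

text \<open>Mean drift minus noise, in exponential form. As \<open>s\<close> has size at most
  \<open>S\<close> and vanishes unless \<open>j\<close> is 1, its second moment is at most
  \<open>S\<^sup>2\<close> times the probability of a jump; this is the price in the condition on
  \<open>d\<close>.\<close>

lemma sum_exp_le:
  fixes \<kappa> s j :: "'x \<Rightarrow> real"
  assumes fin: "finite X" and \<kappa>: "\<And>x. x \<in> X \<Longrightarrow> 0 \<le> \<kappa> x" "sum \<kappa> X = 1"
    and s: "\<And>x. x \<in> X \<Longrightarrow> \<bar>s x\<bar> \<le> S * j x" and j: "\<And>x. x \<in> X \<Longrightarrow> j x = 0 \<or> j x = 1"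
    and lam: "0 \<le> lam" "lam * S \<le> 1"
    and d: "d + lam * S\<^sup>2 * (\<Sum>x\<in>X. \<kappa> x * j x) \<le> (\<Sum>x\<in>X. \<kappa> x * s x)"
  shows "(\<Sum>x\<in>X. \<kappa> x * exp (- lam * s x)) \<le> exp (- lam * d)"
proof -
  have "exp (- lam * s x) \<le> 1 - lam * s x + lam\<^sup>2 * S\<^sup>2 * j x" if x: "x \<in> X" for x
  proof -
    have "\<bar>- lam * s x\<bar> = lam * \<bar>s x\<bar>" using lam by (simp add: abs_mult)
    also have "\<dots> \<le> lam * (S * j x)" using lam s[OF x] by (intro mult_left_mono) auto
    also have "\<dots> \<le> 1" using j[OF x] lam by auto
    finally have "exp (- lam * s x) \<le> 1 + - lam * s x + (- lam * s x)\<^sup>2"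
      by (rule exp_le_quadratic)
    moreover have "(s x)\<^sup>2 \<le> S\<^sup>2 * j x"
    proof -
      have "\<bar>s x\<bar>\<^sup>2 \<le> (S * j x)\<^sup>2" using s[OF x] by (intro power_mono) auto
      then show ?thesis using j[OF x] by auto
    qed
    then have "lam\<^sup>2 * (s x)\<^sup>2 \<le> lam\<^sup>2 * (S\<^sup>2 * j x)" by (intro mult_left_mono) auto
    ultimately show ?thesis by (simp add: power_mult_distrib)
  qed
  then have "(\<Sum>x\<in>X. \<kappa> x * exp (- lam * s x)) \<le> (\<Sum>x\<in>X. \<kappa> x * (1 - lam * s x + lam\<^sup>2 * S\<^sup>2 * j x))"
    using \<kappa> by (intro sum_mono mult_left_mono) auto
  also have "\<dots> = (\<Sum>x\<in>X. \<kappa> x - lam * (\<kappa> x * s x) + lam\<^sup>2 * S\<^sup>2 * (\<kappa> x * j x))"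
    by (intro sum.cong refl) (simp add: algebra_simps)
  also have "\<dots> = 1 - lam * (\<Sum>x\<in>X. \<kappa> x * s x) + lam\<^sup>2 * S\<^sup>2 * (\<Sum>x\<in>X. \<kappa> x * j x)"
    unfolding sum.distrib sum_subtractf sum_distrib_left[symmetric] by (simp only: \<kappa>(2))
  also have "\<dots> = 1 - lam * ((\<Sum>x\<in>X. \<kappa> x * s x) - lam * S\<^sup>2 * (\<Sum>x\<in>X. \<kappa> x * j x))"
    by (simp add: algebra_simps power2_eq_square)
  also have "\<dots> \<le> 1 - lam * d" using d lam by (simp add: mult_left_mono)
  also have "\<dots> \<le> exp (- lam * d)" using exp_ge_add_one_self[of "- lam * d"] by simp
  finally show ?thesis .
qed

section \<open>Occupation measures, joint moves and their drift\<close>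

context walk_model
begin

text \<open>A state \<open>y\<close> at time \<open>n\<close> consists of the visit counts, which start at \<open>1\<close>; \<open>emp n y\<close> is the
  occupation measure and a joint step \<open>f\<close> of the walks adds \<open>inc f\<close> to the counts.\<close>

definition emp :: "nat \<Rightarrow> (nat \<times> 'v \<Rightarrow> real) \<Rightarrow> nat \<times> 'v \<Rightarrow> real" where
  "emp n y c = y c / (real (card (V (fst c))) + real n)"

text \<open>The condition on the totals makes the difference of two states in the box at the same
  time an element of \<open>T\<close>.\<close>

definition in_box :: "real \<Rightarrow> nat \<Rightarrow> (nat \<times> 'v \<Rightarrow> real) \<Rightarrow> bool" where
  "in_box r n y \<longleftrightarrow> emp n y \<in> near C p r \<and>
     (\<forall>i\<in>{1..m}. (\<Sum>v\<in>V i. y (i, v)) = real (card (V i)) + real n)"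

definition moves :: "(nat \<Rightarrow> 'v) set" where
  "moves = PiE {1..m} V"

definition move_prob :: "(nat \<times> 'v \<Rightarrow> real) \<Rightarrow> (nat \<Rightarrow> 'v) \<Rightarrow> real" where
  "move_prob x f = (\<Prod>i\<in>{1..m}. \<pi> x (i, f i))"

definition inc :: "(nat \<Rightarrow> 'v) \<Rightarrow> nat \<times> 'v \<Rightarrow> real" where
  "inc f c = of_bool (f (fst c) = snd c)"

lemma finite_moves: "finite moves"
  unfolding moves_def using V by (intro finite_PiE) auto

lemma moves_C: "f \<in> moves \<Longrightarrow> i \<in> {1..m} \<Longrightarrow> (i, f i) \<in> C"
  by (auto simp: moves_def coords_def)

lemma C_nonempty: "C \<noteq> {}"
proof -
  obtain v where "v \<in> V 1" using V[of 1] m_pos by auto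
  then have "(1, v) \<in> C" using m_pos by (simp add: in_C)
  then show ?thesis by blast
qed

text \<open>The floor \<delta> gives every joint move a probability of at least \<delta>^m, so that
  the walks can be steered anywhere.\<close>

definition stochastic :: "real \<Rightarrow> (nat \<times> 'v \<Rightarrow> real) \<Rightarrow> bool" where
  "stochastic \<delta> x \<longleftrightarrow> (\<forall>c\<in>C. \<delta> \<le> \<pi> x c) \<and> (\<forall>i\<in>{1..m}. (\<Sum>v\<in>V i. \<pi> x (i, v)) = 1)"

lemma eventually_stochastic:
  "\<exists>\<delta>>0. \<forall>\<^sub>F r in at_right 0. \<forall>x\<in>near C p r. stochastic \<delta> x"
proof -
  define \<delta> where "\<delta> = Min (p ` C) / 2"
  have \<delta>: "\<delta> > 0" using finite_C C_nonempty p_pos by (simp add: \<delta>_def)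
  have \<delta>_le: "\<delta> \<le> p c / 2" if "c \<in> C" for c
    using that finite_C by (simp add: \<delta>_def)
  have "\<forall>\<^sub>F r in at_right 0. \<forall>c\<in>C. \<forall>x\<in>near C p r. \<bar>\<pi> x c - \<pi> p c\<bar> \<le> p c / 2"
    using p_pos by (intro eventually_ball_finite finite_C ballI
        strict_deriv_continuous[OF strict_deriv_trans_map]) auto
  with eventually_pos_near have "\<forall>\<^sub>F r in at_right 0. \<forall>x\<in>near C p r. stochastic \<delta> x"
  proof eventually_elim
    case (elim r)
    show ?case
    proof
      fix x assume x: "x \<in> near C p r"
      have pos: "0 < x c * (\<eta> (fst c) (snd c) + R x c) powr \<alpha>" if "c \<in> C" for c
      proof -
        have "0 < x c" "0 < \<eta> (fst c) (snd c) + R x c" using elim(1) x that by blast+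
        then show ?thesis by simp
      qed
      have 1: "\<delta> \<le> \<pi> x c" if "c \<in> C" for c
      proof -
        have "\<bar>\<pi> x c - p c\<bar> \<le> p c / 2" using elim(2) x that p_fix by metis
        then show ?thesis using \<delta>_le[OF that] unfolding abs_le_iff by linarith
      qed
      have 2: "(\<Sum>v\<in>V i. \<pi> x (i, v)) = 1" if i: "i \<in> {1..m}" for i
      proof -
        define S where "S = (\<Sum>w\<in>V i. x (i, w) * (\<eta> i w + R x (i, w)) powr \<alpha>)"
        have "S > 0" unfolding S_def using V[OF i] pos[of "(i, _)"] i
          by (intro sum_pos) (auto simp: in_C)
        moreover have "(\<Sum>v\<in>V i. \<pi> x (i, v)) = (\<Sum>v\<in>V i. x (i, v) * (\<eta> i v + R x (i, v)) powr \<alpha> / S)"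
          using i by (intro sum.cong refl) (simp add: trans_map_eq in_C S_def)
        ultimately show ?thesis by (simp add: S_def flip: sum_divide_distrib)
      qed
      show "stochastic \<delta> x" unfolding stochastic_def using 1 2 by blast
    qed
  qed
  with \<delta> show ?thesis by blast
qed

lemma stochastic_le_1:
  assumes "stochastic \<delta> x" "0 \<le> \<delta>" "c \<in> C"
  shows "0 \<le> \<pi> x c" "\<pi> x c \<le> 1"
proof -
  have *: "0 \<le> \<pi> x b" if "b \<in> C" for b using assms that unfolding stochastic_def by force
  then show "0 \<le> \<pi> x c" using assms by blast
  have "\<pi> x (fst c, snd c) \<le> (\<Sum>v\<in>V (fst c). \<pi> x (fst c, v))"
    using assms(3) * finite_V fst_C[OF assms(3)] by (intro member_le_sum) (auto simp: coords_def)
  then show "\<pi> x c \<le> 1" using assms fst_C[OF assms(3)] by (simp add: stochastic_def)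
qed

lemma move_prob_ge:
  assumes "stochastic \<delta> x" "0 \<le> \<delta>" "f \<in> moves"
  shows "\<delta> ^ m \<le> move_prob x f"
proof -
  have "(\<Prod>i\<in>{1..m}. \<delta>) \<le> move_prob x f"
    unfolding move_prob_def using assms moves_C[OF assms(3)]
    by (intro prod_mono) (auto simp: stochastic_def)
  then show ?thesis by simp
qed

lemma sum_move_prob:
  assumes "stochastic \<delta> x"
  shows "(\<Sum>f\<in>moves. move_prob x f) = 1"
proof -
  have "(\<Sum>f\<in>moves. move_prob x f) = (\<Prod>i\<in>{1..m}. \<Sum>v\<in>V i. \<pi> x (i, v))"
    unfolding moves_def move_prob_def using V by (subst prod_sum_PiE) auto
  then show ?thesis using assms by (simp add: stochastic_def)
qed

text \<open>A marginal of a product measure: the indicator is moved into the factor of the walk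
  \<open>fst c\<close>, and the other factors sum to 1.\<close>

lemma sum_move_prob_inc:
  assumes "stochastic \<delta> x" "c \<in> C"
  shows "(\<Sum>f\<in>moves. move_prob x f * inc f c) = \<pi> x c"
proof -
  define h where "h i v = \<pi> x (i, v) * (if i = fst c then of_bool (v = snd c) else 1)" for i v
  have "(\<Sum>f\<in>moves. move_prob x f * inc f c) = (\<Sum>f\<in>moves. \<Prod>i\<in>{1..m}. h i (f i))"
    unfolding move_prob_def h_def inc_def prod.distrib
    using fst_C[OF assms(2)] by (simp add: prod.delta)
  also have "\<dots> = (\<Prod>i\<in>{1..m}. \<Sum>v\<in>V i. h i v)"
    unfolding moves_def using V by (subst prod_sum_PiE) auto
  also have "\<dots> = (\<Prod>i\<in>{1..m}. if i = fst c then \<pi> x c else 1)"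
  proof (rule prod.cong, rule refl)
    fix i assume i: "i \<in> {1..m}"
    show "(\<Sum>v\<in>V i. h i v) = (if i = fst c then \<pi> x c else 1)"
    proof (cases "i = fst c")
      case True
      have "(\<Sum>v\<in>V i. h i v) = (\<Sum>v\<in>V i. if v = snd c then \<pi> x c else 0)"
        by (intro sum.cong refl) (auto simp: h_def True)
      then show ?thesis using True assms(2) finite_V[OF i] by (auto simp: coords_def)
    next
      case False
      then show ?thesis using assms(1) i by (simp add: h_def stochastic_def)
    qed
  qed
  also have "\<dots> = \<pi> x c" using fst_C[OF assms(2)] by (simp add: prod.delta)
  finally show ?thesis .
qed

text \<open>For factors in [0, 1], replacing them one at a time changes a product by at most the sum
  of the changes.\<close>

lemma move_prob_diff_le:
  assumes "stochastic \<delta> x" "stochastic \<delta> x'" "0 \<le> \<delta>"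
  shows "(\<Sum>f\<in>moves. \<bar>move_prob x f - move_prob x' f\<bar>) \<le> card moves * l1 C (\<lambda>c. \<pi> x' c - \<pi> x c)"
proof (rule sum_bounded_above)
  fix f assume f: "f \<in> moves"
  have "\<bar>move_prob x f - move_prob x' f\<bar> \<le> (\<Sum>i\<in>{1..m}. \<bar>\<pi> x (i, f i) - \<pi> x' (i, f i)\<bar>)"
    unfolding move_prob_def real_norm_def[symmetric]
    using assms stochastic_le_1 moves_C[OF f] by (intro norm_prod_diff) (auto simp: abs_le_iff intro: order_trans[of _ 0])
  also have "\<dots> = (\<Sum>c\<in>(\<lambda>i. (i, f i)) ` {1..m}. \<bar>\<pi> x c - \<pi> x' c\<bar>)"
    by (subst sum.reindex) (auto simp: inj_on_def)
  also have "\<dots> \<le> l1 C (\<lambda>c. \<pi> x' c - \<pi> x c)"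
    unfolding l1_def using moves_C[OF f]
    by (subst abs_minus_commute) (auto intro!: sum_mono2 finite_C)
  finally show "\<bar>move_prob x f - move_prob x' f\<bar> \<le> l1 C (\<lambda>c. \<pi> x' c - \<pi> x c)" .
qed

lemma l1_J_bounded: "\<exists>K>0. \<forall>z. l1 C (J z) \<le> K * l1 C z"
proof -
  have "\<forall>c\<in>C. \<exists>K>0. \<forall>z. \<bar>J z c\<bar> \<le> K * l1 C z"
  proof
    fix c assume "c \<in> C"
    from strict_deriv_trans_map[OF this] obtain K where "K > 0" "\<And>z. \<bar>J z c\<bar> \<le> K * l1 C z"
      by (rule strict_deriv_bounded) (rule that; assumption)
    then show "\<exists>K>0. \<forall>z. \<bar>J z c\<bar> \<le> K * l1 C z" by blast
  qed
  from bchoice[OF this] obtain K where K: "\<And>c. c \<in> C \<Longrightarrow> K c > 0" "\<And>c z. c \<in> C \<Longrightarrow> \<bar>J z c\<bar> \<le> K c * l1 C z"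
    by blast
  have "l1 C (J z) \<le> sum K C * l1 C z" for z
    unfolding l1_def[of C "J z"] sum_distrib_right by (intro sum_mono K(2))
  moreover have "sum K C > 0" using K(1) finite_C C_nonempty by (intro sum_pos) auto
  ultimately show ?thesis by blast
qed

lemma l1_trans_map_lipschitz:
  "\<exists>K>0. \<forall>\<^sub>F r in at_right 0. \<forall>x\<in>near C p r. \<forall>y\<in>near C p r.
     l1 C (\<lambda>c. \<pi> y c - \<pi> x c) \<le> K * l1 C (\<lambda>c. y c - x c)"
proof -
  have "\<forall>c\<in>C. \<exists>K>0. \<forall>\<^sub>F r in at_right 0. \<forall>x\<in>near C p r. \<forall>y\<in>near C p r.
      \<bar>\<pi> y c - \<pi> x c\<bar> \<le> K * l1 C (\<lambda>c. y c - x c)"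
  proof
    fix c assume "c \<in> C"
    from strict_deriv_trans_map[OF this] obtain K where "K > 0" "\<And>z. \<bar>J z c\<bar> \<le> K * l1 C z"
      "\<forall>\<^sub>F r in at_right 0. \<forall>x\<in>near C p r. \<forall>y\<in>near C p r.
        \<bar>\<pi> y c - \<pi> x c\<bar> \<le> K * l1 C (\<lambda>c. y c - x c)"
      by (rule strict_deriv_lipschitz) (rule that; assumption)
    then show "\<exists>K>0. \<forall>\<^sub>F r in at_right 0. \<forall>x\<in>near C p r. \<forall>y\<in>near C p r.
        \<bar>\<pi> y c - \<pi> x c\<bar> \<le> K * l1 C (\<lambda>c. y c - x c)" by blast
  qed
  from bchoice[OF this] obtain K where K: "\<And>c. c \<in> C \<Longrightarrow> K c > 0"
    "\<And>c. c \<in> C \<Longrightarrow> \<forall>\<^sub>F r in at_right 0. \<forall>x\<in>near C p r. \<forall>y\<in>near C p r.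
      \<bar>\<pi> y c - \<pi> x c\<bar> \<le> K c * l1 C (\<lambda>c. y c - x c)"
    by blast
  have "\<forall>\<^sub>F r in at_right 0. \<forall>c\<in>C. \<forall>x\<in>near C p r. \<forall>y\<in>near C p r.
      \<bar>\<pi> y c - \<pi> x c\<bar> \<le> K c * l1 C (\<lambda>c. y c - x c)"
    using K(2) finite_C by (intro eventually_ball_finite) auto
  then have "\<forall>\<^sub>F r in at_right 0. \<forall>x\<in>near C p r. \<forall>y\<in>near C p r.
     l1 C (\<lambda>c. \<pi> y c - \<pi> x c) \<le> sum K C * l1 C (\<lambda>c. y c - x c)"
  proof eventually_elim
    case (elim r)
    then show ?case
      unfolding l1_def[of C "\<lambda>c. \<pi> _ c - \<pi> _ c"] sum_distrib_right by (intro ballI sum_mono) blast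
  qed
  moreover have "sum K C > 0" using K(1) finite_C C_nonempty by (intro sum_pos) auto
  ultimately show ?thesis by blast
qed

lemma in_box_diff_T:
  assumes "in_box r n y" "in_box r n y'"
  shows "(\<lambda>c. y' c - y c) \<in> T"
  using assms by (auto simp: in_box_def T_def sum_subtractf)

lemma emp_diff_le:
  assumes "n \<ge> 1"
  shows "l1 C (\<lambda>c. emp n y' c - emp n y c) \<le> l1 C (\<lambda>c. y' c - y c) / n"
  unfolding l1_def sum_divide_distrib
proof (rule sum_mono)
  fix c
  have "\<bar>emp n y' c - emp n y c\<bar> = \<bar>y' c - y c\<bar> / (real (card (V (fst c))) + real n)"
    by (simp add: emp_def flip: diff_divide_distrib)
  also have "\<dots> \<le> \<bar>y' c - y c\<bar> / real n" using assms by (intro divide_left_mono mult_pos_pos) auto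
  finally show "\<bar>emp n y' c - emp n y c\<bar> \<le> \<bar>y' c - y c\<bar> / real n" .
qed

text \<open>Strict differentiability compares the images of the two occupation measures at the cost
  of half of \<epsilon>. The other half pays for replacing the denominators
  \<open>card (V i) + n\<close> by \<open>n\<close>, a relative error of order 1 / n, hence
  \<open>n0\<close>.\<close>

lemma drift_estimate:
  assumes "\<epsilon> > 0"
  shows "\<exists>n0\<ge>1. \<forall>\<^sub>F r in at_right 0. \<forall>n\<ge>n0. \<forall>y y'. in_box r n y \<longrightarrow> in_box r n y' \<longrightarrow>
     l1 C (\<lambda>c. \<pi> (emp n y') c - \<pi> (emp n y) c - J (\<lambda>c. y' c - y c) c / n) \<le> \<epsilon> * l1 C (\<lambda>c. y' c - y c) / n"
proof -
  obtain K where K: "K > 0" "\<And>z. l1 C (J z) \<le> K * l1 C z" using l1_J_bounded by blast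
  define D where "D = real (card C)"
  have D: "D > 0" using finite_C C_nonempty by (simp add: D_def card_gt_0_iff)
  have card_le: "real (card (V i)) \<le> D" if "i \<in> {1..m}" for i
  proof -
    have "card (Pair i ` V i) \<le> card C" using that by (intro card_mono finite_C) (auto simp: in_C)
    then show ?thesis by (simp add: D_def card_image inj_on_def)
  qed
  define n0 where "n0 = max 1 (nat \<lceil>2 * K * D / \<epsilon>\<rceil>)"
  have "\<epsilon> / (2 * D) > 0" using assms D by simp
  then have "\<forall>\<^sub>F r in at_right 0. \<forall>c\<in>C. \<forall>x\<in>near C p r. \<forall>y\<in>near C p r.
      \<bar>\<pi> y c - \<pi> x c - J (\<lambda>c. y c - x c) c\<bar> \<le> \<epsilon> / (2 * D) * l1 C (\<lambda>c. y c - x c)"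
    by (intro eventually_ball_finite finite_C ballI) (rule strict_derivD[OF strict_deriv_trans_map])
  then have "\<forall>\<^sub>F r in at_right 0. \<forall>n\<ge>n0. \<forall>y y'. in_box r n y \<longrightarrow> in_box r n y' \<longrightarrow>
     l1 C (\<lambda>c. \<pi> (emp n y') c - \<pi> (emp n y) c - J (\<lambda>c. y' c - y c) c / n) \<le> \<epsilon> * l1 C (\<lambda>c. y' c - y c) / n"
  proof eventually_elim
    case (elim r)
    show ?case
    proof (intro allI impI)
      fix n y y' assume n: "n0 \<le> n" and box: "in_box r n y" "in_box r n y'"
      define x where "x = emp n y"
      define x' where "x' = emp n y'"
      define z where "z c = y' c - y c" for c
      define \<xi> where "\<xi> c = x' c - x c" for c
      \<comment> \<open>The error from the denominators, written as a linear combination to suit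
        \<open>J_lin\<close>.\<close>
      define \<theta> where "\<theta> c = 1 * \<xi> c + (- 1 / real n) * z c" for c
      have n1: "n \<ge> 1" using n by (simp add: n0_def)
      have \<xi>_le: "l1 C \<xi> \<le> l1 C z / n"
        using emp_diff_le[OF n1, of y' y] by (simp add: \<xi>_def[abs_def] z_def[abs_def] x_def x'_def)
      have "l1 C \<theta> \<le> (\<Sum>c\<in>C. D / (real n)\<^sup>2 * \<bar>z c\<bar>)"
        unfolding l1_def
      proof (rule sum_mono)
        fix c assume c: "c \<in> C"
        define d where "d = real (card (V (fst c)))"
        have "\<theta> c = z c / (d + n) - z c / n"
          by (simp add: \<theta>_def \<xi>_def x_def x'_def emp_def z_def d_def diff_divide_distrib)
        also have "\<dots> = - (d / (n * (d + n))) * z c" using n1 by (simp add: d_def field_simps)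
        finally have "\<bar>\<theta> c\<bar> = d / (n * (d + n)) * \<bar>z c\<bar>" by (simp add: abs_mult d_def)
        also have "\<dots> \<le> D / (real n)\<^sup>2 * \<bar>z c\<bar>"
          using card_le[OF fst_C[OF c]] n1 D
          by (intro mult_right_mono frac_le) (auto simp: d_def power2_eq_square)
        finally show "\<bar>\<theta> c\<bar> \<le> D / (real n)\<^sup>2 * \<bar>z c\<bar>" .
      qed
      then have \<theta>_le: "l1 C \<theta> \<le> D / (real n)\<^sup>2 * l1 C z" by (simp add: l1_def sum_distrib_left)
      have "l1 C (J \<theta>) \<le> K * (D / (real n)\<^sup>2 * l1 C z)"
        using order_trans[OF K(2) mult_left_mono[OF \<theta>_le]] K(1) by simp
      also have "\<dots> = (K * D / n) * (l1 C z / n)" by (simp add: power2_eq_square)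
      also have "\<dots> \<le> \<epsilon> / 2 * (l1 C z / n)"
      proof (intro mult_right_mono)
        have "2 * K * D / \<epsilon> \<le> n" using n by (simp add: n0_def nat_le_iff ceiling_le_iff)
        then show "K * D / n \<le> \<epsilon> / 2" using assms n1 by (simp add: field_simps)
      qed simp
      finally have J\<theta>: "l1 C (J \<theta>) \<le> \<epsilon> / 2 * (l1 C z / n)" .
      have "l1 C (\<lambda>c. \<pi> x' c - \<pi> x c - J \<xi> c) \<le> card C * (\<epsilon> / (2 * D) * l1 C \<xi>)"
        unfolding l1_def[of C "\<lambda>c. \<pi> x' c - \<pi> x c - J \<xi> c"]
        using elim box unfolding \<xi>_def[abs_def] x_def x'_def
        by (intro sum_bounded_above) (auto simp: in_box_def)
      also have "\<dots> = \<epsilon> / 2 * l1 C \<xi>" using D by (simp add: D_def)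
      also have "\<dots> \<le> \<epsilon> / 2 * (l1 C z / n)" using assms \<xi>_le by (intro mult_left_mono) auto
      finally have 1: "l1 C (\<lambda>c. \<pi> x' c - \<pi> x c - J \<xi> c) \<le> \<epsilon> / 2 * (l1 C z / n)" .
      have "J \<theta> c = J \<xi> c - J z c / n" for c
        unfolding \<theta>_def by (subst J_lin) simp
      then have "l1 C (\<lambda>c. \<pi> x' c - \<pi> x c - J z c / n) = l1 C (\<lambda>c. (\<pi> x' c - \<pi> x c - J \<xi> c) + J \<theta> c)"
        by (intro l1_cong) (simp add: algebra_simps)
      also have "\<dots> \<le> l1 C (\<lambda>c. \<pi> x' c - \<pi> x c - J \<xi> c) + l1 C (J \<theta>)" by (rule l1_triangle)
      also have "\<dots> \<le> \<epsilon> / 2 * (l1 C z / n) + \<epsilon> / 2 * (l1 C z / n)"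
        by (intro add_mono 1 J\<theta>)
      also have "\<dots> = \<epsilon> * l1 C z / n" by (simp add: field_simps)
      finally show "l1 C (\<lambda>c. \<pi> (emp n y') c - \<pi> (emp n y) c - J (\<lambda>c. y' c - y c) c / n)
          \<le> \<epsilon> * l1 C (\<lambda>c. y' c - y c) / n"
        by (simp add: x_def x'_def z_def[abs_def])
    qed
  qed
  moreover have "n0 \<ge> 1" by (simp add: n0_def)
  ultimately show ?thesis by blast
qed

end

section \<open>The probability of staying near the fixed point\<close>

context walk_model
begin

text \<open>The probability that the process with counts \<open>y\<close> at time \<open>n\<close> is in the box at the
  times \<open>n, \<dots>, n + j\<close>.\<close>

primrec stay :: "nat \<Rightarrow> real \<Rightarrow> nat \<Rightarrow> (nat \<times> 'v \<Rightarrow> real) \<Rightarrow> real" where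
  "stay 0 r n y = of_bool (in_box r n y)"
| "stay (Suc j) r n y = of_bool (in_box r n y) *
     (\<Sum>f\<in>moves. move_prob (emp n y) f * stay j r (Suc n) (\<lambda>c. y c + inc f c))"

lemma stay_not_in_box: "\<not> in_box r n y \<Longrightarrow> stay j r n y = 0"
  by (cases j) auto

lemma stay_bounds:
  assumes st: "\<forall>x\<in>near C p r. stochastic \<delta> x" and \<delta>: "0 \<le> \<delta>"
  shows "0 \<le> stay j r n y \<and> stay j r n y \<le> 1"
proof (induction j arbitrary: n y)
  case (Suc j)
  show ?case
  proof (cases "in_box r n y")
    case True
    then have s: "stochastic \<delta> (emp n y)" using st by (simp add: in_box_def)
    have p0: "0 \<le> move_prob (emp n y) f" if "f \<in> moves" for f
      using move_prob_ge[OF s \<delta> that] \<delta> by (meson order_trans zero_le_power)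
    have "(\<Sum>f\<in>moves. move_prob (emp n y) f * stay j r (Suc n) (\<lambda>c. y c + inc f c))
        \<le> (\<Sum>f\<in>moves. move_prob (emp n y) f * 1)"
      using Suc p0 by (intro sum_mono mult_left_mono) auto
    then have "stay (Suc j) r n y \<le> 1" using True sum_move_prob[OF s] by simp
    moreover have "0 \<le> stay (Suc j) r n y"
      using Suc p0 by (auto intro!: mult_nonneg_nonneg sum_nonneg)
    ultimately show ?thesis by blast
  qed simp
qed simp

lemma l1_inc_diff_le: "l1 C (\<lambda>c. inc f' c - inc f c) \<le> real (card C) * of_bool (f \<noteq> f')"
  unfolding l1_def by (rule sum_bounded_above) (auto simp: inc_def)

end

text \<open>Fixes a gauge with the properties from \<open>gauge_exists\<close>, so that the coupling
  argument depends on these and not on its formula.\<close>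

locale gauge_model = walk_model m V \<alpha> \<eta> \<rho> p
  for m and V :: "nat \<Rightarrow> 'v set" and \<alpha> \<eta> \<rho> p +
  fixes u :: "(nat \<times> 'v \<Rightarrow> real) \<Rightarrow> real" and l :: "(nat \<times> 'v \<Rightarrow> real) \<Rightarrow> nat \<times> 'v \<Rightarrow> real"
    and \<Lambda> c1 :: real
  assumes \<Lambda>_pos: "\<Lambda> > 0" and c1_pos: "c1 > 0"
    and u_le: "\<And>z. u z \<le> \<Lambda> * l1 C z"
    and l_le: "\<And>z c. c \<in> C \<Longrightarrow> \<bar>l z c\<bar> \<le> \<Lambda>"
    and sum_l: "\<And>z. (\<Sum>c\<in>C. l z c * z c) = u z"
    and u_add: "\<And>z y. l1 C z > 0 \<Longrightarrow>
       u (\<lambda>c. z c + y c) \<ge> u z + (\<Sum>c\<in>C. l z c * y c) - \<Lambda> * (l1 C y)\<^sup>2 / l1 C z"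
    and u_drift: "\<And>z. z \<in> T \<Longrightarrow> 0 \<le> u z \<Longrightarrow> (\<Sum>c\<in>C. l z c * B z c) \<ge> c1 * l1 C z"
    and u_pos: "\<exists>z\<in>T. 0 < u z"
    and u_scale: "\<And>s z. s \<ge> 0 \<Longrightarrow> u (\<lambda>c. s * z c) = s * u z"
begin

lemma sum_l_le: "\<bar>\<Sum>c\<in>C. l z c * y c\<bar> \<le> \<Lambda> * l1 C y"
proof -
  have "\<bar>\<Sum>c\<in>C. l z c * y c\<bar> \<le> (\<Sum>c\<in>C. \<Lambda> * \<bar>y c\<bar>)"
    by (rule order_trans[OF sum_abs]) (auto simp: abs_mult intro!: sum_mono mult_right_mono l_le)
  then show ?thesis by (simp add: l1_def sum_distrib_left)
qed

text \<open>The expected difference of two coupled copies grows like \<open>z / n\<close> plus the unstable drift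
  \<open>B z / n\<close>, while the copies jump differently only with probability \<open>O(\<bar>z\<bar> / n)\<close>, so the
  exponential moment of \<open>u\<close> absorbs the noise.\<close>

lemma separated_step:
  "\<exists>A>0. \<exists>lam0>0. \<exists>b>0. \<exists>n0\<ge>1. \<forall>\<^sub>F r in at_right 0. \<forall>n\<ge>n0. \<forall>y y' lam.
     in_box r n y \<longrightarrow> in_box r n y' \<longrightarrow> A \<le> u (\<lambda>c. y' c - y c) \<longrightarrow> 0 \<le> lam \<longrightarrow> lam \<le> lam0 \<longrightarrow>
     (\<exists>\<kappa>. (\<forall>f\<in>moves. \<forall>f'\<in>moves. 0 \<le> \<kappa> f f') \<and>
        (\<forall>f\<in>moves. (\<Sum>f'\<in>moves. \<kappa> f f') = move_prob (emp n y) f) \<and>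
        (\<forall>f'\<in>moves. (\<Sum>f\<in>moves. \<kappa> f f') = move_prob (emp n y') f') \<and>
        (\<Sum>f\<in>moves. \<Sum>f'\<in>moves. \<kappa> f f' * exp (- lam * u (\<lambda>c. (y' c + inc f' c) - (y c + inc f c))))
          \<le> exp (- lam * ((1 + 1 / n) * (1 + b / n) * u (\<lambda>c. y' c - y c))))"
proof -
  obtain \<delta> where \<delta>: "\<delta> > 0" "\<forall>\<^sub>F r in at_right 0. \<forall>x\<in>near C p r. stochastic \<delta> x"
    using eventually_stochastic by blast
  obtain L where L: "L > 0" "\<forall>\<^sub>F r in at_right 0. \<forall>x\<in>near C p r. \<forall>y\<in>near C p r.
     l1 C (\<lambda>c. \<pi> y c - \<pi> x c) \<le> L * l1 C (\<lambda>c. y c - x c)"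
    using l1_trans_map_lipschitz by blast
  define q where "q = real (card C)"
  define Cj where "Cj = real (card moves) * L"
  \<comment> \<open>The budget of the drift c1 * N1 / n: the linearization error with \<epsilon>,
    the second order error of \<open>u\<close> once \<open>u z\<close> is at least \<open>A\<close>,
    and the noise with lam at most \<open>lam0\<close> cost one sixth each; \<open>b\<close> spends
    the remaining half.\<close>
  define \<epsilon> where "\<epsilon> = c1 / (6 * \<Lambda>)"
  define S where "S = \<Lambda> * q + \<Lambda> * q\<^sup>2 + 1"
  define A where "A = \<Lambda> * max 1 (6 * \<Lambda> * q\<^sup>2 * Cj / c1)"
  define lam0 where "lam0 = min (1 / S) (c1 / (6 * S\<^sup>2 * (Cj + 1)))"
  define b where "b = c1 / (4 * \<Lambda>)"
  have q0: "q \<ge> 0" by (simp add: q_def)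
  have Cj0: "Cj \<ge> 0" using L(1) by (simp add: Cj_def)
  have \<epsilon>0: "\<epsilon> > 0" using c1_pos \<Lambda>_pos by (simp add: \<epsilon>_def)
  have S0: "S > 0" using \<Lambda>_pos q0 by (simp add: S_def add_nonneg_pos)
  have A0: "A > 0" using \<Lambda>_pos by (simp add: A_def)
  have lam0: "lam0 > 0" using S0 c1_pos Cj0 by (simp add: lam0_def)
  have b0: "b > 0" using c1_pos \<Lambda>_pos by (simp add: b_def)
  obtain n0 where n0: "n0 \<ge> 1" "\<forall>\<^sub>F r in at_right 0. \<forall>n\<ge>n0. \<forall>y y'. in_box r n y \<longrightarrow> in_box r n y' \<longrightarrow>
     l1 C (\<lambda>c. \<pi> (emp n y') c - \<pi> (emp n y) c - J (\<lambda>c. y' c - y c) c / n) \<le> \<epsilon> * l1 C (\<lambda>c. y' c - y c) / n"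
    using drift_estimate[OF \<epsilon>0] by blast
  have "\<forall>\<^sub>F r in at_right 0. \<forall>n\<ge>n0. \<forall>y y' lam.
     in_box r n y \<longrightarrow> in_box r n y' \<longrightarrow> A \<le> u (\<lambda>c. y' c - y c) \<longrightarrow> 0 \<le> lam \<longrightarrow> lam \<le> lam0 \<longrightarrow>
     (\<exists>\<kappa>. (\<forall>f\<in>moves. \<forall>f'\<in>moves. 0 \<le> \<kappa> f f') \<and>
        (\<forall>f\<in>moves. (\<Sum>f'\<in>moves. \<kappa> f f') = move_prob (emp n y) f) \<and>
        (\<forall>f'\<in>moves. (\<Sum>f\<in>moves. \<kappa> f f') = move_prob (emp n y') f') \<and>
        (\<Sum>f\<in>moves. \<Sum>f'\<in>moves. \<kappa> f f' * exp (- lam * u (\<lambda>c. (y' c + inc f' c) - (y c + inc f c))))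
          \<le> exp (- lam * ((1 + 1 / n) * (1 + b / n) * u (\<lambda>c. y' c - y c))))"
    using \<delta>(2) L(2) n0(2)
  proof eventually_elim
    case (elim r)
    show ?case
    proof (intro allI impI)
      fix n y y' lam
      assume n: "n0 \<le> n" and box: "in_box r n y" "in_box r n y'"
        and uA: "A \<le> u (\<lambda>c. y' c - y c)" and lam: "0 \<le> lam" "lam \<le> lam0"
      define z where "z = (\<lambda>c. y' c - y c)"
      define N1 where "N1 = l1 C z"
      define x where "x = emp n y"
      define x' where "x' = emp n y'"
      have n1: "real n \<ge> 1" using n n0(1) by simp
      have zT: "z \<in> T" unfolding z_def by (rule in_box_diff_T[OF box])
      have near: "x \<in> near C p r" "x' \<in> near C p r" using box by (auto simp: in_box_def x_def x'_def)
      then have st: "stochastic \<delta> x" "stochastic \<delta> x'" using elim(1) by blast+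
      have "A \<le> \<Lambda> * N1" using uA u_le[of z] by (simp add: z_def N1_def)
      then have "max 1 (6 * \<Lambda> * q\<^sup>2 * Cj / c1) \<le> N1" using \<Lambda>_pos by (simp add: A_def)
      then have N1: "1 \<le> N1" and "6 * \<Lambda> * q\<^sup>2 * Cj / c1 \<le> N1" by simp_all
      then have N1': "6 * (\<Lambda> * q\<^sup>2 * Cj) \<le> c1 * N1" using c1_pos by (simp add: field_simps)
      have uz0: "0 \<le> u z" using uA A0 by (simp add: z_def)
      have p0: "0 \<le> move_prob x f" "0 \<le> move_prob x' f" if "f \<in> moves" for f
        using move_prob_ge[OF st(1) _ that] move_prob_ge[OF st(2) _ that] \<delta>(1)
        by (meson less_imp_le order_trans zero_le_power)+
      obtain \<kappa> where \<kappa>: "\<And>f f'. f \<in> moves \<Longrightarrow> f' \<in> moves \<Longrightarrow> 0 \<le> \<kappa> f f'"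
        "\<And>f. f \<in> moves \<Longrightarrow> (\<Sum>f'\<in>moves. \<kappa> f f') = move_prob x f"
        "\<And>f'. f' \<in> moves \<Longrightarrow> (\<Sum>f\<in>moves. \<kappa> f f') = move_prob x' f'"
        "(\<Sum>f\<in>moves. \<Sum>f'\<in>moves. of_bool (f \<noteq> f') * \<kappa> f f') \<le> (\<Sum>f\<in>moves. \<bar>move_prob x f - move_prob x' f\<bar>)"
        by (rule coupling_exists[OF finite_moves p0(1) p0(2) sum_move_prob[OF st(1)] sum_move_prob[OF st(2)]])
          (assumption | rule that)+
      define X where "X = moves \<times> moves"
      define k where "k = (\<lambda>(f, f'). \<kappa> f f')"
      define dz where "dz = (\<lambda>(f, f') c. inc f' c - inc f c)"
      define jmp where "jmp = (\<lambda>(f :: nat \<Rightarrow> 'v, f'). of_bool (f \<noteq> f') :: real)"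
      \<comment> \<open>The part of the increment of \<open>u\<close> that \<open>u_add\<close>
        guarantees. It vanishes when both copies make the same move.\<close>
      define s where "s \<theta> = (\<Sum>c\<in>C. l z c * dz \<theta> c) - \<Lambda> * (l1 C (dz \<theta>))\<^sup>2 / N1" for \<theta> :: "(nat \<Rightarrow> 'v) \<times> (nat \<Rightarrow> 'v)"
      \<comment> \<open>The increment to be achieved: \<open>u z + d\<close> is the exponent in the
        claim.\<close>
      define d where "d = (1 + 1 / n) * (1 + b / n) * u z - u z"
      have finX: "finite X" by (simp add: X_def finite_moves)
      have sumX: "(\<Sum>f\<in>moves. \<Sum>f'\<in>moves. h f f') = (\<Sum>\<theta>\<in>X. h (fst \<theta>) (snd \<theta>))" for h :: "_ \<Rightarrow> _ \<Rightarrow> real"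
        by (simp add: X_def sum.cartesian_product case_prod_beta)
      have k0: "0 \<le> k \<theta>" if "\<theta> \<in> X" for \<theta> using that \<kappa>(1) by (auto simp: k_def X_def)
      have k1: "sum k X = 1"
      proof -
        have "sum k X = (\<Sum>f\<in>moves. \<Sum>f'\<in>moves. \<kappa> f f')" by (simp add: sumX k_def case_prod_beta)
        then show ?thesis using \<kappa>(2) sum_move_prob[OF st(1)] by simp
      qed
      have jmp01: "jmp \<theta> = 0 \<or> jmp \<theta> = 1" for \<theta> by (auto simp: jmp_def split: prod.splits)
      have dz_le: "l1 C (dz \<theta>) \<le> q * jmp \<theta>" for \<theta>
        using l1_inc_diff_le[of "snd \<theta>" "fst \<theta>"] by (simp add: dz_def jmp_def q_def case_prod_beta)
      have dz2: "(l1 C (dz \<theta>))\<^sup>2 \<le> q\<^sup>2 * jmp \<theta>" for \<theta>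
        using power_mono[OF dz_le l1_nonneg, of \<theta> 2] jmp01[of \<theta>] by auto
      have jump: "(\<Sum>\<theta>\<in>X. k \<theta> * jmp \<theta>) \<le> Cj * N1 / n"
      proof -
        have "(\<Sum>\<theta>\<in>X. k \<theta> * jmp \<theta>) = (\<Sum>f\<in>moves. \<Sum>f'\<in>moves. of_bool (f \<noteq> f') * \<kappa> f f')"
          by (simp add: sumX k_def jmp_def case_prod_beta mult.commute)
        also have "\<dots> \<le> (\<Sum>f\<in>moves. \<bar>move_prob x f - move_prob x' f\<bar>)" by (rule \<kappa>(4))
        also have "\<dots> \<le> card moves * l1 C (\<lambda>c. \<pi> x' c - \<pi> x c)"
          using move_prob_diff_le[OF st] \<delta>(1) by simp
        also have "\<dots> \<le> card moves * (L * l1 C (\<lambda>c. x' c - x c))"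
          using elim(2) near by (intro mult_left_mono) auto
        also have "\<dots> \<le> card moves * (L * (N1 / n))"
          using emp_diff_le[of n y' y] n1 L(1) unfolding N1_def z_def x_def x'_def
          by (intro mult_left_mono) auto
        finally show ?thesis by (simp add: Cj_def)
      qed
      have mean: "(\<Sum>\<theta>\<in>X. k \<theta> * dz \<theta> c) = \<pi> x' c - \<pi> x c" if c: "c \<in> C" for c
      proof -
        have "(\<Sum>\<theta>\<in>X. k \<theta> * dz \<theta> c) = (\<Sum>f\<in>moves. \<Sum>f'\<in>moves. \<kappa> f f' * inc f' c) -
            (\<Sum>f\<in>moves. \<Sum>f'\<in>moves. \<kappa> f f' * inc f c)"
          by (simp add: sumX k_def dz_def case_prod_beta right_diff_distrib sum_subtractf)
        also have "(\<Sum>f\<in>moves. \<Sum>f'\<in>moves. \<kappa> f f' * inc f c) = \<pi> x c"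
          using \<kappa>(2) sum_move_prob_inc[OF st(1) c] by (simp flip: sum_distrib_right)
        also have "(\<Sum>f\<in>moves. \<Sum>f'\<in>moves. \<kappa> f f' * inc f' c) = \<pi> x' c"
          using \<kappa>(3) sum_move_prob_inc[OF st(2) c] by (subst sum.swap) (simp flip: sum_distrib_right)
        finally show ?thesis by simp
      qed
      have Es: "u z / n + 4 / 6 * (c1 * N1 / n) \<le> (\<Sum>\<theta>\<in>X. k \<theta> * s \<theta>)"
      proof -
        define err where "err c = \<pi> x' c - \<pi> x c - J z c / n" for c
        have err: "l1 C err \<le> \<epsilon> * N1 / n"
          using elim(3) n box unfolding err_def x_def x'_def N1_def z_def by simp
        have "(\<Sum>\<theta>\<in>X. k \<theta> * (\<Sum>c\<in>C. l z c * dz \<theta> c)) = (\<Sum>c\<in>C. \<Sum>\<theta>\<in>X. k \<theta> * (l z c * dz \<theta> c))"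
          by (subst sum.swap) (simp add: sum_distrib_left)
        also have "\<dots> = (\<Sum>c\<in>C. l z c * (\<Sum>\<theta>\<in>X. k \<theta> * dz \<theta> c))"
          by (simp add: sum_distrib_left mult.left_commute)
        also have "\<dots> = (\<Sum>c\<in>C. l z c * err c + (l z c * z c) / n + (l z c * B z c) / n)"
          by (intro sum.cong refl) (simp add: mean err_def J_on_T[OF zT] algebra_simps add_divide_distrib)
        also have "\<dots> = (\<Sum>c\<in>C. l z c * err c) + u z / n + (\<Sum>c\<in>C. l z c * B z c) / n"
          by (simp add: sum.distrib sum_l flip: sum_divide_distrib)
        also have "\<dots> \<ge> - (\<Lambda> * (\<epsilon> * N1 / n)) + u z / n + c1 * N1 / n"
        proof (intro add_mono)
          have "\<bar>\<Sum>c\<in>C. l z c * err c\<bar> \<le> \<Lambda> * (\<epsilon> * N1 / n)"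
            using order_trans[OF sum_l_le mult_left_mono[OF err]] \<Lambda>_pos by simp
          then show "- (\<Lambda> * (\<epsilon> * N1 / n)) \<le> (\<Sum>c\<in>C. l z c * err c)" by linarith
          show "c1 * N1 / n \<le> (\<Sum>c\<in>C. l z c * B z c) / n"
            using u_drift[OF zT uz0] unfolding N1_def by (intro divide_right_mono) auto
        qed simp
        finally have 1: "- (\<Lambda> * (\<epsilon> * N1 / n)) + u z / n + c1 * N1 / n \<le>
            (\<Sum>\<theta>\<in>X. k \<theta> * (\<Sum>c\<in>C. l z c * dz \<theta> c))" .
        have "(\<Sum>\<theta>\<in>X. k \<theta> * (\<Lambda> * (l1 C (dz \<theta>))\<^sup>2 / N1)) \<le> (\<Sum>\<theta>\<in>X. k \<theta> * (\<Lambda> * (q\<^sup>2 * jmp \<theta>) / N1))"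
          using \<Lambda>_pos N1 by (intro sum_mono mult_left_mono divide_right_mono dz2 k0) auto
        also have "\<dots> = \<Lambda> * q\<^sup>2 / N1 * (\<Sum>\<theta>\<in>X. k \<theta> * jmp \<theta>)"
          unfolding sum_distrib_left by (intro sum.cong refl) simp
        also have "\<dots> \<le> \<Lambda> * q\<^sup>2 / N1 * (Cj * N1 / n)"
          using \<Lambda>_pos N1 by (intro mult_left_mono jump) auto
        also have "\<dots> = \<Lambda> * q\<^sup>2 * Cj / n" using N1 by simp
        also have "\<dots> \<le> (c1 * N1 / 6) / n" using N1' by (intro divide_right_mono) auto
        finally have 2: "(\<Sum>\<theta>\<in>X. k \<theta> * (\<Lambda> * (l1 C (dz \<theta>))\<^sup>2 / N1)) \<le> c1 * N1 / n / 6" by simp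
        have 3: "\<Lambda> * (\<epsilon> * N1 / n) = c1 * N1 / n / 6" using \<Lambda>_pos by (simp add: \<epsilon>_def)
        have "(\<Sum>\<theta>\<in>X. k \<theta> * s \<theta>) = (\<Sum>\<theta>\<in>X. k \<theta> * (\<Sum>c\<in>C. l z c * dz \<theta> c)) -
            (\<Sum>\<theta>\<in>X. k \<theta> * (\<Lambda> * (l1 C (dz \<theta>))\<^sup>2 / N1))"
          by (simp only: s_def right_diff_distrib sum_subtractf)
        moreover define W where "W = c1 * N1 / n"
        ultimately show ?thesis using 1 2 unfolding 3 W_def[symmetric] by linarith
      qed
      have s_le: "\<bar>s \<theta>\<bar> \<le> S * jmp \<theta>" for \<theta>
      proof -
        have "\<bar>\<Sum>c\<in>C. l z c * dz \<theta> c\<bar> \<le> \<Lambda> * (q * jmp \<theta>)"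
          using order_trans[OF sum_l_le mult_left_mono[OF dz_le]] \<Lambda>_pos by simp
        moreover have "\<Lambda> * (l1 C (dz \<theta>))\<^sup>2 / N1 \<le> \<Lambda> * (q\<^sup>2 * jmp \<theta>) / 1"
          using \<Lambda>_pos N1 dz2 jmp01[of \<theta>] by (intro frac_le mult_left_mono) auto
        moreover have "0 \<le> \<Lambda> * (l1 C (dz \<theta>))\<^sup>2 / N1" using \<Lambda>_pos N1 by simp
        moreover have "S * jmp \<theta> = \<Lambda> * (q * jmp \<theta>) + \<Lambda> * (q\<^sup>2 * jmp \<theta>) + jmp \<theta>"
          by (simp add: S_def algebra_simps)
        moreover have "0 \<le> jmp \<theta>" using jmp01[of \<theta>] by auto
        ultimately show ?thesis unfolding s_def abs_le_iff by linarith
      qed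
      have lamS: "lam * S \<le> 1" using lam S0 by (simp add: lam0_def field_simps)
      have d_le: "d \<le> u z / n + c1 * N1 / n / 2"
      proof -
        have "d = (1 + b + b / n) * (u z / n)" using n1 by (simp add: d_def field_simps)
        also have "\<dots> \<le> (1 + 2 * b) * (u z / n)"
        proof (intro mult_right_mono)
          have "b / n \<le> b / 1" using n1 b0 by (intro divide_left_mono) auto
          then show "1 + b + b / n \<le> 1 + 2 * b" by simp
        qed (use uz0 in simp)
        also have "\<dots> = u z / n + c1 / (2 * \<Lambda>) * (u z / n)" by (simp add: b_def algebra_simps)
        also have "c1 / (2 * \<Lambda>) * (u z / n) \<le> c1 / (2 * \<Lambda>) * (\<Lambda> * N1 / n)"
          using u_le[of z] c1_pos \<Lambda>_pos unfolding N1_def by (intro mult_left_mono divide_right_mono) auto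
        also have "\<dots> = c1 * N1 / n / 2" using \<Lambda>_pos by simp
        finally show ?thesis by simp
      qed
      have noise: "lam * S\<^sup>2 * (\<Sum>\<theta>\<in>X. k \<theta> * jmp \<theta>) \<le> c1 * N1 / n / 6"
      proof -
        have "lam * S\<^sup>2 * (\<Sum>\<theta>\<in>X. k \<theta> * jmp \<theta>) \<le> lam * S\<^sup>2 * (Cj * N1 / n)"
          using lam by (intro mult_left_mono jump) auto
        also have "\<dots> = (lam * (S\<^sup>2 * Cj)) * (N1 / n)" by simp
        also have "\<dots> \<le> (c1 / 6) * (N1 / n)"
        proof (intro mult_right_mono)
          have "lam * (S\<^sup>2 * Cj) \<le> c1 / (6 * S\<^sup>2 * (Cj + 1)) * (S\<^sup>2 * (Cj + 1))"
            using lam Cj0 c1_pos S0 by (intro mult_mono) (auto simp: lam0_def)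
          also have "\<dots> = c1 / 6"
          proof -
            have "c1 / (6 * e) * e = c1 / 6" if "e > 0" for e :: real using that by simp
            then show ?thesis using S0 Cj0 by (simp only: mult.assoc) (simp add: add_nonneg_pos)
          qed
          finally show "lam * (S\<^sup>2 * Cj) \<le> c1 / 6" .
        qed (use N1 in simp)
        finally show ?thesis by simp
      qed
      have exp_s: "(\<Sum>\<theta>\<in>X. k \<theta> * exp (- lam * s \<theta>)) \<le> exp (- lam * d)"
      proof (rule sum_exp_le[where S = S and j = jmp, OF finX k0 k1 s_le jmp01 lam(1) lamS])
        define W where "W = c1 * N1 / n"
        show "d + lam * S\<^sup>2 * (\<Sum>\<theta>\<in>X. k \<theta> * jmp \<theta>) \<le> (\<Sum>\<theta>\<in>X. k \<theta> * s \<theta>)"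
          using Es d_le noise unfolding W_def[symmetric] by linarith
      qed
      have "(\<Sum>f\<in>moves. \<Sum>f'\<in>moves. \<kappa> f f' * exp (- lam * u (\<lambda>c. (y' c + inc f' c) - (y c + inc f c))))
          = (\<Sum>\<theta>\<in>X. k \<theta> * exp (- lam * u (\<lambda>c. z c + dz \<theta> c)))"
        by (simp add: sumX k_def dz_def z_def case_prod_beta algebra_simps)
      also have "\<dots> \<le> (\<Sum>\<theta>\<in>X. k \<theta> * (exp (- lam * u z) * exp (- lam * s \<theta>)))"
      proof (intro sum_mono mult_left_mono k0)
        fix \<theta>
        have "u z + s \<theta> \<le> u (\<lambda>c. z c + dz \<theta> c)"
          using u_add[of z "dz \<theta>"] N1 by (simp add: s_def N1_def)
        then have "lam * (u z + s \<theta>) \<le> lam * u (\<lambda>c. z c + dz \<theta> c)" using lam by (intro mult_left_mono) auto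
        then show "exp (- lam * u (\<lambda>c. z c + dz \<theta> c)) \<le> exp (- lam * u z) * exp (- lam * s \<theta>)"
          unfolding exp_add[symmetric] by (simp add: algebra_simps)
      qed
      also have "\<dots> = exp (- lam * u z) * (\<Sum>\<theta>\<in>X. k \<theta> * exp (- lam * s \<theta>))"
        by (simp add: sum_distrib_left mult.left_commute)
      also have "\<dots> \<le> exp (- lam * u z) * exp (- lam * d)" using exp_s by simp
      also have "\<dots> = exp (- lam * ((1 + 1 / n) * (1 + b / n) * u z))"
        unfolding exp_add[symmetric] by (simp add: d_def algebra_simps)
      finally show "\<exists>\<kappa>. (\<forall>f\<in>moves. \<forall>f'\<in>moves. 0 \<le> \<kappa> f f') \<and>
        (\<forall>f\<in>moves. (\<Sum>f'\<in>moves. \<kappa> f f') = move_prob (emp n y) f) \<and>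
        (\<forall>f'\<in>moves. (\<Sum>f\<in>moves. \<kappa> f f') = move_prob (emp n y') f') \<and>
        (\<Sum>f\<in>moves. \<Sum>f'\<in>moves. \<kappa> f f' * exp (- lam * u (\<lambda>c. (y' c + inc f' c) - (y c + inc f c))))
          \<le> exp (- lam * ((1 + 1 / n) * (1 + b / n) * u (\<lambda>c. y' c - y c)))"
        using \<kappa>(1-3) unfolding z_def x_def x'_def by (intro exI[of _ \<kappa>]) blast
    qed
  qed
  then show ?thesis using A0 lam0 b0 n0(1) by blast
qed

end

section \<open>Escape from a neighbourhood of the fixed point\<close>

lemma one_plus_sum_le_prod:
  fixes f :: "nat \<Rightarrow> real"
  assumes "finite I" "\<And>i. i \<in> I \<Longrightarrow> 0 \<le> f i"
  shows "1 + sum f I \<le> (\<Prod>i\<in>I. 1 + f i)"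
  using assms
proof (induction I rule: finite_induct)
  case (insert i I)
  have "0 \<le> f i * sum f I" using insert by (intro mult_nonneg_nonneg sum_nonneg) auto
  then have "1 + sum f (insert i I) \<le> (1 + f i) * (1 + sum f I)"
    using insert by (simp add: algebra_simps)
  also have "\<dots> \<le> (1 + f i) * (\<Prod>i\<in>I. 1 + f i)" using insert by (intro mult_left_mono) auto
  finally show ?case using insert by simp
qed simp

text \<open>The product dominates b times a harmonic sum. The bound \<open>k \<ge> n\<close> lets
  \<open>k\<close> serve as a horizon after \<open>n\<close>.\<close>

lemma prod_one_plus_inverse_unbounded:
  fixes b M :: real
  assumes "b > 0"
  shows "\<exists>k\<ge>n. M \<le> (\<Prod>i\<in>{1..<k}. 1 + b / real i)"
proof -
  have "eventually (\<lambda>N. M / b \<le> (harm N :: real)) sequentially"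
    using harm_at_top unfolding filterlim_at_top by blast
  then obtain N0 where N0: "\<And>N. N \<ge> N0 \<Longrightarrow> M / b \<le> (harm N :: real)"
    unfolding eventually_sequentially by blast
  define N where "N = max N0 n"
  have "b * (M / b) \<le> b * harm N" using assms N0[of N] by (intro mult_left_mono) (auto simp: N_def)
  then have "M \<le> b * harm N" using assms by simp
  also have "\<dots> = (\<Sum>i\<in>{1..<Suc N}. b / real i)"
    by (simp add: harm_def sum_distrib_left divide_inverse atLeastLessThanSuc_atLeastAtMost)
  also have "\<dots> \<le> (\<Prod>i\<in>{1..<Suc N}. 1 + b / real i)"
    using one_plus_sum_le_prod[of "{1..<Suc N}" "\<lambda>i. b / real i"] assms by simp
  finally show ?thesis by (intro exI[of _ "Suc N"]) (simp add: N_def)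
qed

text \<open>Round down everywhere except at one point, which receives the remainder. Its error is
  the sum of the other errors, hence the factor 2.\<close>

lemma round_to_counts:
  fixes x :: "'x \<Rightarrow> real"
  assumes fin: "finite I" "I \<noteq> {}" and x: "\<And>v. v \<in> I \<Longrightarrow> 0 \<le> x v" "sum x I = real K"
  shows "\<exists>a :: 'x \<Rightarrow> nat. sum a I = K \<and> (\<Sum>v\<in>I. \<bar>real (a v) - x v\<bar>) \<le> 2 * real (card I)"
proof -
  obtain v0 where v0: "v0 \<in> I" using fin by blast
  define b where "b v = nat \<lfloor>x v\<rfloor>" for v
  have b: "real (b v) \<le> x v" "x v - real (b v) \<le> 1" if "v \<in> I" for v
    using x(1)[OF that] of_int_floor_le[of "x v"] floor_correct[of "x v"] by (auto simp: b_def) linarith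
  define s where "s = sum b (I - {v0})"
  have "real s \<le> sum x (I - {v0})" unfolding s_def of_nat_sum using b by (intro sum_mono) auto
  also have "\<dots> \<le> real K" using fin v0 x by (simp add: sum_diff1)
  finally have sK: "s \<le> K" by simp
  define a where "a v = (if v = v0 then K - s else b v)" for v
  have "sum a I = a v0 + sum a (I - {v0})" using fin v0 by (simp add: sum.remove)
  also have "sum a (I - {v0}) = s" unfolding s_def by (intro sum.cong) (auto simp: a_def)
  finally have sum_a: "sum a I = K" using sK by (simp add: a_def)
  have "(\<Sum>v\<in>I. \<bar>real (a v) - x v\<bar>) = \<bar>real (a v0) - x v0\<bar> + (\<Sum>v\<in>I - {v0}. \<bar>real (a v) - x v\<bar>)"
    using fin v0 by (simp add: sum.remove)
  also have "real (a v0) - x v0 = (\<Sum>v\<in>I - {v0}. x v - real (b v))"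
    using fin v0 x(2) sK by (simp add: a_def sum_subtractf sum_diff1 s_def of_nat_diff)
  also have "\<bar>\<dots>\<bar> \<le> (\<Sum>v\<in>I - {v0}. \<bar>x v - real (b v)\<bar>)" by (rule sum_abs)
  also have "\<dots> \<le> (\<Sum>v\<in>I - {v0}. 1)"
  proof (rule sum_mono)
    fix v assume "v \<in> I - {v0}"
    then show "\<bar>x v - real (b v)\<bar> \<le> 1" using b[of v] by auto
  qed
  also have "(\<Sum>v\<in>I - {v0}. \<bar>real (a v) - x v\<bar>) \<le> (\<Sum>v\<in>I - {v0}. 1)"
  proof (rule sum_mono)
    fix v assume "v \<in> I - {v0}"
    then show "\<bar>real (a v) - x v\<bar> \<le> 1" using b[of v] by (auto simp: a_def)
  qed
  also have "(\<Sum>v\<in>I - {v0}. 1) + (\<Sum>v\<in>I - {v0}. 1) \<le> 2 * real (card I)"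
    using fin v0 by (simp add: card_Diff_singleton)
  finally show ?thesis using sum_a by (intro exI[of _ a]) simp
qed

section \<open>Steering to prescribed counts\<close>

context walk_model
begin

text \<open>An escape probability \<open>e\<close> after one particular joint move survives up to
  the factor \<delta>^m, the least probability of that move. Outside the box \<open>stay\<close> is
  0, which is even better.\<close>

lemma stay_Suc_le_if_move:
  assumes st: "\<forall>x\<in>near C p r. stochastic \<delta> x" and \<delta>: "0 \<le> \<delta>" and \<delta>1: "\<delta> \<le> 1"
    and f: "f \<in> moves" and e: "0 \<le> e" "e \<le> 1" and le: "stay j r (Suc n) (\<lambda>c. y c + inc f c) \<le> 1 - e"
  shows "stay (Suc j) r n y \<le> 1 - \<delta> ^ m * e"
proof (cases "in_box r n y")
  case True
  define \<mu> where "\<mu> = move_prob (emp n y)"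
  define S where "S g = stay j r (Suc n) (\<lambda>c. y c + inc g c)" for g
  have s: "stochastic \<delta> (emp n y)" using st True by (simp add: in_box_def)
  have \<mu>: "\<delta> ^ m \<le> \<mu> g" "0 \<le> \<mu> g" if "g \<in> moves" for g
    using move_prob_ge[OF s \<delta> that] \<delta> by (auto simp: \<mu>_def intro: order_trans[OF zero_le_power])
  have "stay (Suc j) r n y = (\<Sum>g\<in>moves. \<mu> g * S g)" using True by (simp add: \<mu>_def S_def)
  also have "\<dots> \<le> (\<Sum>g\<in>moves. \<mu> g - (if g = f then \<mu> g * e else 0))"
  proof (rule sum_mono)
    fix g assume g: "g \<in> moves"
    have "S g \<le> 1 - (if g = f then e else 0)"
      using le stay_bounds[OF st \<delta>, of j "Suc n" "\<lambda>c. y c + inc g c"] by (auto simp: S_def)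
    then have "\<mu> g * S g \<le> \<mu> g * (1 - (if g = f then e else 0))"
      using \<mu>(2)[OF g] by (intro mult_left_mono)
    then show "\<mu> g * S g \<le> \<mu> g - (if g = f then \<mu> g * e else 0)" by (auto simp: algebra_simps)
  qed
  also have "\<dots> = 1 - \<mu> f * e"
    using f finite_moves sum_move_prob[OF s] by (simp add: sum_subtractf \<mu>_def)
  also have "\<dots> \<le> 1 - \<delta> ^ m * e" using \<mu>(1)[OF f] e by (simp add: mult_right_mono)
  finally show ?thesis .
next
  case False
  have "\<delta> ^ m * e \<le> 1" using \<delta> \<delta>1 e by (intro mult_le_one power_le_one) auto
  then show ?thesis using False by simp
qed

text \<open>Visit counts with the same total \<open>K\<close> for each walk can be realised by
  \<open>K\<close> joint moves. The path may leave the box on the way, since that only lowers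
  \<open>stay\<close>.\<close>

lemma stay_le_if_reach:
  assumes st: "\<forall>x\<in>near C p r. stochastic \<delta> x" and \<delta>: "0 \<le> \<delta>" "\<delta> \<le> 1"
    and a: "\<And>i. i \<in> {1..m} \<Longrightarrow> (\<Sum>v\<in>V i. a (i, v)) = (K :: nat)"
  shows "\<exists>y2. (\<forall>c\<in>C. y2 c = y c + real (a c)) \<and>
     stay (K + j) r n y \<le> 1 - (\<delta> ^ m) ^ K * (1 - stay j r (n + K) y2)"
  using a
proof (induction K arbitrary: a n y)
  case 0
  then have "a c = 0" if "c \<in> C" for c using that finite_V by (fastforce simp: coords_def)
  then show ?case by (intro exI[of _ y]) simp
next
  case (Suc K)
  have "\<forall>i\<in>{1..m}. \<exists>v. v \<in> V i \<and> 0 < a (i, v)"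
  proof
    fix i assume "i \<in> {1..m}"
    then have "(\<Sum>v\<in>V i. a (i, v)) \<noteq> 0" using Suc.prems by simp
    then show "\<exists>v. v \<in> V i \<and> 0 < a (i, v)" by (meson not_gr0 sum.neutral)
  qed
  from bchoice[OF this] obtain g where g: "\<And>i. i \<in> {1..m} \<Longrightarrow> g i \<in> V i \<and> 0 < a (i, g i)" by blast
  define f where "f = restrict g {1..m}"
  have f: "f \<in> moves" using g by (auto simp: f_def moves_def)
  \<comment> \<open>Subtraction of natural numbers; nothing is truncated on \<open>C\<close>, since
    \<open>g\<close> picks vertices with positive counts.\<close>
  define a' where "a' c = a c - of_bool (f (fst c) = snd c)" for c
  have a'_eq: "a c = a' c + of_bool (f (fst c) = snd c)" if "c \<in> C" for c
    using g[OF fst_C[OF that]] fst_C[OF that] by (cases c) (auto simp: a'_def f_def)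
  have a': "(\<Sum>v\<in>V i. a' (i, v)) = K" if i: "i \<in> {1..m}" for i
  proof -
    have "Suc K = (\<Sum>v\<in>V i. a' (i, v) + of_bool (f i = v))"
      unfolding Suc.prems[OF i, symmetric] using i by (intro sum.cong refl) (simp add: a'_eq in_C)
    also have "\<dots> = (\<Sum>v\<in>V i. a' (i, v)) + (\<Sum>v\<in>V i. if f i = v then 1 else 0)"
      unfolding sum.distrib by (simp only: of_bool_def)
    also have "(\<Sum>v\<in>V i. if f i = v then 1 else 0) = (1 :: nat)"
      using finite_V[OF i] f i by (subst sum.delta') (auto simp: moves_def)
    finally show ?thesis by simp
  qed
  obtain y2 where y2: "\<And>c. c \<in> C \<Longrightarrow> y2 c = (y c + inc f c) + real (a' c)"
    "stay (K + j) r (Suc n) (\<lambda>c. y c + inc f c) \<le> 1 - (\<delta> ^ m) ^ K * (1 - stay j r (Suc n + K) y2)"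
    using Suc.IH[of a' "\<lambda>c. y c + inc f c" "Suc n", OF a'] by blast
  define e where "e = (\<delta> ^ m) ^ K * (1 - stay j r (Suc n + K) y2)"
  have "0 \<le> e" "e \<le> 1"
    using stay_bounds[OF st \<delta>(1), of j "Suc n + K" y2] \<delta>
    unfolding e_def by (auto intro!: mult_le_one power_le_one mult_nonneg_nonneg)
  from stay_Suc_le_if_move[OF st \<delta> f this] y2(2)
  have "stay (Suc (K + j)) r n y \<le> 1 - \<delta> ^ m * e" unfolding e_def by blast
  then have "stay (Suc K + j) r n y \<le> 1 - (\<delta> ^ m) ^ Suc K * (1 - stay j r (n + Suc K) y2)"
    by (simp add: e_def mult.assoc del: stay.simps)
  moreover have "\<forall>c\<in>C. y2 c = y c + real (a c)"
    using y2(1) by (simp add: a'_eq inc_def of_bool_def)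
  ultimately show ?case by blast
qed

end

section \<open>Separation of two copies and escape\<close>

context gauge_model
begin

text \<open>In the box \<open>u\<close> is at most linear in time, which the growth from
  \<open>separated_step\<close> contradicts. Backward induction on the horizon needs the coupling
  for one step at a time only, because a sum of two survival probabilities, unlike a joint one, is
  determined by the marginals.\<close>

lemma separated_stay:
  "\<exists>A>0. \<exists>lam0>0. \<exists>n0\<ge>1. \<forall>\<^sub>F r in at_right 0. \<forall>n\<ge>n0. \<exists>j. \<forall>y y'.
     stay j r n y + stay j r n y' \<le> 1 + 2 * exp (lam0 * (A - u (\<lambda>c. y' c - y c)))"
proof -
  obtain A lam0 b n0 where A: "A > 0" and lam0: "lam0 > 0" and b: "b > 0" and n0: "n0 \<ge> 1"
    and step: "\<forall>\<^sub>F r in at_right 0. \<forall>n\<ge>n0. \<forall>y y' lam.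
     in_box r n y \<longrightarrow> in_box r n y' \<longrightarrow> A \<le> u (\<lambda>c. y' c - y c) \<longrightarrow> 0 \<le> lam \<longrightarrow> lam \<le> lam0 \<longrightarrow>
     (\<exists>\<kappa>. (\<forall>f\<in>moves. \<forall>f'\<in>moves. 0 \<le> \<kappa> f f') \<and>
        (\<forall>f\<in>moves. (\<Sum>f'\<in>moves. \<kappa> f f') = move_prob (emp n y) f) \<and>
        (\<forall>f'\<in>moves. (\<Sum>f\<in>moves. \<kappa> f f') = move_prob (emp n y') f') \<and>
        (\<Sum>f\<in>moves. \<Sum>f'\<in>moves. \<kappa> f f' * exp (- lam * u (\<lambda>c. (y' c + inc f' c) - (y c + inc f c))))
          \<le> exp (- lam * ((1 + 1 / n) * (1 + b / n) * u (\<lambda>c. y' c - y c))))"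
    using separated_step by blast
  obtain \<delta> where \<delta>: "\<delta> > 0" "\<forall>\<^sub>F r in at_right 0. \<forall>x\<in>near C p r. stochastic \<delta> x"
    using eventually_stochastic by blast
  \<comment> \<open>Solves the recursion with the growth factor (1 + 1 / n) (1 + b / n): with lam =
    \<theta> / w n the exponent at time n + 1 becomes the one at time n. It grows faster than
    n.\<close>
  define w where "w k = real k * (\<Prod>i\<in>{1..<k}. 1 + b / real i)" for k :: nat
  have w_pos: "w k > 0" if "k \<ge> 1" for k
    unfolding w_def using that b by (intro mult_pos_pos prod_pos) (auto intro: add_pos_nonneg)
  have w_Suc: "w (Suc k) = w k * ((1 + 1 / k) * (1 + b / k))" if "k \<ge> 1" for k
    using that by (simp add: w_def atLeastLessThanSuc field_simps)
  have "\<forall>\<^sub>F r in at_right 0. \<forall>n\<ge>n0. \<exists>j. \<forall>y y'.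
     stay j r n y + stay j r n y' \<le> 1 + 2 * exp (lam0 * (A - u (\<lambda>c. y' c - y c)))"
    using step \<delta>(2) eventually_at_right_less[of 0]
  proof eventually_elim
    case (elim r)
    note st = elim(2)
    have stay01: "0 \<le> stay j r n y" "stay j r n y \<le> 1" for j n y
      using stay_bounds[OF st less_imp_le[OF \<delta>(1)]] by blast+
    \<comment> \<open>In the box corresponding counts differ by at most 2 r (card (V i) + n), so
      \<open>u\<close> is at most \<open>U * n\<close>.\<close>
    define U where "U = \<Lambda> * (real (card C) * (2 * r)) * (1 + real (\<Sum>i\<in>{1..m}. card (V i)))"
    have U: "u (\<lambda>c. y' c - y c) \<le> U * n" if n: "n \<ge> 1" and box: "in_box r n y" "in_box r n y'" for n y y'
    proof -
      define D where "D = real (\<Sum>i\<in>{1..m}. card (V i))"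
      have "l1 C (\<lambda>c. y' c - y c) \<le> card C * ((2 * r) * ((1 + D) * n))"
        unfolding l1_def
      proof (rule sum_bounded_above)
        fix c assume c: "c \<in> C"
        define N where "N = real (card (V (fst c))) + real n"
        have N0: "N > 0" using n by (simp add: N_def add_nonneg_pos)
        have "card (V (fst c)) \<le> (\<Sum>i\<in>{1..m}. card (V i))" using fst_C[OF c] by (intro member_le_sum) auto
        then have "real (card (V (fst c))) \<le> D" unfolding D_def by (simp only: of_nat_le_iff)
        then have "N \<le> D + n" by (simp add: N_def)
        also have "\<dots> \<le> (1 + D) * n"
        proof -
          have "0 \<le> D" unfolding D_def by (rule of_nat_0_le_iff)
          then have "D * 1 \<le> D * n" using n by (intro mult_left_mono) auto
          then show ?thesis by (simp add: algebra_simps)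
        qed
        finally have N: "N \<le> (1 + D) * n" .
        have "\<bar>emp n y c - p c\<bar> \<le> r" "\<bar>emp n y' c - p c\<bar> \<le> r"
          using box c by (auto simp: in_box_def near_def)
        then have "\<bar>emp n y' c - emp n y c\<bar> \<le> 2 * r" by linarith
        moreover have "emp n y' c - emp n y c = (y' c - y c) / N"
          by (simp add: emp_def N_def diff_divide_distrib)
        ultimately have "\<bar>y' c - y c\<bar> \<le> 2 * r * N" using N0 by (simp add: field_simps)
        also have "\<dots> \<le> 2 * r * ((1 + D) * n)" using elim(3) N by (intro mult_left_mono) auto
        finally show "\<bar>y' c - y c\<bar> \<le> 2 * r * ((1 + D) * real n)" .
      qed
      from order_trans[OF u_le mult_left_mono[OF this less_imp_le[OF \<Lambda>_pos]]] show ?thesis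
        unfolding U_def D_def[symmetric] by (simp only: mult_ac)
    qed
    have claim: "stay j r n y + stay j r n y' \<le> 1 + 2 * exp (\<theta> / w n * (A - u (\<lambda>c. y' c - y c)))"
      if "n \<ge> n0" "0 \<le> \<theta>" "\<theta> / w n \<le> lam0" "\<theta> / w (n + j) * (U * (n + j)) \<le> ln 2" for j n \<theta> y y'
      using that
    proof (induction j arbitrary: n y y')
      case 0
      show ?case
      proof (cases "in_box r n y \<and> in_box r n y'")
        case True
        define z where "z = (\<lambda>c. y' c - y c)"
        have n1: "n \<ge> 1" using 0 n0 by simp
        have th: "0 \<le> \<theta> / w n" using 0 w_pos[OF n1] by simp
        \<comment> \<open>At the horizon the exponent is at least - ln 2, so the bound is at least 2
          and holds trivially; hence the factor 2 in the claim.\<close>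
        have "\<theta> / w n * u z \<le> \<theta> / w n * (U * n)"
          using U[OF n1, of y y'] True th unfolding z_def by (intro mult_left_mono) auto
        also have "\<dots> \<le> ln 2" using 0 by simp
        finally have "\<theta> / w n * u z \<le> ln 2" .
        moreover have "0 \<le> \<theta> / w n * A" using th A by (intro mult_nonneg_nonneg) auto
        ultimately have "- ln 2 \<le> \<theta> / w n * (A - u z)" unfolding right_diff_distrib by linarith
        then have "exp (- ln 2) \<le> exp (\<theta> / w n * (A - u z))" by simp
        then have "1 \<le> 2 * exp (\<theta> / w n * (A - u z))" by (simp add: exp_minus)
        then show ?thesis using stay01[of 0 n y] stay01[of 0 n y'] unfolding z_def by linarith
      next
        case False
        have "0 \<le> exp (\<theta> / w n * (A - u (\<lambda>c. y' c - y c)))" by simp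
        then show ?thesis using False stay_not_in_box[of r n y 0] stay_not_in_box[of r n y' 0]
            stay01[of 0 n y] stay01[of 0 n y'] by (smt (verit))
      qed
    next
      case (Suc j)
      define z where "z = (\<lambda>c. y' c - y c)"
      have n1: "n \<ge> 1" using Suc n0 by simp
      have th: "0 \<le> \<theta> / w n" using Suc w_pos[OF n1] by simp
      have pos: "0 \<le> exp (\<theta> / w n * (A - u z))" by simp
      show ?case
      proof (cases "in_box r n y \<and> in_box r n y' \<and> A \<le> u z")
        case False
        \<comment> \<open>A copy outside the box contributes 0 and the other at most 1; below the
          threshold \<open>A\<close> the exponent is nonnegative and the bound exceeds 2.\<close>
        then consider "\<not> in_box r n y" | "\<not> in_box r n y'" | "u z < A" by linarith
        then have "stay (Suc j) r n y + stay (Suc j) r n y' \<le> 1 + 2 * exp (\<theta> / w n * (A - u z))"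
        proof cases
          case 1
          then show ?thesis using stay01[of "Suc j" n y'] stay_not_in_box[of r n y "Suc j"] pos by linarith
        next
          case 2
          then show ?thesis using stay01[of "Suc j" n y] stay_not_in_box[of r n y' "Suc j"] pos by linarith
        next
          case 3
          then have "0 \<le> \<theta> / w n * (A - u z)" using th by (intro mult_nonneg_nonneg) auto
          then have "1 \<le> exp (\<theta> / w n * (A - u z))" by (simp only: one_le_exp_iff)
          then show ?thesis using stay01[of "Suc j" n y'] stay01[of "Suc j" n y] by linarith
        qed
        then show ?thesis by (simp only: z_def)
      next
        case True
        define lam where "lam = \<theta> / w (Suc n)"
        define G where "G = (1 + 1 / real n) * (1 + b / n)"
        have G1: "G \<ge> 1"
          using mult_mono[of 1 "1 + 1 / real n" 1 "1 + b / n"] b by (simp add: G_def)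
        have lamG: "lam * G = \<theta> / w n"
          using w_Suc[OF n1] G1 by (simp add: lam_def G_def[symmetric])
        have lam_nn: "0 \<le> lam" using Suc.prems w_pos[of "Suc n"] by (simp add: lam_def)
        have "lam * 1 \<le> lam * G" using G1 lam_nn by (intro mult_left_mono)
        then have lam_le: "lam \<le> \<theta> / w n" using lamG by simp
        have IH: "stay j r (Suc n) y1 + stay j r (Suc n) y2 \<le> 1 + 2 * exp (lam * (A - u (\<lambda>c. y2 c - y1 c)))" for y1 y2
          unfolding lam_def using Suc.prems lam_le by (intro Suc.IH) (auto simp: lam_def)
        define S where "S f = stay j r (Suc n) (\<lambda>c. y c + inc f c)" for f
        define S' where "S' f = stay j r (Suc n) (\<lambda>c. y' c + inc f c)" for f
        define E where "E f f' = exp (- lam * u (\<lambda>c. (y' c + inc f' c) - (y c + inc f c)))" for f f'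
        have "lam \<le> lam0" using lam_le Suc.prems(3) by linarith
        moreover have "A \<le> u (\<lambda>c. y' c - y c)" using True by (simp add: z_def)
        ultimately have "\<exists>\<kappa>. (\<forall>f\<in>moves. \<forall>f'\<in>moves. 0 \<le> \<kappa> f f') \<and>
          (\<forall>f\<in>moves. (\<Sum>f'\<in>moves. \<kappa> f f') = move_prob (emp n y) f) \<and>
          (\<forall>f'\<in>moves. (\<Sum>f\<in>moves. \<kappa> f f') = move_prob (emp n y') f') \<and>
          (\<Sum>f\<in>moves. \<Sum>f'\<in>moves. \<kappa> f f' * E f f') \<le> exp (- lam * (G * u z))"
          unfolding E_def G_def z_def
          using True by (intro elim(1)[rule_format, OF Suc.prems(1) _ _ _ lam_nn]) auto
        then obtain \<kappa> where \<kappa>: "\<And>f f'. f \<in> moves \<Longrightarrow> f' \<in> moves \<Longrightarrow> 0 \<le> \<kappa> f f'"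
          "\<And>f. f \<in> moves \<Longrightarrow> (\<Sum>f'\<in>moves. \<kappa> f f') = move_prob (emp n y) f"
          "\<And>f'. f' \<in> moves \<Longrightarrow> (\<Sum>f\<in>moves. \<kappa> f f') = move_prob (emp n y') f'"
          "(\<Sum>f\<in>moves. \<Sum>f'\<in>moves. \<kappa> f f' * E f f') \<le> exp (- lam * (G * u z))"
          by blast
        have sum1: "(\<Sum>f\<in>moves. \<Sum>f'\<in>moves. \<kappa> f f') = 1"
          using \<kappa>(2) sum_move_prob[of \<delta> "emp n y"] st True by (simp add: in_box_def)
        \<comment> \<open>Each survival probability sees only its own marginal, so both become sums
          over the coupling.\<close>
        have "stay (Suc j) r n y = (\<Sum>f\<in>moves. \<Sum>f'\<in>moves. \<kappa> f f' * S f)"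
          using True \<kappa>(2) by (simp add: S_def flip: sum_distrib_right)
        moreover have "stay (Suc j) r n y' = (\<Sum>f\<in>moves. \<Sum>f'\<in>moves. \<kappa> f f' * S' f')"
          using True \<kappa>(3) by (subst sum.swap) (simp add: S'_def flip: sum_distrib_right)
        ultimately have "stay (Suc j) r n y + stay (Suc j) r n y' =
            (\<Sum>f\<in>moves. \<Sum>f'\<in>moves. \<kappa> f f' * (S f + S' f'))"
          by (simp add: sum.distrib distrib_left)
        also have "\<dots> \<le> (\<Sum>f\<in>moves. \<Sum>f'\<in>moves. \<kappa> f f' * (1 + 2 * exp (lam * A) * E f f'))"
        proof (intro sum_mono mult_left_mono \<kappa>(1))
          fix f f'
          have "exp (lam * (A - u (\<lambda>c. (y' c + inc f' c) - (y c + inc f c)))) = exp (lam * A) * E f f'"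
            unfolding E_def exp_add[symmetric] by (simp add: algebra_simps)
          then show "S f + S' f' \<le> 1 + 2 * exp (lam * A) * E f f'"
            using IH[of "\<lambda>c. y c + inc f c" "\<lambda>c. y' c + inc f' c"] by (simp add: S_def S'_def)
        qed
        also have "\<dots> = 1 + 2 * exp (lam * A) * (\<Sum>f\<in>moves. \<Sum>f'\<in>moves. \<kappa> f f' * E f f')"
          by (simp add: distrib_left sum.distrib sum1 sum_distrib_left mult_ac)
        also have "\<dots> \<le> 1 + 2 * exp (lam * A) * exp (- lam * (G * u z))"
          using \<kappa>(4) by simp
        also have "\<dots> = 1 + 2 * exp (lam * A - \<theta> / w n * u z)"
          by (simp add: exp_add[symmetric] lamG[symmetric] mult.assoc)
        also have "\<dots> \<le> 1 + 2 * exp (\<theta> / w n * A - \<theta> / w n * u z)"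
          using mult_right_mono[OF lam_le, of A] A by simp
        finally show ?thesis by (simp add: z_def right_diff_distrib)
      qed
    qed
    show ?case
    proof (intro allI impI)
      fix n assume n: "n0 \<le> n"
      then have n1: "n \<ge> 1" using n0 by simp
      \<comment> \<open>Makes lam equal to \<open>lam0\<close> at time n. The horizon depends on n
        through \<theta>, but not on the two states.\<close>
      define \<theta> where "\<theta> = lam0 * w n"
      have \<theta>: "0 \<le> \<theta>" "\<theta> / w n = lam0" using lam0 w_pos[OF n1] by (auto simp: \<theta>_def)
      have U0: "0 \<le> U"
        using \<Lambda>_pos elim(3) unfolding U_def by (intro mult_nonneg_nonneg add_nonneg_nonneg of_nat_0_le_iff) auto
      \<comment> \<open>As \<open>w k\<close> is k times this product, \<theta> / w k * (U * k)
        falls to ln 2 or below.\<close>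
      obtain k where k: "k \<ge> n" "\<theta> * U / ln 2 \<le> (\<Prod>i\<in>{1..<k}. 1 + b / real i)"
        using prod_one_plus_inverse_unbounded[OF b] by blast
      define P where "P = (\<Prod>i\<in>{1..<k}. 1 + b / real i)"
      have P: "P > 0" unfolding P_def using b by (intro prod_pos) (auto intro: add_pos_nonneg)
      have wk: "w k = real k * P" unfolding w_def P_def by (rule refl)
      have "\<theta> * U / ln 2 \<le> P" using k(2) unfolding P_def .
      then have "\<theta> * U \<le> ln 2 * P" by (simp add: field_simps)
      moreover have "\<theta> / w k * (U * k) = \<theta> * U / P"
        using k n1 by (simp add: wk)
      moreover have "\<theta> * U / P \<le> ln 2" using calculation(1) P by (simp add: divide_le_eq)
      ultimately have "\<theta> / w k * (U * k) \<le> ln 2" by (simp only:)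
      then have "\<theta> / w (n + (k - n)) * (U * real (n + (k - n))) \<le> ln 2" using k by simp
      from claim[OF n \<theta>(1) _ this] show "\<exists>j. \<forall>y y'.
        stay j r n y + stay j r n y' \<le> 1 + 2 * exp (lam0 * (A - u (\<lambda>c. y' c - y c)))"
        by (intro exI[of _ "k - n"]) (simp add: \<theta>(2))
    qed
  qed
  then show ?thesis using A lam0 n0 by blast
qed

text \<open>The two target states add visits with frequencies \<open>p\<close> and p + \<epsilon>
  z0, so up to rounding they differ by K \<epsilon> z0, whatever the starting state and time. Thus
  \<open>K\<close> and the escape probability are fixed before r, n and y.\<close>

lemma escape:
  "\<exists>\<delta>>0. \<exists>n0\<ge>1. \<forall>\<^sub>F r in at_right 0. \<forall>n\<ge>n0. \<exists>j. \<forall>y. stay j r n y \<le> 1 - \<delta>"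
proof -
  obtain A lam0 n0 where A: "A > 0" and lam0: "lam0 > 0" and n0: "n0 \<ge> 1"
    and sep: "\<forall>\<^sub>F r in at_right 0. \<forall>n\<ge>n0. \<exists>j. \<forall>y y'.
     stay j r n y + stay j r n y' \<le> 1 + 2 * exp (lam0 * (A - u (\<lambda>c. y' c - y c)))"
    using separated_stay by blast
  obtain \<delta>0 where \<delta>0: "\<delta>0 > 0" "\<forall>\<^sub>F r in at_right 0. \<forall>x\<in>near C p r. stochastic \<delta>0 x"
    using eventually_stochastic by blast
  define \<delta> where "\<delta> = min \<delta>0 1"
  have \<delta>: "0 < \<delta>" "\<delta> \<le> 1" using \<delta>0 by (auto simp: \<delta>_def)
  obtain z0 where z0: "z0 \<in> T" "0 < u z0" using u_pos by blast
  define q where "q = real (card C)"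
  have "0 < \<Lambda> * l1 C z0" using u_le[of z0] z0(2) by linarith
  then have l1z0: "l1 C z0 > 0" using \<Lambda>_pos by (simp add: zero_less_mult_iff)
  \<comment> \<open>The largest multiple for which |\<epsilon> z0| stays below every coordinate of
    \<open>p\<close> by the l1 bound, so that \<open>p'\<close> is a point of the simplices.\<close>
  define \<epsilon> where "\<epsilon> = Min (p ` C) / l1 C z0"
  have \<epsilon>: "\<epsilon> > 0" using l1z0 finite_C C_nonempty p_pos by (simp add: \<epsilon>_def)
  define p' where "p' c = p c + \<epsilon> * z0 c" for c
  have p'0: "0 \<le> p' c" if c: "c \<in> C" for c
  proof -
    have "\<epsilon> * \<bar>z0 c\<bar> \<le> \<epsilon> * l1 C z0" using \<epsilon> c finite_C by (intro mult_left_mono abs_le_l1) auto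
    also have "\<dots> = Min (p ` C)" using l1z0 by (simp add: \<epsilon>_def)
    also have "\<dots> \<le> p c" using c finite_C by simp
    finally have "\<bar>\<epsilon> * z0 c\<bar> \<le> p c" using \<epsilon> by (simp add: abs_mult)
    then show ?thesis unfolding p'_def by linarith
  qed
  \<comment> \<open>The first two terms make the exponential at most 1 / 8; the others absorb the
    linear and quadratic effect of a rounding error of at most 4 q.\<close>
  define W where "W = A + ln 8 / lam0 + \<Lambda> * (4 * q) + \<Lambda> * (4 * q)\<^sup>2"
  \<comment> \<open>The first bound lifts the gauge of K \<epsilon> z0 to \<open>W\<close>; the
    second makes its l1 norm at least 1, the denominator in the quadratic error.\<close>
  obtain K where K: "real K \<ge> max (W / (\<epsilon> * u z0)) (1 / (\<epsilon> * l1 C z0))" using real_arch_simple by blast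
  have KW: "W \<le> K * \<epsilon> * u z0" and K1: "1 \<le> K * \<epsilon> * l1 C z0"
    using K \<epsilon> z0 l1z0 by (simp_all add: field_simps)
  have round: "\<exists>a :: nat \<times> 'v \<Rightarrow> nat. (\<forall>i\<in>{1..m}. (\<Sum>v\<in>V i. a (i, v)) = K) \<and> l1 C (\<lambda>c. real (a c) - K * x c) \<le> 2 * q"
    if x: "\<And>c. c \<in> C \<Longrightarrow> 0 \<le> x c" "\<And>i. i \<in> {1..m} \<Longrightarrow> (\<Sum>v\<in>V i. x (i, v)) = 1" for x :: "nat \<times> 'v \<Rightarrow> real"
  proof -
    have "\<forall>i\<in>{1..m}. \<exists>a :: 'v \<Rightarrow> nat. sum a (V i) = K \<and> (\<Sum>v\<in>V i. \<bar>real (a v) - K * x (i, v)\<bar>) \<le> 2 * real (card (V i))"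
      using V x by (intro ballI round_to_counts) (auto simp: in_C simp flip: sum_distrib_left)
    from bchoice[OF this] obtain a where a: "\<And>i. i \<in> {1..m} \<Longrightarrow> sum (a i) (V i) = K \<and>
        (\<Sum>v\<in>V i. \<bar>real (a i v) - K * x (i, v)\<bar>) \<le> 2 * real (card (V i))" by blast
    have "l1 C (\<lambda>c. real (case_prod a c) - K * x c) = (\<Sum>i\<in>{1..m}. \<Sum>v\<in>V i. \<bar>real (a i v) - K * x (i, v)\<bar>)"
      unfolding l1_def by (subst sum_C) simp
    also have "\<dots> \<le> (\<Sum>i\<in>{1..m}. 2 * real (card (V i)))" using a by (intro sum_mono) blast
    also have "\<dots> = 2 * q"
      unfolding q_def coords_def using finite_V by (subst card_SigmaI) (auto simp: sum_distrib_left)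
    finally show ?thesis using a by (intro exI[of _ "case_prod a"]) auto
  qed
  obtain a where a: "\<And>i. i \<in> {1..m} \<Longrightarrow> (\<Sum>v\<in>V i. a (i, v)) = K" "l1 C (\<lambda>c. real (a c) - K * p c) \<le> 2 * q"
    using round[of p] p_pos p_sum less_imp_le by blast
  have "(\<Sum>v\<in>V i. p' (i, v)) = 1" if "i \<in> {1..m}" for i
    using p_sum[OF that] z0(1) that by (simp add: p'_def sum.distrib T_def flip: sum_distrib_left)
  then obtain b where b: "\<And>i. i \<in> {1..m} \<Longrightarrow> (\<Sum>v\<in>V i. b (i, v)) = K" "l1 C (\<lambda>c. real (b c) - K * p' c) \<le> 2 * q"
    using round[of p'] p'0 by blast
  \<comment> \<open>The two survival probabilities add up to at most 5 / 4, so one of the escape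
    probabilities is at least (2 - 5 / 4) / 2 = 3 / 8.\<close>
  define \<gamma> where "\<gamma> = (\<delta> ^ m) ^ K * (3 / 8)"
  have \<gamma>: "\<gamma> > 0" using \<delta> by (simp add: \<gamma>_def)
  have "\<forall>\<^sub>F r in at_right 0. \<forall>n\<ge>n0. \<exists>j. \<forall>y. stay j r n y \<le> 1 - \<gamma>"
    using sep \<delta>0(2)
  proof eventually_elim
    case (elim r)
    have st: "\<forall>x\<in>near C p r. stochastic \<delta> x"
      using elim(2) unfolding stochastic_def \<delta>_def by fastforce
    show ?case
    proof (intro allI impI)
      fix n assume n: "n0 \<le> n"
      then obtain j where j: "\<And>y y'. stay j r (n + K) y + stay j r (n + K) y' \<le>
          1 + 2 * exp (lam0 * (A - u (\<lambda>c. y' c - y c)))"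
        using elim(1)[rule_format, of "n + K"] by auto
      have "stay (K + j) r n y \<le> 1 - \<gamma>" for y
      proof -
        obtain ya where ya: "\<And>c. c \<in> C \<Longrightarrow> ya c = y c + real (a c)"
          "stay (K + j) r n y \<le> 1 - (\<delta> ^ m) ^ K * (1 - stay j r (n + K) ya)"
          using stay_le_if_reach[OF st less_imp_le[OF \<delta>(1)] \<delta>(2) a(1), where y = y and j = j and n = n] by blast
        obtain yb where yb: "\<And>c. c \<in> C \<Longrightarrow> yb c = y c + real (b c)"
          "stay (K + j) r n y \<le> 1 - (\<delta> ^ m) ^ K * (1 - stay j r (n + K) yb)"
          using stay_le_if_reach[OF st less_imp_le[OF \<delta>(1)] \<delta>(2) b(1), where y = y and j = j and n = n] by blast
        define e where "e c = yb c - ya c - K * \<epsilon> * z0 c" for c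
        have "l1 C e = l1 C (\<lambda>c. (real (b c) - K * p' c) + - 1 * (real (a c) - K * p c))"
          by (rule l1_cong) (simp add: e_def ya yb p'_def algebra_simps)
        also have "\<dots> \<le> l1 C (\<lambda>c. real (b c) - K * p' c) + l1 C (\<lambda>c. - 1 * (real (a c) - K * p c))"
          by (rule l1_triangle)
        also have "\<dots> \<le> 4 * q" unfolding l1_scale using a(2) b(2) by simp
        finally have e: "l1 C e \<le> 4 * q" .
        have l1s: "l1 C (\<lambda>c. K * \<epsilon> * z0 c) = K * \<epsilon> * l1 C z0" unfolding l1_scale using \<epsilon> by simp
        have "K * \<epsilon> * u z0 + (\<Sum>c\<in>C. l (\<lambda>c. K * \<epsilon> * z0 c) c * e c) - \<Lambda> * (l1 C e)\<^sup>2 / (K * \<epsilon> * l1 C z0)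
            \<le> u (\<lambda>c. K * \<epsilon> * z0 c + e c)"
          using u_add[of "\<lambda>c. K * \<epsilon> * z0 c" e] u_scale[of "K * \<epsilon>" z0] K1 \<epsilon> unfolding l1s by simp
        moreover have "\<bar>\<Sum>c\<in>C. l (\<lambda>c. K * \<epsilon> * z0 c) c * e c\<bar> \<le> \<Lambda> * (4 * q)"
          using order_trans[OF sum_l_le mult_left_mono[OF e]] \<Lambda>_pos by simp
        moreover have "\<Lambda> * (l1 C e)\<^sup>2 / (K * \<epsilon> * l1 C z0) \<le> \<Lambda> * (4 * q)\<^sup>2 / 1"
          using \<Lambda>_pos K1 e by (intro frac_le mult_left_mono power_mono) auto
        moreover have "(\<lambda>c. K * \<epsilon> * z0 c + e c) = (\<lambda>c. yb c - ya c)" by (simp add: e_def)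
        ultimately have "A + ln 8 / lam0 \<le> u (\<lambda>c. yb c - ya c)"
          using KW unfolding W_def abs_le_iff by simp
        then have "lam0 * (A + ln 8 / lam0) \<le> lam0 * u (\<lambda>c. yb c - ya c)"
          using lam0 by (intro mult_left_mono) auto
        then have "lam0 * (A - u (\<lambda>c. yb c - ya c)) \<le> - ln 8" using lam0 by (simp add: algebra_simps)
        then have "exp (lam0 * (A - u (\<lambda>c. yb c - ya c))) \<le> exp (- ln 8)" by (simp only: exp_le_cancel_iff)
        then have "exp (lam0 * (A - u (\<lambda>c. yb c - ya c))) \<le> 1 / 8" by (simp add: exp_minus)
        then have "stay j r (n + K) ya + stay j r (n + K) yb \<le> 5 / 4" using j[of ya yb] by linarith
        then consider "3 / 8 \<le> 1 - stay j r (n + K) ya" | "3 / 8 \<le> 1 - stay j r (n + K) yb" by linarith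
        then show ?thesis
        proof cases
          case 1
          then have "\<gamma> \<le> (\<delta> ^ m) ^ K * (1 - stay j r (n + K) ya)"
            unfolding \<gamma>_def using \<delta> by (intro mult_left_mono) auto
          then show ?thesis using ya(2) by linarith
        next
          case 2
          then have "\<gamma> \<le> (\<delta> ^ m) ^ K * (1 - stay j r (n + K) yb)"
            unfolding \<gamma>_def using \<delta> by (intro mult_left_mono) auto
          then show ?thesis using yb(2) by linarith
        qed
      qed
      then show "\<exists>j. \<forall>y. stay j r n y \<le> 1 - \<gamma>" by blast
    qed
  qed
  then show ?thesis using \<gamma> n0 by blast
qed

end

lemma (in walk_model) trans_map_cong:
  assumes "\<And>c. c \<in> C \<Longrightarrow> x c = y c" "c \<in> C"
  shows "\<pi> x c = \<pi> y c"
proof -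
  have "R x b = R y b" for b using assms(1) by (rule R_cong)
  moreover have "x b = y b" if "b \<in> C" for b using assms(1) that .
  moreover have "(fst c, w) \<in> C" if "w \<in> V (fst c)" for w using assms(2) that by (auto simp: coords_def)
  ultimately show ?thesis using assms(2) by (simp add: trans_map_eq)
qed

section \<open>The walks\<close>

locale walk_process = walk_model m V \<alpha> \<eta> \<rho> p + prob_space M
  for m and V :: "nat \<Rightarrow> 'v set" and \<alpha> \<eta> \<rho> p and M :: "'a measure" +
  fixes W :: "nat \<Rightarrow> nat \<Rightarrow> 'a \<Rightarrow> 'v"
  assumes W: "\<And>i n. i \<in> {1..m} \<Longrightarrow> n \<ge> 1 \<Longrightarrow> W i n \<in> measurable M (count_space (V i))"
    and W_step: "\<And>i v n. i \<in> {1..m} \<Longrightarrow> v \<in> V i \<Longrightarrow>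
           AE \<omega> in M. cond_prob_given M (history M m V W n) {\<omega> \<in> space M. W i (n + 1) \<omega> = v} \<omega> =
             trans_map m V \<alpha> \<eta> \<rho> (occupation m V W n \<omega>) (i, v)"
    and W_indep: "\<And>n. cond_indep_vars M (history M m V W n)
           (\<lambda>i. count_space (V i)) (\<lambda>i. W i (n + 1)) {1..m}"
begin

abbreviation F :: "nat \<Rightarrow> 'a measure" where "F n \<equiv> history M m V W n"

definition valid :: "nat \<Rightarrow> (nat \<Rightarrow> nat \<Rightarrow> 'v) \<Rightarrow> bool" where
  "valid n h \<longleftrightarrow> (\<forall>k\<in>{1..n}. h k \<in> moves)"

text \<open>For valid \<open>h\<close> these are the atoms of \<open>F n\<close>, some possibly
  empty, as finitely many variables with finitely many values generate it.\<close>

definition path_event :: "nat \<Rightarrow> (nat \<Rightarrow> nat \<Rightarrow> 'v) \<Rightarrow> 'a set" where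
  "path_event n h = {\<omega> \<in> space M. \<forall>k\<in>{1..n}. \<forall>i\<in>{1..m}. W i k \<omega> = h k i}"

definition visits :: "nat \<Rightarrow> (nat \<Rightarrow> nat \<Rightarrow> 'v) \<Rightarrow> nat \<times> 'v \<Rightarrow> real" where
  "visits n h c = 1 + (\<Sum>k=1..n. inc (h k) c)"

definition stays :: "real \<Rightarrow> nat \<Rightarrow> 'a set" where
  "stays r n = {\<omega> \<in> space M. \<forall>k\<ge>n. in_box r k (visits k (\<lambda>t i. W i t \<omega>))}"

lemma space_F: "space (F n) = space M"
  unfolding history_def by (rule space_measure_of) auto

lemma W_event: "i \<in> {1..m} \<Longrightarrow> n \<ge> 1 \<Longrightarrow> v \<in> V i \<Longrightarrow> {\<omega> \<in> space M. W i n \<omega> = v} \<in> sets M"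
  using measurable_sets[OF W, of i n "{v}"] by (simp add: vimage_def Int_def conj_commute)

lemma sets_F: "sets (F n) =
    sigma_sets (space M) {W i k -` A \<inter> space M |i k A. i \<in> {1..m} \<and> k \<in> {1..n} \<and> A \<subseteq> V i}"
  unfolding history_def by (intro sets_measure_of) auto

lemma subalgebra_F: "subalgebra M (F n)"
  unfolding subalgebra_def
proof
  show "sets (F n) \<subseteq> sets M"
    unfolding sets_F using measurable_sets[OF W]
    by (intro sets.sigma_sets_subset) auto
qed (rule space_F)

sublocale FM: sigma_finite_subalgebra M "F n" for n
proof -
  interpret finite_measure_subalgebra M "F n" by unfold_locales (rule subalgebra_F)
  show "sigma_finite_subalgebra M (F n)" by unfold_locales
qed

lemma path_event_F: "valid n h \<Longrightarrow> path_event n h \<in> sets (F n)"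
proof -
  assume h: "valid n h"
  have "{\<omega> \<in> space M. W i k \<omega> = h k i} \<in> sets (F n)" if "k \<in> {1..n}" "i \<in> {1..m}" for i k
  proof -
    have "W i k -` {h k i} \<inter> space M \<in> sets (F n)"
      unfolding sets_F using h that by (intro sigma_sets.Basic) (fastforce simp: valid_def moves_def)
    moreover have "W i k -` {h k i} \<inter> space M = {\<omega> \<in> space M. W i k \<omega> = h k i}" by auto
    ultimately show ?thesis by simp
  qed
  then have "{\<omega> \<in> space (F n). \<forall>k\<in>{1..n}. \<forall>i\<in>{1..m}. W i k \<omega> = h k i} \<in> sets (F n)"
    unfolding space_F[symmetric, of n] by (intro sets.sets_Collect_finite_All) auto
  then show ?thesis by (simp add: path_event_def space_F)
qed

lemma path_event_M: "valid n h \<Longrightarrow> path_event n h \<in> sets M"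
  using path_event_F[of n h] subalgebra_F[of n] unfolding subalgebra_def by blast

lemma occupation_eq:
  assumes "c \<in> C" shows "occupation m V W n \<omega> c = emp n (visits n (\<lambda>t i. W i t \<omega>)) c"
  using assms by (simp add: occupation_def emp_def visits_def inc_def case_prod_beta)

lemma visits_path_event:
  assumes "\<omega> \<in> path_event n h" "c \<in> C"
  shows "visits n (\<lambda>t i. W i t \<omega>) c = visits n h c"
  using assms fst_C[OF assms(2)] by (simp add: visits_def path_event_def inc_def)

text \<open>On a path event the occupation measure is determined, so the conditional probability of
  the next joint move is constant there; integrating it over this event of \<open>F n\<close> gives
  the product.\<close>

lemma prob_path_event_extend:
  assumes h: "valid n h" and f: "f \<in> moves"
  shows "prob (path_event (Suc n) (h(Suc n := f))) = prob (path_event n h) * move_prob (emp n (visits n h)) f"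
proof -
  define D where "D i = W i (n + 1) -` {f i} \<inter> space M" for i
  define E where "E = path_event n h"
  define Q where "Q = (\<Inter>i\<in>{1..m}. D i)"
  have D_eq: "D i = {\<omega> \<in> space M. W i (n + 1) \<omega> = f i}" for i by (auto simp: D_def)
  have fV: "f i \<in> V i" if "i \<in> {1..m}" for i using f that by (auto simp: moves_def)
  have ne: "{1..m} \<noteq> {}" using m_pos by simp
  have Q: "Q \<in> sets M" unfolding Q_def D_eq using fV m_pos by (intro sets.finite_INT W_event) auto
  have E: "E \<in> sets (F n)" "E \<in> sets M" using path_event_F path_event_M h by (auto simp: E_def)
  have ext: "path_event (Suc n) (h(Suc n := f)) = E \<inter> Q"
  proof -
    have "{1..Suc n} = insert (Suc n) {1..n}" by auto
    then show ?thesis using ne unfolding path_event_def E_def Q_def D_def by (auto split: if_splits)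
  qed
  have "AE \<omega> in M. cond_prob_given M (F n) Q \<omega> = (\<Prod>i\<in>{1..m}. cond_prob_given M (F n) (D i) \<omega>)"
    using W_indep[of n] ne unfolding cond_indep_vars_def Q_def D_def
    by (auto elim!: allE[of _ "{1..m}"] allE[of _ "\<lambda>i. {f i}"] simp: fV)
  moreover have "AE \<omega> in M. \<forall>i\<in>{1..m}. cond_prob_given M (F n) (D i) \<omega> = \<pi> (occupation m V W n \<omega>) (i, f i)"
    using W_step fV unfolding D_eq by (intro AE_finite_allI) auto
  ultimately have AE: "AE \<omega> in M. \<omega> \<in> E \<longrightarrow> cond_prob_given M (F n) Q \<omega> = move_prob (emp n (visits n h)) f"
  proof eventually_elim
    case (elim \<omega>)
    show ?case
    proof
      assume \<omega>: "\<omega> \<in> E"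
      have "\<pi> (occupation m V W n \<omega>) (i, f i) = \<pi> (emp n (visits n h)) (i, f i)" if "i \<in> {1..m}" for i
        using fV[OF that] that visits_path_event[OF \<omega>[unfolded E_def]]
        by (intro trans_map_cong) (auto simp: in_C occupation_eq emp_def)
      then show "cond_prob_given M (F n) Q \<omega> = move_prob (emp n (visits n h)) f"
        using elim by (simp add: move_prob_def)
    qed
  qed
  have "prob (E \<inter> Q) = (\<integral>x\<in>E. indicator Q x \<partial>M)"
    using E Q by (simp add: set_lebesgue_integral_def flip: indicator_inter_arith)
  also have "\<dots> = (\<integral>x\<in>E. real_cond_exp M (F n) (indicator Q) x \<partial>M)"
    using E Q by (intro FM.real_cond_exp_intA) (auto simp: emeasure_eq_measure)
  also have "\<dots> = (\<integral>x\<in>E. move_prob (emp n (visits n h)) f \<partial>M)"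
    using E AE unfolding cond_prob_given_def
    by (intro set_lebesgue_integral_cong_AE) (auto intro: measurable_from_subalg[OF subalgebra_F])
  also have "\<dots> = prob E * move_prob (emp n (visits n h)) f"
    using E by (simp add: set_lebesgue_integral_def)
  finally show ?thesis by (simp add: ext E_def)
qed

lemma in_box_path_event:
  assumes "\<omega> \<in> path_event n h"
  shows "in_box r n (visits n (\<lambda>t i. W i t \<omega>)) \<longleftrightarrow> in_box r n (visits n h)"
proof -
  have "visits n (\<lambda>t i. W i t \<omega>) c = visits n h c" if "c \<in> C" for c
    using visits_path_event[OF assms that] .
  moreover from this have "(\<Sum>v\<in>V i. visits n (\<lambda>t i. W i t \<omega>) (i, v)) = (\<Sum>v\<in>V i. visits n h (i, v))"
    if "i \<in> {1..m}" for i using that by (intro sum.cong refl) (simp add: in_C)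
  ultimately show ?thesis by (simp add: in_box_def near_def emp_def)
qed

lemma path_event_split:
  assumes "\<omega> \<in> path_event n h"
  obtains f where "f \<in> moves" "\<omega> \<in> path_event (Suc n) (h(Suc n := f))"
proof
  show "restrict (\<lambda>i. W i (Suc n) \<omega>) {1..m} \<in> moves"
    using assms measurable_space[OF W] by (auto simp: moves_def path_event_def)
  show "\<omega> \<in> path_event (Suc n) (h(Suc n := restrict (\<lambda>i. W i (Suc n) \<omega>) {1..m}))"
    using assms by (auto simp: path_event_def)
qed

text \<open>The measurability of \<open>stays r n\<close> is avoided by bounding it by measurable supersets.\<close>

lemma stays_bound_step:
  assumes base: "\<And>n h. n \<ge> n0 \<Longrightarrow> valid n h \<Longrightarrow>
      \<exists>S\<in>sets M. path_event n h \<inter> stays r n \<subseteq> S \<and> prob S \<le> prob (path_event n h) * e"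
    and "n \<ge> n0" "valid n h"
  shows "\<exists>S\<in>sets M. path_event n h \<inter> stays r n \<subseteq> S \<and>
      prob S \<le> prob (path_event n h) * (stay j r n (visits n h) * e)"
  using assms(2,3)
proof (induction j arbitrary: n h)
  case 0
  show ?case
  proof (cases "in_box r n (visits n h)")
    case True
    then show ?thesis using base[OF 0] by simp
  next
    case False
    then have "path_event n h \<inter> stays r n = {}" using in_box_path_event by (auto simp: stays_def)
    then show ?thesis using False by (intro bexI[of _ "{}"]) auto
  qed
next
  case (Suc j)
  show ?case
  proof (cases "in_box r n (visits n h)")
    case True
    define h' where "h' f = h(Suc n := f)" for f
    have valid: "valid (Suc n) (h' f)" if "f \<in> moves" for f
      using Suc.prems(2) that by (auto simp: valid_def h'_def le_Suc_eq)
    have "\<forall>f\<in>moves. \<exists>S. S \<in> sets M \<and> path_event (Suc n) (h' f) \<inter> stays r (Suc n) \<subseteq> S \<and>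
        prob S \<le> prob (path_event (Suc n) (h' f)) * (stay j r (Suc n) (visits (Suc n) (h' f)) * e)"
      using Suc.IH[OF _ valid] Suc.prems(1) by (meson le_Suc_eq)
    from bchoice[OF this] obtain S where S: "\<And>f. f \<in> moves \<Longrightarrow> S f \<in> sets M"
      "\<And>f. f \<in> moves \<Longrightarrow> path_event (Suc n) (h' f) \<inter> stays r (Suc n) \<subseteq> S f"
      "\<And>f. f \<in> moves \<Longrightarrow> prob (S f) \<le> prob (path_event (Suc n) (h' f)) * (stay j r (Suc n) (visits (Suc n) (h' f)) * e)"
      by blast
    have visits: "visits (Suc n) (h' f) = (\<lambda>c. visits n h c + inc f c)" for f
      by (auto simp: visits_def h'_def intro!: sum.cong)
    show ?thesis
    proof (intro bexI[of _ "\<Union>f\<in>moves. S f"] conjI)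
      show "(\<Union>f\<in>moves. S f) \<in> sets M" using S(1) finite_moves by auto
      show "path_event n h \<inter> stays r n \<subseteq> (\<Union>f\<in>moves. S f)"
      proof
        fix \<omega> assume \<omega>: "\<omega> \<in> path_event n h \<inter> stays r n"
        then obtain f where f: "f \<in> moves" "\<omega> \<in> path_event (Suc n) (h' f)"
          unfolding h'_def using path_event_split by blast
        have "\<omega> \<in> stays r (Suc n)" using \<omega> by (auto simp: stays_def)
        then show "\<omega> \<in> (\<Union>f\<in>moves. S f)" using f S(2) by blast
      qed
      \<comment> \<open>The union bound over the next joint move reproduces the recursion of
        \<open>stay\<close>.\<close>
      have "prob (\<Union>f\<in>moves. S f) \<le> (\<Sum>f\<in>moves. prob (S f))"
        using S(1) finite_moves by (intro finite_measure_subadditive_finite) auto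
      also have "\<dots> \<le> (\<Sum>f\<in>moves. prob (path_event n h) * (move_prob (emp n (visits n h)) f *
          stay j r (Suc n) (\<lambda>c. visits n h c + inc f c) * e))"
        using S(3) prob_path_event_extend[OF Suc.prems(2)]
        by (intro sum_mono) (simp add: visits h'_def[symmetric] mult.assoc)
      also have "\<dots> = prob (path_event n h) * (stay (Suc j) r n (visits n h) * e)"
        using True by (simp flip: sum_distrib_left sum_distrib_right)
      finally show "prob (\<Union>f\<in>moves. S f) \<le> prob (path_event n h) * (stay (Suc j) r n (visits n h) * e)" .
    qed
  next
    case False
    then have "path_event n h \<inter> stays r n = {}" using in_box_path_event by (auto simp: stays_def)
    then show ?thesis using False by (intro bexI[of _ "{}"]) auto
  qed
qed

text \<open>Each application of \<open>stays_bound_step\<close> spends one time window and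
  multiplies the bound by 1 - \<delta>. The induction counts windows, so their lengths may depend on
  the starting time.\<close>

lemma stays_bound:
  assumes escape: "\<And>n. n \<ge> n0 \<Longrightarrow> \<exists>j. \<forall>y. stay j r n y \<le> 1 - \<delta>" and \<delta>: "0 < \<delta>" "\<delta> \<le> 1"
    and "n \<ge> n0" "valid n h"
  shows "\<exists>S\<in>sets M. path_event n h \<inter> stays r n \<subseteq> S \<and> prob S \<le> prob (path_event n h) * (1 - \<delta>) ^ N"
  using assms(4,5)
proof (induction N arbitrary: n h)
  case 0
  then show ?case using path_event_M by (intro bexI[of _ "path_event n h"]) auto
next
  case (Suc N)
  obtain j where j: "\<And>y. stay j r n y \<le> 1 - \<delta>" using escape[OF Suc.prems(1)] by blast
  obtain S where S: "S \<in> sets M" "path_event n h \<inter> stays r n \<subseteq> S"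
    "prob S \<le> prob (path_event n h) * (stay j r n (visits n h) * (1 - \<delta>) ^ N)"
    using stays_bound_step[OF Suc.IH Suc.prems, of j] by blast
  have "prob S \<le> prob (path_event n h) * ((1 - \<delta>) * (1 - \<delta>) ^ N)"
    using j \<delta> by (intro order_trans[OF S(3)] mult_left_mono mult_right_mono) auto
  then show ?case using S by auto
qed

lemma stays_null:
  assumes "\<And>n. n \<ge> n0 \<Longrightarrow> \<exists>j. \<forall>y. stay j r n y \<le> 1 - \<delta>" "0 < \<delta>" "\<delta> \<le> 1" "n \<ge> n0"
  shows "\<exists>N\<in>null_sets M. stays r n \<subseteq> N"
proof -
  have path: "\<exists>N\<in>null_sets M. path_event n h \<inter> stays r n \<subseteq> N" if h: "valid n h" for h
  proof -
    have "\<forall>k. \<exists>S. S \<in> sets M \<and> path_event n h \<inter> stays r n \<subseteq> S \<and> prob S \<le> prob (path_event n h) * (1 - \<delta>) ^ k"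
      using stays_bound[OF assms h] by blast
    then obtain S where S: "\<And>k. S k \<in> sets M" "\<And>k. path_event n h \<inter> stays r n \<subseteq> S k"
      "\<And>k. prob (S k) \<le> prob (path_event n h) * (1 - \<delta>) ^ k" by metis
    have I: "(\<Inter>k. S k) \<in> sets M" using S(1) by auto
    have "prob (\<Inter>k. S k) \<le> prob (path_event n h) * (1 - \<delta>) ^ k" for k
      using S by (intro order_trans[OF finite_measure_mono S(3)]) auto
    moreover have "(\<lambda>k. prob (path_event n h) * (1 - \<delta>) ^ k) \<longlonglongrightarrow> prob (path_event n h) * 0"
      using assms(2,3) by (intro tendsto_mult tendsto_const LIMSEQ_power_zero) auto
    ultimately have "prob (\<Inter>k. S k) \<le> prob (path_event n h) * 0" by (intro LIMSEQ_le_const) auto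
    then have "prob (\<Inter>k. S k) = 0" by (simp add: measure_le_0_iff)
    then have "(\<Inter>k. S k) \<in> null_sets M" using I by (auto simp: null_sets_def emeasure_eq_measure)
    then show ?thesis using S(2) by blast
  qed
  \<comment> \<open>\<open>valid\<close> leaves a history free outside {1..n}; the extensional ones
    form a finite set that still covers every path.\<close>
  define P where "P = (\<Pi>\<^sub>E k\<in>{1..n}. moves)"
  have finP: "finite P" unfolding P_def using finite_moves by (intro finite_PiE) auto
  have "\<forall>h\<in>P. \<exists>N. N \<in> null_sets M \<and> path_event n h \<inter> stays r n \<subseteq> N"
  proof
    fix h assume "h \<in> P"
    then have "valid n h" by (auto simp: P_def valid_def)
    from path[OF this] show "\<exists>N. N \<in> null_sets M \<and> path_event n h \<inter> stays r n \<subseteq> N" by blast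
  qed
  from bchoice[OF this] obtain N where N: "\<And>h. h \<in> P \<Longrightarrow> N h \<in> null_sets M"
    "\<And>h. h \<in> P \<Longrightarrow> path_event n h \<inter> stays r n \<subseteq> N h" by blast
  have "(\<Union>h\<in>P. N h) \<in> null_sets M" using N(1) finP by (intro null_sets_UN') (auto intro: countable_finite)
  moreover have "stays r n \<subseteq> (\<Union>h\<in>P. N h)"
  proof
    fix \<omega> assume \<omega>: "\<omega> \<in> stays r n"
    define h where "h = (\<lambda>k\<in>{1..n}. \<lambda>i\<in>{1..m}. W i k \<omega>)"
    have sp: "\<omega> \<in> space M" using \<omega> by (simp add: stays_def)
    have "W i k \<omega> \<in> V i" if "i \<in> {1..m}" "k \<in> {1..n}" for i k
      using measurable_space[OF W[OF that(1)] sp] that(2) by auto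
    then have "h \<in> P" by (auto simp: h_def P_def moves_def)
    moreover have "\<omega> \<in> path_event n h" using sp by (auto simp: path_event_def h_def)
    ultimately show "\<omega> \<in> (\<Union>h\<in>P. N h)" using N(2) \<omega> by blast
  qed
  ultimately show ?thesis by blast
qed

text \<open>Convergence of functions is convergence of each coordinate, which gives the condition on
  \<open>emp\<close> at all late times. The totals are right at every time, as each step adds one
  visit per walk.\<close>

lemma converges_imp_stays:
  assumes \<omega>: "\<omega> \<in> space M" and lim: "(\<lambda>n. occupation m V W n \<omega>) \<longlonglongrightarrow> p" and r: "0 < r"
  shows "\<exists>n\<ge>n0. \<omega> \<in> stays r n"
proof -
  have "\<forall>\<^sub>F n in sequentially. \<forall>c\<in>C. \<bar>occupation m V W n \<omega> c - p c\<bar> < r"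
  proof (intro eventually_ball_finite finite_C ballI)
    fix c
    have "(\<lambda>n. occupation m V W n \<omega> c) \<longlonglongrightarrow> p c"
      by (rule continuous_on_tendsto_compose[OF continuous_on_product_coordinates lim]) auto
    then show "\<forall>\<^sub>F n in sequentially. \<bar>occupation m V W n \<omega> c - p c\<bar> < r"
      using r by (auto simp: tendsto_iff dist_real_def)
  qed
  then obtain n1 where n1: "\<And>n. n \<ge> n1 \<Longrightarrow> \<forall>c\<in>C. \<bar>occupation m V W n \<omega> c - p c\<bar> < r"
    unfolding eventually_sequentially by blast
  have sum: "(\<Sum>v\<in>V i. visits n (\<lambda>t i. W i t \<omega>) (i, v)) = card (V i) + real n" if i: "i \<in> {1..m}" for i n
  proof -
    have "(\<Sum>v\<in>V i. inc (\<lambda>i. W i k \<omega>) (i, v)) = 1" if "k \<in> {1..n}" for k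
    proof -
      have "W i k \<omega> \<in> V i" using measurable_space[OF W[OF i] \<omega>] that by auto
      then have "(\<Sum>v\<in>V i. if W i k \<omega> = v then 1 else 0) = (1 :: real)"
        using finite_V[OF i] by (subst sum.delta') auto
      then show ?thesis by (simp only: inc_def of_bool_def fst_conv snd_conv)
    qed
    then have "(\<Sum>k=1..n. \<Sum>v\<in>V i. inc (\<lambda>i. W i k \<omega>) (i, v)) = real n" by simp
    then show ?thesis by (simp add: visits_def sum.distrib) (subst sum.swap, simp)
  qed
  have "in_box r k (visits k (\<lambda>t i. W i t \<omega>))" if "k \<ge> max n0 n1" for k
    using n1[of k] that sum by (auto simp: in_box_def near_def occupation_eq intro: less_imp_le)
  then show ?thesis using \<omega> by (intro exI[of _ "max n0 n1"]) (auto simp: stays_def)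
qed

lemma no_convergence:
  assumes "1 \<notin> spectrum Jac" "\<exists>z\<in>T. bil z z > 0"
  shows "prob {\<omega> \<in> space M. (\<lambda>n. occupation m V W n \<omega>) \<longlonglongrightarrow> p} = 0"
proof -
  obtain u l \<Lambda> c1 where gauge: "gauge_model_axioms m V \<alpha> \<eta> \<rho> p u l \<Lambda> c1"
    by (rule gauge_exists[OF assms]) (rule that, unfold_locales, assumption+)
  interpret gauge_model m V \<alpha> \<eta> \<rho> p u l \<Lambda> c1
    using walk_model_axioms gauge by (rule gauge_model.intro)
  obtain \<delta> n0 where \<delta>: "\<delta> > 0"
    and esc: "\<forall>\<^sub>F r in at_right 0. \<forall>n\<ge>n0. \<exists>j. \<forall>y. stay j r n y \<le> 1 - \<delta>"
    using escape by blast
  from esc eventually_at_right_less[of 0]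
  have "\<forall>\<^sub>F r in at_right 0. (\<forall>n\<ge>n0. \<exists>j. \<forall>y. stay j r n y \<le> 1 - \<delta>) \<and> 0 < r"
    by (rule eventually_conj)
  then obtain r where r: "\<And>n. n \<ge> n0 \<Longrightarrow> \<exists>j. \<forall>y. stay j r n y \<le> 1 - \<delta>" "0 < r"
    using eventually_happens'[OF trivial_limit_at_right_real] by blast
  \<comment> \<open>Capped so that 1 - \<delta>' is nonnegative and its powers tend to 0.\<close>
  define \<delta>' where "\<delta>' = min \<delta> 1"
  have esc': "\<exists>j. \<forall>y. stay j r n y \<le> 1 - \<delta>'" if "n \<ge> n0" for n
  proof -
    obtain j where j: "\<And>y. stay j r n y \<le> 1 - \<delta>" using r(1)[OF \<open>n \<ge> n0\<close>] by blast
    have "1 - \<delta> \<le> 1 - \<delta>'" by (simp add: \<delta>'_def)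
    then show ?thesis using j order_trans by blast
  qed
  have \<delta>': "0 < \<delta>'" "\<delta>' \<le> 1" using \<delta> by (auto simp: \<delta>'_def)
  have "\<forall>n\<in>{n0..}. \<exists>N. N \<in> null_sets M \<and> stays r n \<subseteq> N"
    using stays_null[OF esc' \<delta>'] by blast
  from bchoice[OF this] obtain N where N: "\<And>n. n \<ge> n0 \<Longrightarrow> N n \<in> null_sets M" "\<And>n. n \<ge> n0 \<Longrightarrow> stays r n \<subseteq> N n"
    by auto
  define Z where "Z = (\<Union>n\<in>{n0..}. N n)"
  have Z: "Z \<in> null_sets M" unfolding Z_def using N(1) by (intro null_sets_UN') auto
  define X where "X = {\<omega> \<in> space M. (\<lambda>n. occupation m V W n \<omega>) \<longlonglongrightarrow> p}"
  have "X \<subseteq> Z"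
  proof
    fix \<omega> assume "\<omega> \<in> X"
    then obtain n where "n \<ge> n0" "\<omega> \<in> stays r n" using converges_imp_stays[OF _ _ r(2)] unfolding X_def by blast
    then show "\<omega> \<in> Z" using N(2) unfolding Z_def by blast
  qed
  \<comment> \<open>\<open>X\<close> lies in the null set \<open>Z\<close> in any case; were it not
    measurable, its measure would be 0 by convention.\<close>
  have "prob X = 0"
  proof (cases "X \<in> sets M")
    case True
    then have "X \<in> null_sets M" using null_sets_subset[OF Z] \<open>X \<subseteq> Z\<close> by blast
    then show ?thesis by (simp add: measure_eq_0_null_sets)
  qed (rule measure_notin_sets)
  then show ?thesis by (simp only: X_def)
qed

end

theorem theorem3:
  fixes m :: nat and V :: "nat \<Rightarrow> 'v set"
    and \<alpha> :: real and \<eta> :: "nat \<Rightarrow> 'v \<Rightarrow> real" and \<rho> :: "'v \<Rightarrow> nat \<Rightarrow> nat \<Rightarrow> real"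
    and M :: "'a measure" and W :: "nat \<Rightarrow> nat \<Rightarrow> 'a \<Rightarrow> 'v"
    and p :: "nat \<times> 'v \<Rightarrow> real"
  assumes m: "m \<ge> 1"
    and V: "\<And>i. i \<in> {1..m} \<Longrightarrow> finite (V i) \<and> V i \<noteq> {}"
    and \<alpha>: "\<alpha> > 0"
    and \<eta>: "\<And>i v. i \<in> {1..m} \<Longrightarrow> v \<in> V i \<Longrightarrow> \<eta> i v > 0"
    and \<rho>_sym: "\<And>v i j. i \<in> walks_at m V v \<Longrightarrow> j \<in> walks_at m V v \<Longrightarrow> \<rho> v i j = \<rho> v j i"
    and \<eta>_\<rho>: "\<And>i v. i \<in> {1..m} \<Longrightarrow> v \<in> V i \<Longrightarrow>
           \<eta> i v > (\<Sum>j \<in> {j \<in> walks_at m V v. \<rho> v i j < 0}. \<bar>\<rho> v i j\<bar>)"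
    and M: "prob_space M"
    and W: "\<And>i n. i \<in> {1..m} \<Longrightarrow> n \<ge> 1 \<Longrightarrow> W i n \<in> measurable M (count_space (V i))"
    and W_step: "\<And>i v n. i \<in> {1..m} \<Longrightarrow> v \<in> V i \<Longrightarrow>
           AE \<omega> in M. cond_prob_given M (history M m V W n) {\<omega> \<in> space M. W i (n + 1) \<omega> = v} \<omega> =
             trans_map m V \<alpha> \<eta> \<rho> (occupation m V W n \<omega>) (i, v)"
    and W_indep: "\<And>n. cond_indep_vars M (history M m V W n)
           (\<lambda>i. count_space (V i)) (\<lambda>i. W i (n + 1)) {1..m}"
    and p: "p \<in> simplex_prod_pos m V"
    and p_fix: "trans_map m V \<alpha> \<eta> \<rho> p = p"
    and hyperbolic: "\<And>z. z \<in> spectrum (jacobian_mat (coords m V) (trans_map m V \<alpha> \<eta> \<rho>) p) \<Longrightarrow> Re z \<noteq> 1"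
    and unstable: "\<exists>z \<in> spectrum (jacobian_mat (coords m V) (trans_map m V \<alpha> \<eta> \<rho>) p). Re z > 1"
  shows "\<P>(\<omega> in M. (\<lambda>n. occupation m V W n \<omega>) \<longlonglongrightarrow> p) = 0"
proof -
  interpret prob_space M by (rule M)
  interpret walk_process m V \<alpha> \<eta> \<rho> p M W
    by unfold_locales (fact m V \<alpha> \<rho>_sym \<eta>_\<rho> p p_fix W W_step W_indep)+
  \<comment> \<open>Hyperbolicity enters at the eigenvalue 1, where it makes \<open>B\<close>
    injective on \<open>T\<close>.\<close>
  have "1 \<notin> spectrum Jac" using hyperbolic by force
  moreover have "\<exists>z\<in>T. bil z z > 0" using unstable unstable_direction by blast
  ultimately show ?thesis by (rule no_convergence)
qed

end
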